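(* Let $A=\mathrm{k}\Delta/I^N$ be a truncated quiver algebra. Then the product $\vee$ in $\mathbf P^*$ induces the Yoneda product in the Hochschild cohomology $H^*(A,A)$ (that is, if $f\in\mathbf P^*_{m}$ and $g\in\mathbf P^*_{n}$ are cocycles then $f\vee g$ is a cocycle representing the Yoneda product of the classes of $f$ and $g$), and thus $H^*(A,A)$ is a bigraded commutative ring with respect to the bigrading $H^n(A,A)=\bigoplus_{i=0}^{N-1}H^n_i$ inherited from $\mathbf P^*$. In particular the Yoneda product of two odd-degree cohomology classes is zero.
   Context: $\mathrm{k}$ is a field of characteristic $0$; $\Delta$ is a finite connected quiver (multiple arrows and loops allowed) with vertex set $\Delta_0$ and arrow set $\Delta_1$; $o$ and $t$ denote source and end of arrows and paths. $\Delta_n$ is the set of paths of length $n$ (vertices are the paths of length $0$; $a_1\dots a_n$ is a path if $t(a_i)=o(a_{i+1})$), and $\mathrm{k}\Delta=\bigoplus_{n\ge0}\mathrm{k}\Delta_n$ is the path algebra with product given by concatenation ($\alpha\beta=0$ if $t(\alpha)\ne o(\beta)$). $I$ is the two-sided ideal generated by $\Delta_1$, $N$ is a positive integer, and $A=\mathrm{k}\Delta/I^N$; paths of length $<N$ form a basis of $A$ and paths of length $\ge N$ are zero in $A$. $A^e=A\otimes_{\mathrm k}A^{op}$ and $H^n(A,A)=\mathrm{Ext}^n_{A^e}(A,A)$ with the Yoneda product, which coincides with the cup product, induced by $(f\cup g)(\alpha_1\otimes\dots\otimes\alpha_{m+n})=f(\alpha_1\otimes\dots\otimes\alpha_m)\,g(\alpha_{m+1}\otimes\dots\otimes\alpha_{m+n})$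 on cochains of the bar complex. The minimal $A^e$-projective resolution $(\mathbf P,d)$ of $A$ (tensors over $\mathrm{k}\Delta_0$) is $\mathbf P_{2k}=A\otimes\mathrm{k}\Delta_{kN}\otimes A$, $\mathbf P_{2k+1}=A\otimes\mathrm{k}\Delta_{kN+1}\otimes A$, with augmentation $\epsilon:\mathbf P_0=A\otimes A\to A$, $\epsilon(\alpha\otimes\beta)=\alpha\beta$, and $$d_{2k}(\alpha\otimes v_1\dots v_{kN}\otimes\beta)=\sum_{j=0}^{N-1}\alpha v_1\dots v_j\otimes v_{j+1}\dots v_{j+(k-1)N+1}\otimes v_{j+(k-1)N+2}\dots v_{kN}\beta,$$ $$d_{2k+1}(\alpha\otimes v_1\dots v_{kN+1}\otimes\beta)=\alpha v_1\otimes v_2\dots v_{kN+1}\otimes\beta-\alpha\otimes v_1\dots v_{kN}\otimes v_{kN+1}\beta.$$ Two paths are parallel if they have the same source and the same end; $\Delta_i/\!/\Delta_j$ is the set of pairs $(\alpha,\beta)$ of parallel paths with $\alpha\in\Delta_i$, $\beta\in\Delta_j$, and $\mathrm{k}\,\Delta_i/\!/\Delta_j$ the vector space with this basis. Put $\mathbf P^*_{2k,i}=\mathrm{k}\,\Delta_i/\!/\Delta_{kN}$, $\mathbf P^*_{2k+1,i}=\mathrm{k}\,\Delta_i/\!/\Delta_{kN+1}$ for $0\le i\le N-1$, $\mathbf P^*_n=\bigoplus_{i=0}^{N-1}\mathbf P^*_{n,i}$, $\mathbf P^*=\bigoplus_{n\ge0}\mathbf P^*_n$. Then $\mathbf P^*_n$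 is identified with $\mathrm{Hom}_{A^e}(\mathbf P_n,A)$, where $(\alpha,\pi)$ corresponds to the bimodule map sending $1\otimes\pi\otimes1$ to $\alpha$ and $1\otimes\pi'\otimes1$ to $0$ for every path $\pi'\ne\pi$ of the same length as $\pi$; $\mathbf P^*$ is a cochain complex with differential $f\mapsto f\circ d$, and its cohomology is $H^*(A,A)$. This differential maps $\mathbf P^*_{2k,i}$ to $\mathbf P^*_{2k+1,i+1}$ (to $0$ if $i=N-1$), maps $\mathbf P^*_{2k+1,0}$ to $\mathbf P^*_{2k+2,N-1}$, and is zero on $\mathbf P^*_{2k+1,i}$ for $i\ge1$; hence $H^n(A,A)=\bigoplus_{i=0}^{N-1}H^n_i$, where $H^n_i$ is the space of classes of cocycles in $\mathbf P^*_{n,i}$. Being bigraded means that the product maps $H^m_i\times H^n_j$ into $H^{m+n}_{i+j}$, with $H^{m+n}_{i+j}=0$ if $i+j\ge N$. The bilinear product $\vee$ on $\mathbf P^*$ is defined for $(\alpha,\pi)\in\mathbf P^*_{n_1}$, $(\beta,\tau)\in\mathbf P^*_{n_2}$ by $(\alpha,\pi)\vee(\beta,\tau)=(\alpha\beta,\pi\tau)$ if $n_1$ or $n_2$ is even, and $0$ otherwise; here $(\alpha\beta,\pi\tau)$ is understood to be $0$ if the paths cannot be concatenated or if $\alpha\beta=0$ in $A$. *)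

theory Defs
  imports
    "HOL-Library.Poly_Mapping"
    "HOL-Library.Set_Algebras"
    "HOL-Algebra.Ideal_Product"
    "HOL-Algebra.QuotRing"
    "Graph_Theory.Digraph_Component"
begin

section \<open>Vector spaces with a given basis\<close>

text \<open>
  The vector space with basis \<open>B\<close> over the field \<open>'k\<close> is the set of all finitely supported
  functions whose support lies in \<open>B\<close>; the basis vector \<open>b\<close> is \<open>Poly_Mapping.single b 1\<close>.
\<close>

definition free_on :: "'b set \<Rightarrow> ('b \<Rightarrow>\<^sub>0 'k::zero) set" where
  "free_on B = {x. Poly_Mapping.keys x \<subseteq> B}"

definition scal :: "'k::field \<Rightarrow> ('b \<Rightarrow>\<^sub>0 'k) \<Rightarrow> ('b \<Rightarrow>\<^sub>0 'k)" where
  "scal c x = Poly_Mapping.map ((*) c) x"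

text \<open>The linear, respectively bilinear, extension of a map given on basis vectors.\<close>

definition lin_ext :: "('b \<Rightarrow> ('c \<Rightarrow>\<^sub>0 'k::field)) \<Rightarrow> ('b \<Rightarrow>\<^sub>0 'k) \<Rightarrow> ('c \<Rightarrow>\<^sub>0 'k)" where
  "lin_ext F x = (\<Sum>b\<in>Poly_Mapping.keys x. scal (Poly_Mapping.lookup x b) (F b))"

definition bilin_ext ::
  "('b \<Rightarrow> 'c \<Rightarrow> ('d \<Rightarrow>\<^sub>0 'k::field)) \<Rightarrow> ('b \<Rightarrow>\<^sub>0 'k) \<Rightarrow> ('c \<Rightarrow>\<^sub>0 'k) \<Rightarrow> ('d \<Rightarrow>\<^sub>0 'k)" where
  "bilin_ext F x y = lin_ext (\<lambda>b. lin_ext (F b) y) x"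


section \<open>Paths and the truncated quiver algebra\<close>

text \<open>
  A path is its source together with its list of arrows, so that the vertex \<open>v\<close> is the path
  \<open>(v, [])\<close> of length 0. A quiver is a \<open>pre_digraph\<close> (which admits loops and multiple arrows).
\<close>

type_synonym ('v, 'a) qpath = "'v \<times> 'a list"

definition psrc :: "('v, 'a) qpath \<Rightarrow> 'v" where
  "psrc p = fst p"

definition ptgt :: "('v, 'a) pre_digraph \<Rightarrow> ('v, 'a) qpath \<Rightarrow> 'v" where
  "ptgt Q p = pre_digraph.awlast Q (fst p) (snd p)"

definition plen :: "('v, 'a) qpath \<Rightarrow> nat" where
  "plen p = length (snd p)"

definition pcat :: "('v, 'a) qpath \<Rightarrow> ('v, 'a) qpath \<Rightarrow> ('v, 'a) qpath" where
  "pcat p q = (fst p, snd p @ snd q)"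

definition qpaths :: "('v, 'a) pre_digraph \<Rightarrow> nat \<Rightarrow> ('v, 'a) qpath set" where
  "qpaths Q n = {p. pre_digraph.awalk Q (psrc p) (snd p) (ptgt Q p) \<and> plen p = n}"

text \<open>\<open>psub Q (v\<^sub>1\<dots>v\<^sub>n) i l\<close> is the subpath \<open>v\<^bsub>i+1\<^esub>\<dots>v\<^bsub>i+l\<^esub>\<close>.\<close>

definition psub :: "('v, 'a) pre_digraph \<Rightarrow> ('v, 'a) qpath \<Rightarrow> nat \<Rightarrow> nat \<Rightarrow> ('v, 'a) qpath" where
  "psub Q p i l = (ptgt Q (fst p, take i (snd p)), take l (drop i (snd p)))"

definition kmul :: "('v, 'a) pre_digraph \<Rightarrow> (('v, 'a) qpath \<Rightarrow>\<^sub>0 'k::field) \<Rightarrow>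
    (('v, 'a) qpath \<Rightarrow>\<^sub>0 'k) \<Rightarrow> (('v, 'a) qpath \<Rightarrow>\<^sub>0 'k)" where
  "kmul Q = bilin_ext (\<lambda>p q. if ptgt Q p = psrc q then Poly_Mapping.single (pcat p q) 1 else 0)"

definition kone :: "('v, 'a) pre_digraph \<Rightarrow> (('v, 'a) qpath \<Rightarrow>\<^sub>0 'k::field)" where
  "kone Q = (\<Sum>v\<in>verts Q. Poly_Mapping.single (v, []) 1)"

definition path_alg :: "('v, 'a) pre_digraph \<Rightarrow> (('v, 'a) qpath \<Rightarrow>\<^sub>0 'k::field) ring" where
  "path_alg Q = \<lparr>carrier = free_on (\<Union>n. qpaths Q n), monoid.mult = kmul Q, one = kone Q,
                 zero = 0, add = (+)\<rparr>"

definition arrow_ideal :: "('v, 'a) pre_digraph \<Rightarrow> (('v, 'a) qpath \<Rightarrow>\<^sub>0 'k::field) set" where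
  "arrow_ideal Q = genideal (path_alg Q) {Poly_Mapping.single a 1 |a. a \<in> qpaths Q 1}"

text \<open>
  \<open>A = k\<Delta>/I\<^sup>N\<close> is realised on its basis of paths of length less than \<open>N\<close>, paths of length
  at least \<open>N\<close> being zero. Lemma \<open>trunc_alg_iso\<close> below confirms that this is the quotient
  of the path algebra by the \<open>N\<close>-th power of the arrow ideal.
\<close>

definition trunc :: "nat \<Rightarrow> (('v, 'a) qpath \<Rightarrow>\<^sub>0 'k::field) \<Rightarrow> (('v, 'a) qpath \<Rightarrow>\<^sub>0 'k)" where
  "trunc N = lin_ext (\<lambda>p. if plen p < N then Poly_Mapping.single p 1 else 0)"

definition alg_basis :: "('v, 'a) pre_digraph \<Rightarrow> nat \<Rightarrow> ('v, 'a) qpath set" where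
  "alg_basis Q N = (\<Union>n<N. qpaths Q n)"

definition amul :: "('v, 'a) pre_digraph \<Rightarrow> nat \<Rightarrow> (('v, 'a) qpath \<Rightarrow>\<^sub>0 'k::field) \<Rightarrow>
    (('v, 'a) qpath \<Rightarrow>\<^sub>0 'k) \<Rightarrow> (('v, 'a) qpath \<Rightarrow>\<^sub>0 'k)" where
  "amul Q N x y = trunc N (kmul Q x y)"

definition trunc_alg :: "('v, 'a) pre_digraph \<Rightarrow> nat \<Rightarrow> (('v, 'a) qpath \<Rightarrow>\<^sub>0 'k::field) ring" where
  "trunc_alg Q N = \<lparr>carrier = free_on (alg_basis Q N), monoid.mult = amul Q N, one = trunc N (kone Q),
                    zero = 0, add = (+)\<rparr>"

section \<open>The minimal projective resolution\<close>

text \<open>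
  The tensor product \<open>A \<otimes> k\<Delta>\<^sub>m \<otimes> A\<close> over \<open>k\<Delta>\<^sub>0\<close> has as basis the composable triples
  \<open>\<alpha> \<otimes> \<pi> \<otimes> \<beta>\<close> with \<open>\<alpha>, \<beta>\<close> of length less than \<open>N\<close> and \<open>\<pi>\<close> of length \<open>m\<close>.
\<close>

type_synonym ('v, 'a, 'k) bimod = "('v, 'a) qpath \<times> ('v, 'a) qpath \<times> ('v, 'a) qpath \<Rightarrow>\<^sub>0 'k"

definition res_len :: "nat \<Rightarrow> nat \<Rightarrow> nat" where
  "res_len N n = (n div 2) * N + n mod 2"

definition res_basis ::
  "('v, 'a) pre_digraph \<Rightarrow> nat \<Rightarrow> nat \<Rightarrow> (('v, 'a) qpath \<times> ('v, 'a) qpath \<times> ('v, 'a) qpath) set" where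
  "res_basis Q N n = {(\<alpha>, \<pi>, \<beta>). \<alpha> \<in> alg_basis Q N \<and> \<pi> \<in> qpaths Q (res_len N n) \<and>
     \<beta> \<in> alg_basis Q N \<and> ptgt Q \<alpha> = psrc \<pi> \<and> ptgt Q \<pi> = psrc \<beta>}"

definition res_mod :: "('v, 'a) pre_digraph \<Rightarrow> nat \<Rightarrow> nat \<Rightarrow> ('v, 'a, 'k::field) bimod set" where
  "res_mod Q N n = free_on (res_basis Q N n)"

text \<open>\<open>tens N \<alpha> \<pi> \<beta>\<close> is \<open>\<alpha> \<otimes> \<pi> \<otimes> \<beta>\<close> for composable paths, where \<open>\<alpha>\<close> and \<open>\<beta>\<close> are read in \<open>A\<close>.\<close>

definition tens :: "nat \<Rightarrow> ('v, 'a) qpath \<Rightarrow> ('v, 'a) qpath \<Rightarrow> ('v, 'a) qpath \<Rightarrow>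
    ('v, 'a, 'k::field) bimod" where
  "tens N \<alpha> \<pi> \<beta> = (if plen \<alpha> < N \<and> plen \<beta> < N then Poly_Mapping.single (\<alpha>, \<pi>, \<beta>) 1 else 0)"

definition lact :: "('v, 'a) pre_digraph \<Rightarrow> nat \<Rightarrow> (('v, 'a) qpath \<Rightarrow>\<^sub>0 'k::field) \<Rightarrow>
    ('v, 'a, 'k) bimod \<Rightarrow> ('v, 'a, 'k) bimod" where
  "lact Q N = bilin_ext (\<lambda>p (\<alpha>, \<pi>, \<beta>). if ptgt Q p = psrc \<alpha> then tens N (pcat p \<alpha>) \<pi> \<beta> else 0)"

definition ract :: "('v, 'a) pre_digraph \<Rightarrow> nat \<Rightarrow> ('v, 'a, 'k::field) bimod \<Rightarrow>
    (('v, 'a) qpath \<Rightarrow>\<^sub>0 'k) \<Rightarrow> ('v, 'a, 'k) bimod" where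
  "ract Q N = bilin_ext (\<lambda>(\<alpha>, \<pi>, \<beta>) p. if ptgt Q \<beta> = psrc p then tens N \<alpha> \<pi> (pcat \<beta> p) else 0)"

text \<open>
  \<open>res_term Q N l j (\<alpha>, v\<^sub>1\<dots>v\<^sub>n, \<beta>)\<close> is
  \<open>\<alpha>v\<^sub>1\<dots>v\<^sub>j \<otimes> v\<^bsub>j+1\<^esub>\<dots>v\<^bsub>j+l\<^esub> \<otimes> v\<^bsub>j+l+1\<^esub>\<dots>v\<^sub>n\<beta>\<close>.
\<close>

definition res_term :: "('v, 'a) pre_digraph \<Rightarrow> nat \<Rightarrow> nat \<Rightarrow> nat \<Rightarrow>
    ('v, 'a) qpath \<times> ('v, 'a) qpath \<times> ('v, 'a) qpath \<Rightarrow> ('v, 'a, 'k::field) bimod" where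
  "res_term Q N l j = (\<lambda>(\<alpha>, \<pi>, \<beta>).
     tens N (pcat \<alpha> (psub Q \<pi> 0 j)) (psub Q \<pi> j l) (pcat (psub Q \<pi> (j + l) (plen \<pi> - (j + l))) \<beta>))"

definition res_diff :: "('v, 'a) pre_digraph \<Rightarrow> nat \<Rightarrow> nat \<Rightarrow>
    ('v, 'a, 'k::field) bimod \<Rightarrow> ('v, 'a, 'k) bimod" where
  "res_diff Q N n = lin_ext (\<lambda>b.
     if n = 0 then 0
     else if even n then \<Sum>j<N. res_term Q N (res_len N (n - 1)) j b
     else res_term Q N (res_len N (n - 1)) 1 b - res_term Q N (res_len N (n - 1)) 0 b)"

definition res_aug :: "('v, 'a) pre_digraph \<Rightarrow> nat \<Rightarrow>
    ('v, 'a, 'k::field) bimod \<Rightarrow> (('v, 'a) qpath \<Rightarrow>\<^sub>0 'k)" where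
  "res_aug Q N = lin_ext (\<lambda>(\<alpha>, \<pi>, \<beta>). amul Q N (Poly_Mapping.single \<alpha> 1) (Poly_Mapping.single \<beta> 1))"

text \<open>Homomorphisms of \<open>A\<close>-bimodules from \<open>P\<^sub>m\<close> to \<open>P\<^sub>n\<close>; only the values on \<open>P\<^sub>m\<close> matter.\<close>

definition res_hom :: "('v, 'a) pre_digraph \<Rightarrow> nat \<Rightarrow> nat \<Rightarrow> nat \<Rightarrow>
    (('v, 'a, 'k::field) bimod \<Rightarrow> ('v, 'a, 'k) bimod) set" where
  "res_hom Q N m n = {\<phi>. (\<forall>x\<in>res_mod Q N m. \<phi> x \<in> res_mod Q N n) \<and>
     (\<forall>x\<in>res_mod Q N m. \<forall>y\<in>res_mod Q N m. \<phi> (x + y) = \<phi> x + \<phi> y) \<and>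
     (\<forall>c. \<forall>x\<in>res_mod Q N m. \<phi> (scal c x) = scal c (\<phi> x)) \<and>
     (\<forall>a\<in>free_on (alg_basis Q N). \<forall>x\<in>res_mod Q N m.
        \<phi> (lact Q N a x) = lact Q N a (\<phi> x) \<and> \<phi> (ract Q N x a) = ract Q N (\<phi> x) a)}"


section \<open>The complex of parallel paths and Hochschild cohomology\<close>

type_synonym ('v, 'a, 'k) cochain = "('v, 'a) qpath \<times> ('v, 'a) qpath \<Rightarrow>\<^sub>0 'k"

definition coch_basis :: "('v, 'a) pre_digraph \<Rightarrow> nat \<Rightarrow> nat \<Rightarrow> nat \<Rightarrow>
    (('v, 'a) qpath \<times> ('v, 'a) qpath) set" where
  "coch_basis Q N n i = {(\<alpha>, \<pi>). i < N \<and> \<alpha> \<in> qpaths Q i \<and> \<pi> \<in> qpaths Q (res_len N n) \<and>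
     psrc \<alpha> = psrc \<pi> \<and> ptgt Q \<alpha> = ptgt Q \<pi>}"

text \<open>The space \<open>P\<^sup>*\<^bsub>n,i\<^esub>\<close>, which is \<open>{0}\<close> for \<open>i \<ge> N\<close>, and the space \<open>P\<^sup>*\<^sub>n\<close>.\<close>

definition cochains_bi :: "('v, 'a) pre_digraph \<Rightarrow> nat \<Rightarrow> nat \<Rightarrow> nat \<Rightarrow> ('v, 'a, 'k::field) cochain set" where
  "cochains_bi Q N n i = free_on (coch_basis Q N n i)"

definition cochains :: "('v, 'a) pre_digraph \<Rightarrow> nat \<Rightarrow> nat \<Rightarrow> ('v, 'a, 'k::field) cochain set" where
  "cochains Q N n = free_on (\<Union>i<N. coch_basis Q N n i)"

text \<open>
  The identification of \<open>P\<^sup>*\<^sub>n\<close> with the bimodule maps \<open>P\<^sub>n \<rightarrow> A\<close>: \<open>coch_val f \<pi>\<close> is the value of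
  \<open>f\<close> at \<open>1 \<otimes> \<pi> \<otimes> 1\<close>, \<open>hom_of Q N f\<close> is the bimodule map corresponding to \<open>f\<close>, and \<open>coch_of\<close>
  recovers the cochain from a bimodule map.
\<close>

definition coch_val :: "('v, 'a, 'k::field) cochain \<Rightarrow> ('v, 'a) qpath \<Rightarrow> (('v, 'a) qpath \<Rightarrow>\<^sub>0 'k)" where
  "coch_val f \<pi> = lin_ext (\<lambda>(\<alpha>, \<pi>'). if \<pi>' = \<pi> then Poly_Mapping.single \<alpha> 1 else 0) f"

definition hom_of :: "('v, 'a) pre_digraph \<Rightarrow> nat \<Rightarrow> ('v, 'a, 'k::field) cochain \<Rightarrow>
    ('v, 'a, 'k) bimod \<Rightarrow> (('v, 'a) qpath \<Rightarrow>\<^sub>0 'k)" where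
  "hom_of Q N f = lin_ext (\<lambda>(\<alpha>, \<pi>, \<beta>).
     amul Q N (amul Q N (Poly_Mapping.single \<alpha> 1) (coch_val f \<pi>)) (Poly_Mapping.single \<beta> 1))"

definition coch_of :: "('v, 'a) pre_digraph \<Rightarrow> nat \<Rightarrow> nat \<Rightarrow>
    (('v, 'a, 'k::field) bimod \<Rightarrow> (('v, 'a) qpath \<Rightarrow>\<^sub>0 'k)) \<Rightarrow> ('v, 'a, 'k) cochain" where
  "coch_of Q N n F = (\<Sum>(\<alpha>, \<pi>)\<in>(\<Union>i<N. coch_basis Q N n i). Poly_Mapping.single (\<alpha>, \<pi>)
     (Poly_Mapping.lookup (F (Poly_Mapping.single ((psrc \<pi>, []), \<pi>, (ptgt Q \<pi>, [])) 1)) \<alpha>))"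

definition coch_diff :: "('v, 'a) pre_digraph \<Rightarrow> nat \<Rightarrow> nat \<Rightarrow>
    ('v, 'a, 'k::field) cochain \<Rightarrow> ('v, 'a, 'k) cochain" where
  "coch_diff Q N n f = coch_of Q N (n + 1) (hom_of Q N f \<circ> res_diff Q N (n + 1))"

definition cocycles :: "('v, 'a) pre_digraph \<Rightarrow> nat \<Rightarrow> nat \<Rightarrow> ('v, 'a, 'k::field) cochain set" where
  "cocycles Q N n = {f \<in> cochains Q N n. coch_diff Q N n f = 0}"

definition coboundaries :: "('v, 'a) pre_digraph \<Rightarrow> nat \<Rightarrow> nat \<Rightarrow> ('v, 'a, 'k::field) cochain set" where
  "coboundaries Q N n = (if n = 0 then {0} else coch_diff Q N (n - 1) ` cochains Q N (n - 1))"

definition coh_class :: "('v, 'a) pre_digraph \<Rightarrow> nat \<Rightarrow> nat \<Rightarrow> ('v, 'a, 'k::field) cochain \<Rightarrow>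
    ('v, 'a, 'k) cochain set" where
  "coh_class Q N n f = {f + b |b. b \<in> coboundaries Q N n}"

text \<open>\<open>HH Q N n\<close> is \<open>H\<^sup>n(A,A)\<close>, and \<open>HH_bi Q N n i\<close> its subspace \<open>H\<^sup>n\<^sub>i\<close>.\<close>

definition HH :: "('v, 'a) pre_digraph \<Rightarrow> nat \<Rightarrow> nat \<Rightarrow> ('v, 'a, 'k::field) cochain set set" where
  "HH Q N n = coh_class Q N n ` cocycles Q N n"

definition HH_bi :: "('v, 'a) pre_digraph \<Rightarrow> nat \<Rightarrow> nat \<Rightarrow> nat \<Rightarrow> ('v, 'a, 'k::field) cochain set set" where
  "HH_bi Q N n i = coh_class Q N n ` (cocycles Q N n \<inter> cochains_bi Q N n i)"


section \<open>The products\<close>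

text \<open>
  A lift of a cocycle \<open>g : P\<^sub>n \<rightarrow> A\<close> is a family of bimodule maps \<open>\<phi>\<^sub>i : P\<^bsub>n+i\<^esub> \<rightarrow> P\<^sub>i\<close> that commutes
  with the differentials and satisfies \<open>\<epsilon> \<circ> \<phi>\<^sub>0 = g\<close>. The Yoneda product of the classes of
  \<open>f : P\<^sub>m \<rightarrow> A\<close> and \<open>g\<close> is the class of \<open>f \<circ> \<phi>\<^sub>m\<close>. As for cosets in a quotient ring, the product
  of two classes is the union of the classes obtained from all choices of
  representatives and lifts; it is a single class because the lifts exist and are unique up to
  homotopy. With these conventions (no signs) it agrees with the cup product
  \<open>(f \<union> g)(\<alpha>\<^sub>1 \<otimes> \<dots> \<otimes> \<alpha>\<^bsub>m+n\<^esub>) = f(\<alpha>\<^sub>1 \<otimes> \<dots> \<otimes> \<alpha>\<^sub>m) g(\<alpha>\<^bsub>m+1\<^esub> \<otimes> \<dots> \<otimes> \<alpha>\<^bsub>m+n\<^esub>)\<close>.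
\<close>

definition cocycle_lift :: "('v, 'a) pre_digraph \<Rightarrow> nat \<Rightarrow> nat \<Rightarrow> ('v, 'a, 'k::field) cochain \<Rightarrow>
    (nat \<Rightarrow> ('v, 'a, 'k) bimod \<Rightarrow> ('v, 'a, 'k) bimod) \<Rightarrow> bool" where
  "cocycle_lift Q N n g \<phi> \<longleftrightarrow>
     (\<forall>i. \<phi> i \<in> res_hom Q N (n + i) i) \<and>
     (\<forall>x\<in>res_mod Q N n. res_aug Q N (\<phi> 0 x) = hom_of Q N g x) \<and>
     (\<forall>i. \<forall>x\<in>res_mod Q N (n + i + 1).
        res_diff Q N (i + 1) (\<phi> (i + 1) x) = \<phi> i (res_diff Q N (n + i + 1) x))"

definition yoneda :: "('v, 'a) pre_digraph \<Rightarrow> nat \<Rightarrow> nat \<Rightarrow> nat \<Rightarrow> ('v, 'a, 'k::field) cochain set \<Rightarrow>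
    ('v, 'a, 'k) cochain set \<Rightarrow> ('v, 'a, 'k) cochain set" where
  "yoneda Q N m n X Y = \<Union>{coh_class Q N (m + n) (coch_of Q N (m + n) (hom_of Q N f \<circ> \<phi> m)) |f g \<phi>.
     f \<in> X \<and> g \<in> Y \<and> cocycle_lift Q N n g \<phi>}"

definition vee :: "('v, 'a) pre_digraph \<Rightarrow> nat \<Rightarrow> nat \<Rightarrow> nat \<Rightarrow> ('v, 'a, 'k::field) cochain \<Rightarrow>
    ('v, 'a, 'k) cochain \<Rightarrow> ('v, 'a, 'k) cochain" where
  "vee Q N m n = bilin_ext (\<lambda>(\<alpha>, \<pi>) (\<beta>, \<tau>).
     if (even m \<or> even n) \<and> ptgt Q \<alpha> = psrc \<beta> \<and> ptgt Q \<pi> = psrc \<tau> \<and> plen (pcat \<alpha> \<beta>) < N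
     then Poly_Mapping.single (pcat \<alpha> \<beta>, pcat \<pi> \<tau>) 1 else 0)"


section \<open>The cohomology ring\<close>

text \<open>
  An element of \<open>H\<^sup>*(A,A) = \<Oplus>\<^sub>n H\<^sup>n(A,A)\<close> is a family of classes, almost all of them zero. The zero of
  \<open>H\<^sup>n(A,A)\<close> is the set of coboundaries, \<open>+\<close> and \<open>\<Sum>\<close> of classes are elementwise
  sums of sets, and the unit is the class of the augmentation.
\<close>

definition HH_ring :: "('v, 'a) pre_digraph \<Rightarrow> nat \<Rightarrow> (nat \<Rightarrow> ('v, 'a, 'k::field) cochain set) ring" where
  "HH_ring Q N = \<lparr>
     carrier = {X. (\<forall>n. X n \<in> HH Q N n) \<and> finite {n. X n \<noteq> coboundaries Q N n}},
     monoid.mult = (\<lambda>X Y n. \<Sum>i\<le>n. yoneda Q N i (n - i) (X i) (Y (n - i))),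
     one = (\<lambda>n. if n = 0 then coh_class Q N 0 (coch_of Q N 0 (res_aug Q N)) else coboundaries Q N n),
     zero = coboundaries Q N,
     add = (\<lambda>X Y n. X n + Y n)\<rparr>"

text \<open>\<open>H\<^sup>n\<^sub>i\<close> as a subspace of \<open>H\<^sup>*(A,A)\<close>.\<close>

definition HH_comp :: "('v, 'a) pre_digraph \<Rightarrow> nat \<Rightarrow> nat \<Rightarrow> nat \<Rightarrow>
    (nat \<Rightarrow> ('v, 'a, 'k::field) cochain set) set" where
  "HH_comp Q N n i = {X. X n \<in> HH_bi Q N n i \<and> (\<forall>m. m \<noteq> n \<longrightarrow> X m = coboundaries Q N m)}"

definition bigrading :: "('r, 's) ring_scheme \<Rightarrow> (nat \<Rightarrow> nat \<Rightarrow> 'r set) \<Rightarrow> bool" where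
  "bigrading R H \<longleftrightarrow>
     (\<forall>n i. subgroup (H n i) (add_monoid R)) \<and>
     (\<forall>x\<in>carrier R. \<exists>!c. (\<forall>n i. c (n, i) \<in> H n i) \<and> finite {d. c d \<noteq> \<zero>\<^bsub>R\<^esub>} \<and>
        x = finsum R c {d. c d \<noteq> \<zero>\<^bsub>R\<^esub>}) \<and>
     (\<forall>m n i j. \<forall>x\<in>H m i. \<forall>y\<in>H n j. x \<otimes>\<^bsub>R\<^esub> y \<in> H (m + n) (i + j))"


section \<open>The truncated quiver algebra is the quotient of the path algebra\<close>

lemma lookup_scal [simp]: "Poly_Mapping.lookup (scal c x) k = c * Poly_Mapping.lookup x k"
  by (simp add: scal_def Poly_Mapping.map.rep_eq when_def)

lemma scal_simps:
  "scal c 0 = 0" "scal c (x + y) = scal c x + scal c y" "scal (c + d) x = scal c x + scal d x"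
  "scal 1 x = x" "scal 0 x = 0" "scal c (scal d x) = scal (c * d) x"
  "scal c (Poly_Mapping.single b d) = Poly_Mapping.single b (c * d)"
  by (auto intro!: poly_mapping_eqI simp: lookup_add algebra_simps lookup_single when_def)

lemma scal_sum: "scal c (sum f S) = (\<Sum>s\<in>S. scal c (f s))"
  by (induction S rule: infinite_finite_induct) (auto simp: scal_simps)

lemma lin_ext_superset:
  assumes "finite S" "Poly_Mapping.keys x \<subseteq> S"
  shows "lin_ext F x = (\<Sum>b\<in>S. scal (Poly_Mapping.lookup x b) (F b))"
  unfolding lin_ext_def using assms
  by (intro sum.mono_neutral_left) (auto simp: in_keys_iff scal_simps)

lemma lin_ext_add: "lin_ext F (x + y) = lin_ext F x + lin_ext F y"
proof -
  let ?S = "Poly_Mapping.keys x \<union> Poly_Mapping.keys y"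
  have "lin_ext F (x + y) = (\<Sum>b\<in>?S. scal (Poly_Mapping.lookup (x + y) b) (F b))"
    using Poly_Mapping.keys_add[of x y] by (intro lin_ext_superset) auto
  also have "\<dots> = lin_ext F x + lin_ext F y"
    by (simp add: lin_ext_superset[of ?S x] lin_ext_superset[of ?S y] lookup_add scal_simps sum.distrib)
  finally show ?thesis .
qed

lemma lin_ext_zero [simp]: "lin_ext F 0 = 0"
  by (simp add: lin_ext_def)

lemma lin_ext_single [simp]: "lin_ext F (Poly_Mapping.single b c) = scal c (F b)"
  by (simp add: lin_ext_superset[of "{b}"] )

lemma lin_ext_fun_add: "lin_ext (\<lambda>b. F b + G b) x = lin_ext F x + lin_ext G x"
  by (simp add: lin_ext_def scal_simps sum.distrib)

lemma lin_ext_fun_zero [simp]: "lin_ext (\<lambda>b. 0) x = 0"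
  by (simp add: lin_ext_def scal_simps)

lemma bilin_ext_add:
  "bilin_ext F (x + x') y = bilin_ext F x y + bilin_ext F x' y"
  "bilin_ext F x (y + y') = bilin_ext F x y + bilin_ext F x y'"
  by (simp_all add: bilin_ext_def lin_ext_add lin_ext_fun_add)

lemma bilin_ext_zero [simp]: "bilin_ext F 0 y = 0" "bilin_ext F x 0 = 0"
  by (simp_all add: bilin_ext_def)

lemma bilin_ext_single [simp]:
  "bilin_ext F (Poly_Mapping.single b c) (Poly_Mapping.single d e) = scal (c * e) (F b d)"
  by (simp add: bilin_ext_def scal_simps)

lemma free_on_simps:
  "0 \<in> free_on B" "x \<in> free_on B \<Longrightarrow> y \<in> free_on B \<Longrightarrow> x + y \<in> free_on B"
  "b \<in> B \<Longrightarrow> Poly_Mapping.single b c \<in> free_on B"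
  using Poly_Mapping.keys_add[of x y] by (auto simp: free_on_def)

lemma free_on_uminus: "x \<in> free_on B \<Longrightarrow> - x \<in> free_on (B :: 'b set)"
  for x :: "'b \<Rightarrow>\<^sub>0 'k::field"
  by (auto simp: free_on_def in_keys_iff subset_iff)

lemma free_on_induct [consumes 1, case_names zero single add]:
  fixes x :: "'b \<Rightarrow>\<^sub>0 'k::field"
  assumes "x \<in> free_on B" "P 0" "\<And>b c. b \<in> B \<Longrightarrow> P (Poly_Mapping.single b c)"
    "\<And>x y. x \<in> free_on B \<Longrightarrow> y \<in> free_on B \<Longrightarrow> P x \<Longrightarrow> P y \<Longrightarrow> P (x + y)"
  shows "P x"
proof -
  have eq: "x = (\<Sum>b\<in>Poly_Mapping.keys x. Poly_Mapping.single b (Poly_Mapping.lookup x b))"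
    by (intro poly_mapping_eqI) (auto simp: lookup_sum lookup_single when_def in_keys_iff sum.delta)
  have "S \<subseteq> B \<Longrightarrow> (\<Sum>b\<in>S. Poly_Mapping.single b (Poly_Mapping.lookup x b)) \<in> free_on B \<and>
      P (\<Sum>b\<in>S. Poly_Mapping.single b (Poly_Mapping.lookup x b))" if "finite S" for S
    using that by (induction S) (auto intro!: assms free_on_simps)
  then have "P (\<Sum>b\<in>Poly_Mapping.keys x. Poly_Mapping.single b (Poly_Mapping.lookup x b))"
    using assms(1) by (simp add: free_on_def)
  then show ?thesis by (simp only: eq[symmetric])
qed

lemma free_on_all: "x \<in> free_on UNIV"
  by (simp add: free_on_def)

lemma kmul_simps:
  "kmul Q (x + x') y = kmul Q x y + kmul Q x' y" "kmul Q x (y + y') = kmul Q x y + kmul Q x y'"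
  "kmul Q 0 y = 0" "kmul Q x 0 = 0"
  "kmul Q (Poly_Mapping.single p c) (Poly_Mapping.single q d) =
     (if ptgt Q p = psrc q then Poly_Mapping.single (pcat p q) (c * d) else 0)"
  by (simp_all add: kmul_def bilin_ext_add scal_simps)

lemma path_simps:
  "pcat (pcat p q) r = pcat p (pcat q r)" "psrc (pcat p q) = psrc p"
  "plen (pcat p q) = plen p + plen q" "psrc (v, l) = v" "pcat p (w, []) = p"
  "plen (v, l) = length l" "ptgt Q (v, []) = v" "pcat (psrc p, []) p = p"
  by (simp_all add: pcat_def psrc_def plen_def ptgt_def pre_digraph.awalk_verts.simps)

lemma ptgt_pcat: "ptgt Q p = psrc q \<Longrightarrow> ptgt Q (pcat p q) = ptgt Q q"
proof -
  have ne: "pre_digraph.awalk_verts Q u l \<noteq> []" for u l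
    by (cases l) (simp_all add: pre_digraph.awalk_verts.simps)
  have "pre_digraph.awlast Q u (l @ m) = pre_digraph.awlast Q (pre_digraph.awlast Q u l) m" for u l m
  proof (induction l arbitrary: u)
    case (Cons a l)
    show ?case
      using Cons.IH[of "head Q a"] by (simp only: append_Cons pre_digraph.awalk_verts.simps last_ConsR[OF ne])
  qed (simp add: pre_digraph.awalk_verts.simps)
  then show "ptgt Q p = psrc q \<Longrightarrow> ptgt Q (pcat p q) = ptgt Q q"
    by (simp add: ptgt_def psrc_def pcat_def)
qed

lemma qpaths_plen: "p \<in> qpaths Q n \<Longrightarrow> plen p = n"
  by (simp add: qpaths_def)

context
  fixes Q :: "('v, 'a) pre_digraph"
  assumes fin: "fin_digraph Q"
begin

interpretation fin_digraph Q by (rule fin)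

lemma qpaths_pcat:
  "p \<in> qpaths Q m \<Longrightarrow> q \<in> qpaths Q n \<Longrightarrow> ptgt Q p = psrc q \<Longrightarrow> pcat p q \<in> qpaths Q (m + n)"
  using ptgt_pcat[of Q p q]
  by (auto simp: qpaths_def path_simps) (auto simp: pcat_def ptgt_def psrc_def)

lemma qpaths_split:
  assumes "p \<in> qpaths Q (m + n)"
  obtains q r where "q \<in> qpaths Q m" "r \<in> qpaths Q n" "ptgt Q q = psrc r" "p = pcat q r"
proof -
  define q where "q = (fst p, take m (snd p))"
  define r where "r = (ptgt Q q, drop m (snd p))"
  have "awalk (fst p) (take m (snd p) @ drop m (snd p)) (ptgt Q p)"
    using assms by (simp add: qpaths_def psrc_def)
  then have "awalk (fst p) (take m (snd p)) (ptgt Q q)" "awalk (ptgt Q q) (drop m (snd p)) (ptgt Q p)"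
    unfolding awalk_append_iff by (simp_all add: q_def ptgt_def)
  moreover have "pcat q r = p" by (simp add: pcat_def q_def r_def)
  moreover have "ptgt Q q = psrc r" by (simp add: r_def psrc_def)
  moreover from this have "ptgt Q r = ptgt Q p" using ptgt_pcat[of Q q r] \<open>pcat q r = p\<close> by simp
  moreover have "plen q = m" "plen r = n"
    using assms by (auto simp: qpaths_def plen_def q_def r_def)
  ultimately show ?thesis
    by (intro that[of q r]) (auto simp: qpaths_def psrc_def q_def r_def)
qed

lemma qpaths_vert: "p \<in> qpaths Q n \<Longrightarrow> psrc p \<in> verts Q \<and> ptgt Q p \<in> verts Q"
  by (auto simp: qpaths_def dest: awalk_hd_in_verts awalk_last_in_verts)

lemma vert_qpaths: "v \<in> verts Q \<Longrightarrow> (v, []) \<in> qpaths Q 0"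
  by (simp add: qpaths_def path_simps awalk_def)

abbreviation "paths_ge n \<equiv> (\<Union>m\<in>{n..}. qpaths Q m)"

lemma kmul_closed:
  fixes x y :: "('v, 'a) qpath \<Rightarrow>\<^sub>0 'k::field"
  assumes "x \<in> free_on (paths_ge m)" "y \<in> free_on (paths_ge n)"
  shows "kmul Q x y \<in> free_on (paths_ge (m + n))"
  using assms(1)
proof (induction rule: free_on_induct)
  case (single p c)
  show ?case using assms(2)
  proof (induction rule: free_on_induct)
    case (single q d)
    from \<open>p \<in> paths_ge m\<close> single obtain i j where "i \<ge> m" "j \<ge> n" "p \<in> qpaths Q i" "q \<in> qpaths Q j"
      by auto
    then have "ptgt Q p = psrc q \<Longrightarrow> pcat p q \<in> paths_ge (m + n)"
      using qpaths_pcat[of p i q j] by (auto intro!: bexI[of _ "i + j"])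
    then show ?case by (auto simp: kmul_simps intro: free_on_simps)
  qed (auto simp: kmul_simps intro: free_on_simps)
qed (auto simp: kmul_simps intro: free_on_simps)

lemma kmul_assoc: "kmul Q (kmul Q x y) z = kmul Q x (kmul Q y z)"
  for x y z :: "('v, 'a) qpath \<Rightarrow>\<^sub>0 'k::field"
  using free_on_all[of x]
proof (induction rule: free_on_induct)
  case (single p c)
  show ?case using free_on_all[of y]
  proof (induction rule: free_on_induct)
    case (single q d)
    show ?case using free_on_all[of z]
      by (induction rule: free_on_induct) (auto simp: kmul_simps path_simps ptgt_pcat mult.assoc)
  qed (auto simp: kmul_simps)
qed (auto simp: kmul_simps)

lemma kone_closed: "kone Q \<in> (free_on (paths_ge 0) :: (('v, 'a) qpath \<Rightarrow>\<^sub>0 'k::field) set)"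
proof -
  have "finite S \<Longrightarrow> S \<subseteq> verts Q \<Longrightarrow> (\<Sum>v\<in>S. Poly_Mapping.single (v, []) (1::'k)) \<in> free_on (paths_ge 0)" for S
    by (induction S rule: finite_induct) (auto intro!: free_on_simps vert_qpaths)
  then show ?thesis by (simp add: kone_def)
qed

lemma kmul_sum: "kmul Q (sum f S) x = (\<Sum>s\<in>S. kmul Q (f s) x)" "kmul Q x (sum f S) = (\<Sum>s\<in>S. kmul Q x (f s))"
  by (induction S rule: infinite_finite_induct) (auto simp: kmul_simps)

lemma kone_l: "x \<in> free_on (paths_ge 0) \<Longrightarrow> kmul Q (kone Q) x = x"
  for x :: "('v, 'a) qpath \<Rightarrow>\<^sub>0 'k::field"
proof (induction rule: free_on_induct)
  case (single p c)
  then have "psrc p \<in> verts Q" by (auto dest: qpaths_vert)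
  then show ?case
    by (simp add: kone_def kmul_sum kmul_simps path_simps sum.delta)
qed (auto simp: kmul_simps)

lemma kone_r: "x \<in> free_on (paths_ge 0) \<Longrightarrow> kmul Q x (kone Q) = x"
  for x :: "('v, 'a) qpath \<Rightarrow>\<^sub>0 'k::field"
proof (induction rule: free_on_induct)
  case (single p c)
  then have "ptgt Q p \<in> verts Q" by (auto dest: qpaths_vert)
  then show ?case
    by (simp add: kone_def kmul_sum kmul_simps path_simps sum.delta')
qed (auto simp: kmul_simps)

lemma path_alg_carrier: "carrier (path_alg Q) = free_on (paths_ge 0)"
  by (auto simp: path_alg_def)

lemma ring_path_alg: "ring (path_alg Q :: (('v, 'a) qpath \<Rightarrow>\<^sub>0 'k::field) ring)" (is "ring ?R")
proof (rule ringI)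
  show "abelian_group ?R"
  proof (rule abelian_groupI)
    fix x :: "('v, 'a) qpath \<Rightarrow>\<^sub>0 'k" assume "x \<in> carrier ?R"
    then show "\<exists>y\<in>carrier ?R. y \<oplus>\<^bsub>?R\<^esub> x = \<zero>\<^bsub>?R\<^esub>"
      by (auto simp: path_alg_def intro!: bexI[of _ "- x"] free_on_uminus)
  qed (auto simp: path_alg_def free_on_simps add_ac)
  have "x \<otimes>\<^bsub>?R\<^esub> y \<in> carrier ?R" if "x \<in> carrier ?R" "y \<in> carrier ?R" for x y
    using that kmul_closed[of x 0 y 0] by (simp add: path_alg_def)
  then show "monoid ?R"
    by (intro monoidI)
      (use kone_closed kone_l kone_r in \<open>auto simp: path_alg_def kmul_assoc\<close>)
qed (auto simp: path_alg_def kmul_simps)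

lemma lookup_trunc: "Poly_Mapping.lookup (trunc N x) p = (if plen p < N then Poly_Mapping.lookup x p else 0)"
  for x :: "('v, 'a) qpath \<Rightarrow>\<^sub>0 'k::field"
  using free_on_all[of x]
  by (induction rule: free_on_induct)
    (auto simp: trunc_def lin_ext_add lookup_add lookup_single when_def scal_simps)

lemma trunc_simps:
  "trunc N (x + y) = trunc N x + trunc N y" "trunc N 0 = (0 :: ('v, 'a) qpath \<Rightarrow>\<^sub>0 'k)" "trunc N (trunc N x) = trunc N x"
  "trunc N (Poly_Mapping.single p c) = (if plen p < N then Poly_Mapping.single p c else 0)"
  for x y :: "('v, 'a) qpath \<Rightarrow>\<^sub>0 'k::field" and c :: 'k and p :: "('v, 'a) qpath"
  by (auto intro!: poly_mapping_eqI simp: lookup_trunc lookup_add lookup_single when_def)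

lemma trunc_id: "x \<in> free_on (alg_basis Q N) \<Longrightarrow> trunc N x = x"
  for x :: "('v, 'a) qpath \<Rightarrow>\<^sub>0 'k::field"
  by (intro poly_mapping_eqI)
    (auto simp: lookup_trunc free_on_def alg_basis_def in_keys_iff dest!: qpaths_plen)

lemma trunc_closed: "x \<in> free_on (paths_ge 0) \<Longrightarrow> trunc N x \<in> free_on (alg_basis Q N)"
  for x :: "('v, 'a) qpath \<Rightarrow>\<^sub>0 'k::field"
  by (induction rule: free_on_induct)
    (auto simp: trunc_simps alg_basis_def dest: qpaths_plen intro!: free_on_simps)

lemma alg_basis_sub: "free_on (alg_basis Q N) \<subseteq> free_on (paths_ge 0)"
  by (auto simp: free_on_def alg_basis_def)

lemma trunc_kmul: "trunc N (kmul Q (trunc N x) y) = trunc N (kmul Q x y)"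
  "trunc N (kmul Q x (trunc N y)) = trunc N (kmul Q x y)"
  for x y :: "('v, 'a) qpath \<Rightarrow>\<^sub>0 'k::field"
proof -
  have "trunc N (kmul Q (trunc N x) y) = trunc N (kmul Q x y) \<and>
     trunc N (kmul Q x (trunc N y)) = trunc N (kmul Q x y)"
    using free_on_all[of x]
  proof (induction rule: free_on_induct)
    case (single p c)
    show ?case using free_on_all[of y]
      by (induction rule: free_on_induct) (auto simp: kmul_simps trunc_simps path_simps)
  qed (auto simp: kmul_simps trunc_simps)
  then show "trunc N (kmul Q (trunc N x) y) = trunc N (kmul Q x y)"
    "trunc N (kmul Q x (trunc N y)) = trunc N (kmul Q x y)" by auto
qed

lemma ring_trunc_alg: "ring (trunc_alg Q N :: (('v, 'a) qpath \<Rightarrow>\<^sub>0 'k::field) ring)" (is "ring ?R")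
proof (rule ringI)
  show "abelian_group ?R"
  proof (rule abelian_groupI)
    fix x :: "('v, 'a) qpath \<Rightarrow>\<^sub>0 'k" assume "x \<in> carrier ?R"
    then show "\<exists>y\<in>carrier ?R. y \<oplus>\<^bsub>?R\<^esub> x = \<zero>\<^bsub>?R\<^esub>"
      by (auto simp: trunc_alg_def intro!: bexI[of _ "- x"] free_on_uminus)
  qed (auto simp: trunc_alg_def free_on_simps add_ac)
  have "x \<otimes>\<^bsub>?R\<^esub> y \<in> carrier ?R" if "x \<in> carrier ?R" "y \<in> carrier ?R" for x y
    using trunc_closed[OF kmul_closed[of x 0 y 0, unfolded add_0]] that subsetD[OF alg_basis_sub[of N]]
    unfolding trunc_alg_def amul_def ring_record_simps partial_object.simps monoid.simps by blast
  moreover have "kmul Q (kone Q) x = x" "kmul Q x (kone Q) = x" if "x \<in> carrier ?R" for x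
    using that alg_basis_sub[of N] by (auto simp: trunc_alg_def intro!: kone_l kone_r)
  ultimately show "monoid ?R"
    by (intro monoidI)
      (use trunc_closed[OF kone_closed] in \<open>auto simp: trunc_alg_def amul_def trunc_kmul kmul_assoc trunc_id\<close>)
qed (auto simp: trunc_alg_def amul_def kmul_simps trunc_simps)

lemma trunc_hom: "ring_hom_ring (path_alg Q) (trunc_alg Q N :: (('v, 'a) qpath \<Rightarrow>\<^sub>0 'k::field) ring) (trunc N)"
proof (rule ring_hom_ringI[OF ring_path_alg ring_trunc_alg])
  show "trunc N x \<in> carrier (trunc_alg Q N)" if "x \<in> carrier (path_alg Q)"
    for x :: "('v, 'a) qpath \<Rightarrow>\<^sub>0 'k"
    using trunc_closed[of x N] that by (simp add: path_alg_carrier trunc_alg_def)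
qed (auto simp: path_alg_def trunc_alg_def amul_def trunc_simps trunc_kmul)

lemma trunc_kernel:
  "a_kernel (path_alg Q) (trunc_alg Q N) (trunc N) =
     (free_on (paths_ge N) :: (('v, 'a) qpath \<Rightarrow>\<^sub>0 'k::field) set)"
proof -
  have "x \<in> free_on (paths_ge N)" if x0: "x \<in> free_on (paths_ge 0)" and xt: "trunc N x = 0"
    for x :: "('v, 'a) qpath \<Rightarrow>\<^sub>0 'k"
    unfolding free_on_def
  proof safe
    fix v l assume vl: "(v, l) \<in> Poly_Mapping.keys x"
    then obtain n where n: "(v, l) \<in> qpaths Q n" using x0 by (auto simp: free_on_def)
    have "\<not> n < N"
      using lookup_trunc[of N x "(v, l)"] xt vl qpaths_plen[OF n] by (auto simp: in_keys_iff)
    with n show "(v, l) \<in> paths_ge N" by auto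
  qed
  moreover have "trunc N x = 0" if "x \<in> free_on (paths_ge N)" for x :: "('v, 'a) qpath \<Rightarrow>\<^sub>0 'k"
    using that by (induction rule: free_on_induct) (auto simp: trunc_simps dest: qpaths_plen)
  moreover have "free_on (paths_ge N) \<subseteq> free_on (paths_ge 0)"
    by (auto simp: free_on_def)
  ultimately show ?thesis
    by (auto simp: a_kernel_def' path_alg_carrier) (auto simp: trunc_alg_def)
qed

lemma paths_ge_ideal: "ideal (free_on (paths_ge n)) (path_alg Q :: (('v, 'a) qpath \<Rightarrow>\<^sub>0 'k::field) ring)"
  using ring_hom_ring.kernel_is_ideal[OF trunc_hom[of n]] by (simp add: trunc_kernel)

lemma arrow_ideal_eq: "arrow_ideal Q = (free_on (paths_ge 1) :: (('v, 'a) qpath \<Rightarrow>\<^sub>0 'k::field) set)"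
proof
  let ?G = "{Poly_Mapping.single a (1::'k) |a. a \<in> qpaths Q 1}"
  show "arrow_ideal Q \<subseteq> (free_on (paths_ge 1) :: (('v, 'a) qpath \<Rightarrow>\<^sub>0 'k::field) set)"
    unfolding arrow_ideal_def
    by (rule ring.genideal_minimal[OF ring_path_alg paths_ge_ideal]) (auto intro!: free_on_simps)
  have G: "?G \<subseteq> carrier (path_alg Q)"
    by (auto simp: path_alg_carrier intro!: free_on_simps)
  have id: "ideal (arrow_ideal Q) (path_alg Q :: (('v, 'a) qpath \<Rightarrow>\<^sub>0 'k) ring)"
    unfolding arrow_ideal_def by (rule ring.genideal_ideal[OF ring_path_alg G])
  interpret I: ideal "arrow_ideal Q" "path_alg Q :: (('v, 'a) qpath \<Rightarrow>\<^sub>0 'k) ring" by (rule id)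
  show "(free_on (paths_ge 1) :: (('v, 'a) qpath \<Rightarrow>\<^sub>0 'k) set) \<subseteq> arrow_ideal Q"
  proof
    fix x :: "('v, 'a) qpath \<Rightarrow>\<^sub>0 'k" assume "x \<in> free_on (paths_ge 1)"
    then show "x \<in> arrow_ideal Q"
    proof (induction rule: free_on_induct)
      case zero
      show ?case using additive_subgroup.zero_closed[OF ideal.axioms(1)[OF id]] by (simp add: path_alg_def)
    next
      case (single p c)
      then obtain m where m: "p \<in> qpaths Q (1 + (m - 1))" "m \<ge> 1" by auto
      then obtain a q where aq: "a \<in> qpaths Q 1" "q \<in> qpaths Q (m - 1)" "ptgt Q a = psrc q" "p = pcat a q"
        using qpaths_split[OF m(1)] by blast
      have "Poly_Mapping.single a 1 \<in> (arrow_ideal Q :: (('v, 'a) qpath \<Rightarrow>\<^sub>0 'k) set)"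
        unfolding arrow_ideal_def by (rule subsetD[OF ring.genideal_self[OF ring_path_alg G]]) (use aq(1) in blast)
      moreover have "Poly_Mapping.single q c \<in> carrier (path_alg Q)"
        using aq(2) by (auto simp: path_alg_carrier intro!: free_on_simps)
      ultimately have "Poly_Mapping.single a 1 \<otimes>\<^bsub>path_alg Q\<^esub> Poly_Mapping.single q c \<in> arrow_ideal Q"
        by (rule I.I_r_closed)
      then show ?case using aq by (simp add: path_alg_def kmul_simps)
    next
      case (add x y)
      then show ?case using additive_subgroup.a_closed[OF ideal.axioms(1)[OF id], of x y] by (simp add: path_alg_def)
    qed
  qed
qed

lemma paths_ge_prod:
  "ideal_prod (path_alg Q) (free_on (paths_ge n)) (free_on (paths_ge 1)) =
     (free_on (paths_ge (n + 1)) :: (('v, 'a) qpath \<Rightarrow>\<^sub>0 'k::field) set)"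
proof (intro subset_antisym subsetI)
  fix x :: "('v, 'a) qpath \<Rightarrow>\<^sub>0 'k"
  assume "x \<in> ideal_prod (path_alg Q) (free_on (paths_ge n)) (free_on (paths_ge 1))"
  then show "x \<in> free_on (paths_ge (n + 1))"
  proof (induction rule: ideal_prod.induct)
    case (prod i j)
    then show ?case using kmul_closed[of i n j 1] by (simp add: path_alg_def)
  next
    case (sum s1 s2)
    then show ?case by (simp add: path_alg_def free_on_simps)
  qed
next
  fix x :: "('v, 'a) qpath \<Rightarrow>\<^sub>0 'k"
  assume "x \<in> free_on (paths_ge (n + 1))"
  then show "x \<in> ideal_prod (path_alg Q) (free_on (paths_ge n)) (free_on (paths_ge 1))"
  proof (induction rule: free_on_induct)
    case zero
    show ?case
      using ideal_prod.prod[of 0 "free_on (paths_ge n)" 0 "free_on (paths_ge 1)" "path_alg Q"]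
      by (simp add: path_alg_def kmul_simps free_on_simps)
  next
    case (single p c)
    then obtain m where m: "p \<in> qpaths Q (n + (m - n))" "m \<ge> n + 1" by auto
    then obtain q r where qr: "q \<in> qpaths Q n" "r \<in> qpaths Q (m - n)" "ptgt Q q = psrc r" "p = pcat q r"
      using qpaths_split[OF m(1)] by blast
    have "Poly_Mapping.single q 1 \<in> (free_on (paths_ge n) :: (('v, 'a) qpath \<Rightarrow>\<^sub>0 'k) set)"
      using qr by (auto intro!: free_on_simps)
    moreover have "Poly_Mapping.single r c \<in> free_on (paths_ge 1)"
      using qr \<open>m \<ge> n + 1\<close> by (intro free_on_simps) (auto intro!: bexI[of _ "m - n"])
    ultimately show ?case
      using ideal_prod.prod[of "Poly_Mapping.single q 1" "free_on (paths_ge n)"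
          "Poly_Mapping.single r c" "free_on (paths_ge 1)" "path_alg Q"] qr
      by (simp add: path_alg_def kmul_simps)
  next
    case (add x y)
    then show ?case
      using ideal_prod.sum[of x "path_alg Q" "free_on (paths_ge n)" "free_on (paths_ge 1)" y]
      by (simp add: path_alg_def)
  qed
qed

lemma arrow_ideal_power:
  "arrow_ideal Q [^]\<^bsub>ideals_set (path_alg Q)\<^esub> (n::nat) =
     (free_on (paths_ge n) :: (('v, 'a) qpath \<Rightarrow>\<^sub>0 'k::field) set)"
proof (induction n)
  case 0
  show ?case by (simp add: nat_pow_def ideals_set_def path_alg_carrier)
next
  case (Suc n)
  have "arrow_ideal Q [^]\<^bsub>ideals_set (path_alg Q)\<^esub> Suc n =
      ideal_prod (path_alg Q) (arrow_ideal Q [^]\<^bsub>ideals_set (path_alg Q)\<^esub> n)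
        (arrow_ideal Q :: (('v, 'a) qpath \<Rightarrow>\<^sub>0 'k) set)"
    by (simp add: nat_pow_def ideals_set_def)
  then show ?case using Suc paths_ge_prod[of n] by (simp add: arrow_ideal_eq)
qed

lemma trunc_alg_iso:
  "(path_alg Q :: (('v, 'a) qpath \<Rightarrow>\<^sub>0 'k::field) ring) Quot
       (arrow_ideal Q [^]\<^bsub>ideals_set (path_alg Q)\<^esub> N) \<simeq>
     (trunc_alg Q N :: (('v, 'a) qpath \<Rightarrow>\<^sub>0 'k) ring)"
proof -
  have "trunc N ` carrier (path_alg Q) = carrier (trunc_alg Q N :: (('v, 'a) qpath \<Rightarrow>\<^sub>0 'k) ring)"
  proof (intro subset_antisym image_subsetI subsetI)
    fix x :: "('v, 'a) qpath \<Rightarrow>\<^sub>0 'k"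
    show "x \<in> carrier (path_alg Q) \<Longrightarrow> trunc N x \<in> carrier (trunc_alg Q N)"
      using trunc_closed[of x N] by (simp add: path_alg_carrier trunc_alg_def)
    show "x \<in> carrier (trunc_alg Q N) \<Longrightarrow> x \<in> trunc N ` carrier (path_alg Q)"
      using alg_basis_sub[of N] trunc_id[of x N]
      by (auto simp: path_alg_carrier trunc_alg_def intro!: rev_image_eqI[of x])
  qed
  from ring_hom_ring.FactRing_iso[OF trunc_hom this] show ?thesis
    by (simp add: trunc_kernel arrow_ideal_power)
qed

end

end

theory Submission
  imports Defs
begin

text \<open>
  Write \<open>P\<close> for the minimal resolution and \<open>1 \<otimes> \<pi> \<otimes> 1\<close> for the generator of \<open>P\<^sub>n\<close> attached to a
  path \<open>\<pi>\<close>. The Yoneda product of cocycles \<open>f\<close> on \<open>P\<^sub>m\<close> and \<open>g\<close> on \<open>P\<^sub>n\<close> is the class of \<open>f \<circ> \<phi>\<^sub>m\<close> for a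
  lift \<open>\<phi>\<close> of \<open>g\<close> to a chain map. The class depends neither on the representatives nor on
  the lift (\<open>yoneda_eq\<close>): \<open>P\<close> is exact, so two lifts of one cocycle are homotopic. Exactness comes
  from an explicit contracting homotopy of right modules. Differential and homotopy only move the
  two bars in \<open>\<alpha> \<otimes> \<pi> \<otimes> \<beta>\<close> along the path \<open>\<alpha>\<pi>\<beta>\<close>, and the identities between them reduce to
  telescoping sums.

  Everything then rests on lifts for which \<open>f \<circ> \<phi>\<^sub>m\<close> can be read off.

  For even \<open>n\<close> the cocycle condition says that the values of \<open>g\<close> can be slid along a path,
  \<open>v g(\<tau>) = g(\<tau>') v'\<close> whenever \<open>v\<tau> = \<tau>'v'\<close> with arrows \<open>v\<close> and \<open>v'\<close>. Hence
  \<open>1 \<otimes> \<pi>\<tau> \<otimes> 1 \<mapsto> 1 \<otimes> \<pi> \<otimes> g(\<tau>)\<close> is a chain map, and composing it with \<open>f\<close> gives \<open>f \<or> g\<close> on the nose.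
  The mirror image \<open>1 \<otimes> \<tau>\<pi> \<otimes> 1 \<mapsto> g(\<tau>) \<otimes> \<pi> \<otimes> 1\<close> lifts \<open>g\<close> as well and gives \<open>g \<or> f\<close>, so that uniqueness
  of the product yields commutativity without any further computation.

  For odd \<open>n\<close> the cocycle condition is the vanishing of a sum of \<open>N\<close> terms. The map
  \<open>1 \<otimes> \<pi>\<tau> \<otimes> 1 \<mapsto> 1 \<otimes> \<pi> \<otimes> g(\<tau>)\<close> still works in even degrees, which settles even \<open>m\<close>; in odd degrees
  it is replaced by a double sum (\<open>odd_lift\<close>). For odd \<open>m\<close> and \<open>n\<close> each term of \<open>f \<circ> \<phi>\<^sub>m\<close> contains, besides
  one value of \<open>f\<close> and one of \<open>g\<close>, exactly \<open>N - 2\<close> arrows. In characteristic 0 an odd cocycle has no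
  component in degree 0 (\<open>odd_cocycle_degree_0\<close>), hence both values have length at least 1, each term has
  length at least \<open>N\<close>, and the product is 0 already as a cochain.

  So \<open>\<or>\<close> computes the Yoneda product (\<open>yoneda_vee\<close>). It is strictly associative on cochains, because both
  bracketings vanish unless at most one degree is odd and otherwise concatenate paths. The
  differential is homogeneous for the length of the first path of a pair, so this length induces
  the second grading on cohomology, and \<open>\<or>\<close> adds lengths.
\<close>

abbreviation "single \<equiv> Poly_Mapping.single"
abbreviation "lookup \<equiv> Poly_Mapping.lookup"
abbreviation "keys \<equiv> Poly_Mapping.keys"

type_synonym ('v, 'a, 'k) palg = "('v, 'a) qpath \<Rightarrow>\<^sub>0 'k"

section \<open>Linear and bilinear extensions\<close>

lemma additive_rules:
  fixes f :: "'x::ab_group_add \<Rightarrow> 'y::ab_group_add"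
  assumes add: "\<And>x y. f (x + y) = f x + f y"
  shows "f 0 = 0" "f (- x) = - f x" "f (x - y) = f x - f y" "f (sum g S) = (\<Sum>s\<in>S. f (g s))"
proof -
  show zero: "f 0 = 0" using add[of 0 0] by simp
  show minus: "f (- x) = - f x" for x using add[of x "- x"] zero by (simp add: eq_neg_iff_add_eq_0 add.commute)
  show "f (x - y) = f x - f y" using add[of x "- y"] minus[of y] by simp
  show "f (sum g S) = (\<Sum>s\<in>S. f (g s))"
    by (induction S rule: infinite_finite_induct) (auto simp: add zero)
qed

lemma scal_rules: "scal c (- x) = - scal c x" "scal c (x - y) = scal c x - scal c y"
  using additive_rules[of "scal c"] by (simp_all add: scal_simps)

lemma single_scal: "single b c = scal c (single b 1)"
  by (simp add: scal_simps)

lemma lin_ext_rules: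
  fixes F :: "'b \<Rightarrow> ('c \<Rightarrow>\<^sub>0 'k::field)"
  shows "lin_ext F (scal c x) = scal c (lin_ext F x)" "lin_ext F (- x) = - lin_ext F x"
    "lin_ext F (x - y) = lin_ext F x - lin_ext F y" "lin_ext F (sum g S) = (\<Sum>s\<in>S. lin_ext F (g s))"
proof -
  show "lin_ext F (scal c x) = scal c (lin_ext F x)"
    using free_on_all[of x] by (induction rule: free_on_induct) (auto simp: lin_ext_add scal_simps)
qed (simp_all add: additive_rules[of "lin_ext F"] lin_ext_add)

lemma lin_ext_scal_fun: "lin_ext (\<lambda>b. scal c (F b)) x = scal c (lin_ext F x)"
  by (simp add: lin_ext_def scal_sum scal_simps mult.commute)

lemma bilin_ext_rules:
  fixes F :: "'b \<Rightarrow> 'c \<Rightarrow> ('d \<Rightarrow>\<^sub>0 'k::field)"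
  shows "bilin_ext F (x + x') y = bilin_ext F x y + bilin_ext F x' y"
    "bilin_ext F x (y + y') = bilin_ext F x y + bilin_ext F x y'"
    "bilin_ext F 0 y = 0" "bilin_ext F x 0 = 0"
    "bilin_ext F (- x) y = - bilin_ext F x y" "bilin_ext F x (- y) = - bilin_ext F x y"
    "bilin_ext F (x - x') y = bilin_ext F x y - bilin_ext F x' y"
    "bilin_ext F x (y - y') = bilin_ext F x y - bilin_ext F x y'"
    "bilin_ext F (scal c x) y = scal c (bilin_ext F x y)"
    "bilin_ext F x (scal c y) = scal c (bilin_ext F x y)"
    "bilin_ext F (sum g S) y = (\<Sum>s\<in>S. bilin_ext F (g s) y)"
    "bilin_ext F x (sum h S) = (\<Sum>s\<in>S. bilin_ext F x (h s))"
  using additive_rules[of "\<lambda>x. bilin_ext F x y"] additive_rules[of "bilin_ext F x"]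
  by (simp_all add: bilin_ext_add bilin_ext_def[of F] lin_ext_rules lin_ext_scal_fun)

text \<open>Reduces a statement that is additive in two arguments to pairs of basis vectors.\<close>

lemma bilin_free_on_induct [consumes 2, case_names zero_left zero_right single add_left add_right]:
  fixes x :: "'b \<Rightarrow>\<^sub>0 'k::field" and y :: "'c \<Rightarrow>\<^sub>0 'l::field"
  assumes "x \<in> free_on B" "y \<in> free_on C" "\<And>y. P 0 y" "\<And>x. P x 0"
    "\<And>b c p q. b \<in> B \<Longrightarrow> p \<in> C \<Longrightarrow> P (single b c) (single p q)"
    "\<And>x x' y. x \<in> free_on B \<Longrightarrow> x' \<in> free_on B \<Longrightarrow> y \<in> free_on C \<Longrightarrow> P x y \<Longrightarrow> P x' y \<Longrightarrow> P (x + x') y"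
    "\<And>x y y'. x \<in> free_on B \<Longrightarrow> y \<in> free_on C \<Longrightarrow> y' \<in> free_on C \<Longrightarrow> P x y \<Longrightarrow> P x y' \<Longrightarrow> P x (y + y')"
  shows "P x y"
  using assms(1)
proof (induction rule: free_on_induct)
  case (single b c)
  show ?case using assms(2)
    by (induction rule: free_on_induct) (auto intro: assms single free_on_simps)
qed (use assms in auto)

lemma lin_ext_free_on:
  fixes F :: "'b \<Rightarrow> ('c \<Rightarrow>\<^sub>0 'k::field)"
  assumes "x \<in> free_on B" "\<And>b. b \<in> B \<Longrightarrow> F b \<in> free_on C"
  shows "lin_ext F x \<in> free_on C"
  using assms(1)
proof (induction rule: free_on_induct)
  case (single b c)
  then show ?case using assms(2)[of b] by (auto simp: free_on_def in_keys_iff)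
qed (auto simp: lin_ext_add free_on_simps)

lemma free_on_rules:
  fixes x :: "'b \<Rightarrow>\<^sub>0 'k::field"
  shows "x \<in> free_on B \<Longrightarrow> scal c x \<in> free_on B" "x \<in> free_on B \<Longrightarrow> y \<in> free_on B \<Longrightarrow> x - y \<in> free_on B"
    "(\<And>s. s \<in> S \<Longrightarrow> f s \<in> free_on B) \<Longrightarrow> (sum f S :: 'b \<Rightarrow>\<^sub>0 'k) \<in> free_on B"
proof -
  show "x \<in> free_on B \<Longrightarrow> scal c x \<in> free_on B" by (auto simp: free_on_def in_keys_iff)
  show "x \<in> free_on B \<Longrightarrow> y \<in> free_on B \<Longrightarrow> x - y \<in> free_on B"
    using free_on_simps(2)[of x B "- y"] free_on_uminus[of y B] by simp
  show "(\<And>s. s \<in> S \<Longrightarrow> f s \<in> free_on B) \<Longrightarrow> (sum f S :: 'b \<Rightarrow>\<^sub>0 'k) \<in> free_on B"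
    by (induction S rule: infinite_finite_induct) (auto simp: free_on_simps)
qed

lemma free_on_mono: "B \<subseteq> C \<Longrightarrow> free_on B \<subseteq> free_on C"
  by (auto simp: free_on_def)

lemma trunc_rules:
  fixes x y :: "('v, 'a, 'k::field) palg"
  shows "trunc N (scal c x) = scal c (trunc N x)" "trunc N (- x) = - trunc N x"
    "trunc N (x - y) = trunc N x - trunc N y" "trunc N (sum g S) = (\<Sum>s\<in>S. trunc N (g s))"
  unfolding trunc_def by (simp_all add: lin_ext_rules)

lemmas kmul_rules = bilin_ext_rules[where F =
  "\<lambda>p q. if ptgt Q p = psrc q then single (pcat p q) 1 else 0" for Q, folded kmul_def]


lemma lin_ext_fun_diff: "lin_ext (\<lambda>b. F b - G b) x = lin_ext F x - lin_ext G x"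
  by (simp add: lin_ext_def scal_rules sum_subtractf)

lemma lin_ext_fun_sum: "lin_ext (\<lambda>b. \<Sum>j\<in>S. F j b) x = (\<Sum>j\<in>S. lin_ext (F j) x)"
  by (induction S rule: infinite_finite_induct) (auto simp: lin_ext_fun_add)

lemma res_len_simps:
  "res_len N (2 * k) = k * N" "res_len N (2 * k + 1) = k * N + 1" "res_len N (Suc (2 * k)) = k * N + 1"
  "res_len N (2 * k + 2) = k * N + N" "res_len N 0 = 0" "res_len N 1 = 1"
  by (simp_all add: res_len_def)

section \<open>Segments of a path\<close>

text \<open>
  \<open>vx Q w i\<close> is the \<open>i\<close>-th vertex on the path \<open>w\<close>, counted from 0, and \<open>seg Q w i j\<close> is the part of \<open>w\<close>
  between the \<open>i\<close>-th and the \<open>j\<close>-th vertex. Naming both ends makes concatenation and subsegments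
  visible in the indices.
\<close>

definition vx :: "('v, 'a) pre_digraph \<Rightarrow> ('v, 'a) qpath \<Rightarrow> nat \<Rightarrow> 'v" where
  "vx Q w i = ptgt Q (fst w, take i (snd w))"

definition seg :: "('v, 'a) pre_digraph \<Rightarrow> ('v, 'a) qpath \<Rightarrow> nat \<Rightarrow> nat \<Rightarrow> ('v, 'a) qpath" where
  "seg Q w i j = psub Q w i (j - i)"

lemma seg_simps:
  "psrc (seg Q w i j) = vx Q w i" "seg Q w i i = (vx Q w i, [])"
  "j \<le> plen w \<Longrightarrow> plen (seg Q w i j) = j - i"
  by (auto simp: seg_def psub_def vx_def psrc_def plen_def)

lemma vx_0: "vx Q w 0 = psrc w"
  by (simp add: vx_def psrc_def path_simps)

lemma vx_plen: "vx Q w (plen w) = ptgt Q w"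
  by (simp add: vx_def plen_def)

lemma seg_full: "seg Q w 0 (plen w) = w"
  by (simp add: seg_def psub_def path_simps) (simp add: plen_def)

lemma ptgt_seg: "i \<le> j \<Longrightarrow> j \<le> plen w \<Longrightarrow> ptgt Q (seg Q w i j) = vx Q w j"
proof -
  assume "i \<le> j" "j \<le> plen w"
  then have "(fst w, take j (snd w)) = pcat (fst w, take i (snd w)) (seg Q w i j)"
    by (simp add: pcat_def seg_def psub_def take_add[symmetric])
  moreover have "ptgt Q (fst w, take i (snd w)) = psrc (seg Q w i j)"
    by (simp add: seg_simps vx_def)
  ultimately show ?thesis by (simp add: vx_def ptgt_pcat)
qed

lemma pcat_seg: "i \<le> j \<Longrightarrow> j \<le> k \<Longrightarrow> pcat (seg Q w i j) (seg Q w j k) = seg Q w i k"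
  using take_add[of "j - i" "k - j" "drop i (snd w)"]
  by (simp add: pcat_def seg_def psub_def)

text \<open>
  Segments of segments are segments of the ambient path, so that iterated differentials can be
  compared inside one path.
\<close>

lemma seg_seg:
  assumes "i \<le> j" "a + j \<le> b" "b \<le> plen w"
  shows "seg Q (seg Q w a b) i j = seg Q w (a + i) (a + j)"
proof -
  have "(vx Q w a, take i (take (b - a) (drop a (snd w)))) = seg Q w a (a + i)"
    using assms by (simp add: seg_def psub_def vx_def min_def)
  then have "vx Q (seg Q w a b) i = vx Q w (a + i)"
    using ptgt_seg[of a "a + i" w Q] assms by (simp add: vx_def[of Q "seg Q w a b"]) (simp add: seg_def psub_def vx_def)
  then show ?thesis
    using assms by (simp add: seg_def[of Q "seg Q w a b"] seg_def[of Q w "a + i"] psub_def vx_def[symmetric])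
      (simp add: seg_def psub_def drop_take add.commute)
qed

lemma seg_pcat:
  assumes "ptgt Q p = psrc q"
  shows "seg Q (pcat p q) 0 (plen p) = p" "seg Q (pcat p q) (plen p) (plen p + plen q) = q"
proof -
  have "(fst p, snd p) = p" by simp
  then show "seg Q (pcat p q) 0 (plen p) = p" "seg Q (pcat p q) (plen p) (plen p + plen q) = q"
    using assms by (auto simp: seg_def psub_def pcat_def plen_def path_simps prod_eq_iff psrc_def)
qed

lemma finite_qpaths: "fin_digraph Q \<Longrightarrow> finite (qpaths Q n)"
proof -
  assume "fin_digraph Q"
  then interpret fin_digraph Q .
  have "qpaths Q n \<subseteq> verts Q \<times> {l. set l \<subseteq> arcs Q \<and> length l = n}"
    by (auto simp: qpaths_def plen_def psrc_def awalk_def)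
  then show ?thesis
    by (rule finite_subset) (intro finite_cartesian_product finite_verts finite_lists_length_eq finite_arcs)
qed

lemma seg_in_qpaths:
  assumes "fin_digraph Q" "w \<in> qpaths Q L" "i \<le> j" "j \<le> L"
  shows "seg Q w i j \<in> qpaths Q (j - i)"
proof -
  interpret fin_digraph Q by fact
  have L: "plen w = L" using assms by (simp add: qpaths_plen)
  have "awalk (psrc w) (take i (snd w) @ take (j - i) (drop i (snd w)) @ drop j (snd w)) (ptgt Q w)"
    using assms append_take_drop_id[of "j - i" "drop i (snd w)"] by (simp add: qpaths_def)
  then have "awalk (vx Q w i) (take (j - i) (drop i (snd w))) (ptgt Q (seg Q w i j))"
    unfolding awalk_append_iff by (simp add: seg_def psub_def vx_def ptgt_def psrc_def)
  then show ?thesis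
    using assms L by (simp add: qpaths_def seg_simps) (simp add: seg_def psub_def)
qed

section \<open>The bimodules of the resolution\<close>

locale truncated_quiver = fin_digraph Q for Q :: "('v, 'a) pre_digraph" +
  fixes N :: nat
  assumes N_pos: "1 \<le> N"
begin

abbreviation path_mult (infixl "\<star>" 70) where "x \<star> y \<equiv> kmul Q x y"
abbreviation bd where "bd \<equiv> res_diff Q N"
abbreviation E where "E w i j \<equiv> single (seg Q w i j) 1"
abbreviation ev where "ev v \<equiv> single (v, []) 1"

lemmas trunc_eqs = trunc_simps[OF fin_digraph_axioms]

lemma mult_assoc: "x \<star> y \<star> z = x \<star> (y \<star> z)" for x y z :: "('v, 'a, 'k::field) palg"
  by (rule kmul_assoc[OF fin_digraph_axioms])

lemma trunc_mult:
  fixes x y :: "('v, 'a, 'k::field) palg"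
  shows "trunc N (trunc N x \<star> y) = trunc N (x \<star> y)" "trunc N (x \<star> trunc N y) = trunc N (x \<star> y)"
  by (simp_all add: trunc_kmul[OF fin_digraph_axioms])

lemma trunc_mult_cong:
  fixes x y :: "('v, 'a, 'k::field) palg"
  assumes "trunc N x = trunc N x'"
  shows "trunc N (x \<star> y) = trunc N (x' \<star> y)" "trunc N (y \<star> x) = trunc N (y \<star> x')"
  by (metis assms trunc_mult)+

lemma E_mult:
  assumes "i \<le> j" "j \<le> k" "k \<le> plen w"
  shows "E w i j \<star> E w j k = (E w i k :: ('v, 'a, 'k::field) palg)"
    "E w i j \<star> (E w j k \<star> z) = (E w i k \<star> z :: ('v, 'a, 'k::field) palg)"
  using assms by (simp_all add: kmul_simps seg_simps ptgt_seg pcat_seg mult_assoc[symmetric])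

text \<open>
  \<open>ten x \<pi> y\<close> is \<open>x \<otimes> \<pi> \<otimes> y\<close>, bilinear in \<open>x\<close> and \<open>y\<close> and 0 on paths that do not compose with \<open>\<pi>\<close> or are
  zero in \<open>A\<close>. With this convention the formulas for differentials and lifts hold for arbitrary elements
  of the path algebra, and identities between them become identities between products in an
  associative algebra.
\<close>

definition ten :: "('v, 'a, 'k::field) palg \<Rightarrow> ('v, 'a) qpath \<Rightarrow> ('v, 'a, 'k) palg \<Rightarrow> ('v, 'a, 'k) bimod" where
  "ten x \<pi> y = bilin_ext (\<lambda>\<alpha> \<beta>. if ptgt Q \<alpha> = psrc \<pi> \<and> ptgt Q \<pi> = psrc \<beta> then tens N \<alpha> \<pi> \<beta> else 0) x y"

text \<open>
  For a path \<open>w\<close>, \<open>cut w i j y\<close> is \<open>w\<^sub>1\<dots>w\<^sub>i \<otimes> w\<^bsub>i+1\<^esub>\<dots>w\<^sub>j \<otimes> y\<close>, and \<open>val g w i j\<close> is the value of the cochain \<open>g\<close> on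
  \<open>w\<^bsub>i+1\<^esub>\<dots>w\<^sub>j\<close>.
\<close>

abbreviation cut where "cut w i j \<equiv> ten (E w 0 i) (seg Q w i j)"

abbreviation val where "val g w i j \<equiv> coch_val g (seg Q w i j)"

lemmas ten_rules = bilin_ext_rules[where F =
  "\<lambda>\<alpha> \<beta>. if ptgt Q \<alpha> = psrc \<pi> \<and> ptgt Q \<pi> = psrc \<beta> then tens N \<alpha> \<pi> \<beta> else 0" for \<pi>, folded ten_def]

lemmas lact_rules = bilin_ext_rules[where F =
  "\<lambda>p (\<alpha>, \<pi>, \<beta>). if ptgt Q p = psrc \<alpha> then tens N (pcat p \<alpha>) \<pi> \<beta> else 0", folded lact_def]

lemmas ract_rules = bilin_ext_rules[where F =
  "\<lambda>(\<alpha>, \<pi>, \<beta>) p. if ptgt Q \<beta> = psrc p then tens N \<alpha> \<pi> (pcat \<beta> p) else 0", folded ract_def]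

lemma act_single:
  "lact Q N (single p c) (single (\<alpha>, \<pi>, \<beta>) d) =
     scal (c * d) (if ptgt Q p = psrc \<alpha> then tens N (pcat p \<alpha>) \<pi> \<beta> else (0 :: ('v, 'a, 'k::field) bimod))"
  "ract Q N (single (\<alpha>, \<pi>, \<beta>) d) (single p c) =
     scal (d * c) (if ptgt Q \<beta> = psrc p then tens N \<alpha> \<pi> (pcat \<beta> p) else (0 :: ('v, 'a, 'k::field) bimod))"
  by (simp_all add: lact_def ract_def)

lemma ten_single:
  "ten (single \<alpha> c) \<pi> (single \<beta> d) =
    (if ptgt Q \<alpha> = psrc \<pi> \<and> ptgt Q \<pi> = psrc \<beta> \<and> plen \<alpha> < N \<and> plen \<beta> < N
     then single (\<alpha>, \<pi>, \<beta>) (c * d) else (0 :: ('v, 'a, 'k::field) bimod))"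
  by (simp add: ten_def tens_def scal_simps)

lemma ten_trunc:
  fixes x y :: "('v, 'a, 'k::field) palg"
  shows "ten (trunc N x) \<pi> y = ten x \<pi> y" "ten x \<pi> (trunc N y) = ten x \<pi> y"
proof -
  have "ten (trunc N x) \<pi> y = ten x \<pi> y \<and> ten x \<pi> (trunc N y) = ten x \<pi> y"
    using free_on_all[of x] free_on_all[of y]
    by (induction rule: bilin_free_on_induct) (auto simp: ten_rules trunc_eqs ten_single)
  then show "ten (trunc N x) \<pi> y = ten x \<pi> y" "ten x \<pi> (trunc N y) = ten x \<pi> y" by auto
qed

lemma ten_trunc_cong:
  fixes x y :: "('v, 'a, 'k::field) palg"
  shows "trunc N x = trunc N x' \<Longrightarrow> ten x \<pi> y = ten x' \<pi> y"
    "trunc N y = trunc N y' \<Longrightarrow> ten x \<pi> y = ten x \<pi> y'"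
  by (metis ten_trunc)+

lemma lact_ten: "lact Q N a (ten x \<pi> y) = ten (a \<star> x) \<pi> y"
  for a :: "('v, 'a, 'k::field) palg"
  using free_on_all[of x] free_on_all[of y]
proof (induction rule: bilin_free_on_induct)
  case (single b c p q)
  show ?case using free_on_all[of a]
    by (induction rule: free_on_induct)
      (auto simp: lact_rules kmul_rules kmul_simps ten_rules ten_single act_single tens_def path_simps ptgt_pcat scal_simps mult_ac)
qed (auto simp: lact_rules ten_rules kmul_rules)

lemma ract_ten: "ract Q N (ten x \<pi> y) a = ten x \<pi> (y \<star> a)"
  for a :: "('v, 'a, 'k::field) palg"
  using free_on_all[of x] free_on_all[of y]
proof (induction rule: bilin_free_on_induct)
  case (single b c p q)
  show ?case using free_on_all[of a]
    by (induction rule: free_on_induct)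
      (auto simp: ract_rules kmul_rules kmul_simps ten_rules ten_single act_single tens_def path_simps ptgt_pcat scal_simps mult_ac)
qed (auto simp: ract_rules ten_rules kmul_rules)

lemma lact_mult: "lact Q N (a \<star> b) x = lact Q N a (lact Q N b x)"
  for a :: "('v, 'a, 'k::field) palg"
  using free_on_all[of a] free_on_all[of b]
proof (induction rule: bilin_free_on_induct)
  case (single p c q d)
  show ?case using free_on_all[of x]
    by (induction rule: free_on_induct)
      (auto simp: lact_rules kmul_simps act_single tens_def path_simps ptgt_pcat scal_simps mult_ac)
qed (auto simp: lact_rules kmul_rules)

lemma ract_mult: "ract Q N x (a \<star> b) = ract Q N (ract Q N x a) b"
  for a :: "('v, 'a, 'k::field) palg"
  using free_on_all[of a] free_on_all[of b]
proof (induction rule: bilin_free_on_induct)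
  case (single p c q d)
  show ?case using free_on_all[of x]
    by (induction rule: free_on_induct)
      (auto simp: ract_rules kmul_simps act_single tens_def path_simps ptgt_pcat scal_simps mult_ac)
qed (auto simp: ract_rules kmul_rules)

lemma lact_ract: "lact Q N a (ract Q N x b) = ract Q N (lact Q N a x) b"
  for a :: "('v, 'a, 'k::field) palg"
  using free_on_all[of a] free_on_all[of b]
proof (induction rule: bilin_free_on_induct)
  case (single p c q d)
  show ?case using free_on_all[of x]
    by (induction rule: free_on_induct)
      (auto simp: lact_rules ract_rules act_single tens_def path_simps ptgt_pcat scal_simps mult_ac)
qed (auto simp: lact_rules ract_rules)

lemma act_trunc:
  fixes a :: "('v, 'a, 'k::field) palg"
  shows "lact Q N (trunc N a) x = lact Q N a x" "ract Q N x (trunc N a) = ract Q N x a"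
proof -
  have "lact Q N (trunc N a) x = lact Q N a x \<and> ract Q N x (trunc N a) = ract Q N x a"
    using free_on_all[of a] free_on_all[of x]
    by (induction rule: bilin_free_on_induct)
      (auto simp: lact_rules ract_rules trunc_eqs act_single tens_def path_simps scal_simps)
  then show "lact Q N (trunc N a) x = lact Q N a x" "ract Q N x (trunc N a) = ract Q N x a" by auto
qed

lemma ten_ev:
  fixes x y :: "('v, 'a, 'k::field) palg"
  shows "psrc \<pi> = v \<Longrightarrow> ten (x \<star> ev v) \<pi> y = ten x \<pi> y" "ptgt Q \<pi> = v \<Longrightarrow> ten x \<pi> (ev v \<star> y) = ten x \<pi> y"
proof -
  have "ten (x \<star> ev (psrc \<pi>)) \<pi> y = ten x \<pi> y \<and> ten x \<pi> (ev (ptgt Q \<pi>) \<star> y) = ten x \<pi> y"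
    using free_on_all[of x] free_on_all[of y]
  proof (induction rule: bilin_free_on_induct)
    case (single p c q d)
    have "pcat (psrc q, []) q = q" by (simp add: path_simps)
    then show ?case by (auto simp: kmul_simps ten_rules ten_single path_simps)
  qed (auto simp: ten_rules kmul_rules)
  then show "psrc \<pi> = v \<Longrightarrow> ten (x \<star> ev v) \<pi> y = ten x \<pi> y" "ptgt Q \<pi> = v \<Longrightarrow> ten x \<pi> (ev v \<star> y) = ten x \<pi> y" by auto
qed

definition gen :: "('v, 'a) qpath \<Rightarrow> ('v, 'a, 'k::field) bimod" where
  "gen \<pi> = ten (ev (psrc \<pi>)) \<pi> (ev (ptgt Q \<pi>))"

lemma gen_eq: "gen \<pi> = (single ((psrc \<pi>, []), \<pi>, (ptgt Q \<pi>, [])) 1 :: ('v, 'a, 'k::field) bimod)"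
  using N_pos by (simp add: gen_def ten_single path_simps)

lemma ten_gen: "ten x \<pi> y = lact Q N x (ract Q N (gen \<pi>) y)"
  for x y :: "('v, 'a, 'k::field) palg"
  by (simp add: gen_def ract_ten lact_ten ten_ev)

lemma res_mod_induct [consumes 1, case_names zero ten add]:
  fixes x :: "('v, 'a, 'k::field) bimod"
  assumes "x \<in> res_mod Q N n" "P 0"
    "\<And>\<alpha> \<pi> \<beta> c. (\<alpha>, \<pi>, \<beta>) \<in> res_basis Q N n \<Longrightarrow> P (ten (single \<alpha> c) \<pi> (single \<beta> 1))"
    "\<And>x y. x \<in> res_mod Q N n \<Longrightarrow> y \<in> res_mod Q N n \<Longrightarrow> P x \<Longrightarrow> P y \<Longrightarrow> P (x + y)"
  shows "P x"
  using assms(1)[unfolded res_mod_def]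
proof (induction rule: free_on_induct)
  case (single b c)
  obtain \<alpha> \<pi> \<beta> where b: "b = (\<alpha>, \<pi>, \<beta>)" by (cases b)
  then have "single b c = ten (single \<alpha> c) \<pi> (single \<beta> 1)"
    using single by (auto simp: ten_single res_basis_def alg_basis_def dest!: qpaths_plen)
  then show ?case using assms(3) single b by simp
qed (use assms in \<open>auto simp: res_mod_def\<close>)

text \<open>
  The corner \<open>e\<^sub>v P\<^sub>n e\<^sub>w\<close>. A bimodule map may send \<open>1 \<otimes> \<pi> \<otimes> 1\<close> to any element of the corner cut out by the
  ends of \<open>\<pi>\<close>, and to nothing else.
\<close>

definition corner :: "nat \<Rightarrow> 'v \<Rightarrow> 'v \<Rightarrow> ('v, 'a, 'k::field) bimod set" where
  "corner n v w = free_on {(\<alpha>, \<pi>, \<beta>) \<in> res_basis Q N n. psrc \<alpha> = v \<and> ptgt Q \<beta> = w}"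

lemma corner_sub: "corner n v w \<subseteq> res_mod Q N n"
  unfolding corner_def res_mod_def by (intro free_on_mono) auto

abbreviation paths :: "('v, 'a) qpath set" where "paths \<equiv> (\<Union>n. qpaths Q n)"

text \<open>
  The elements of the path algebra with source \<open>v\<close> and end \<open>w\<close> that lie in the \<open>d\<close>-th power of the
  arrow ideal.
\<close>

definition pcorner :: "nat \<Rightarrow> 'v \<Rightarrow> 'v \<Rightarrow> ('v, 'a, 'k::field) palg set" where
  "pcorner d v w = free_on {p. (\<exists>n\<ge>d. p \<in> qpaths Q n) \<and> psrc p = v \<and> ptgt Q p = w}"

lemma pcorner_mult:
  assumes "x \<in> pcorner d u v" "y \<in> pcorner e v w"
  shows "x \<star> y \<in> (pcorner (d + e) u w :: ('v, 'a, 'k::field) palg set)"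
  using assms unfolding pcorner_def
proof (induction rule: bilin_free_on_induct)
  case (single p c q c')
  then obtain m n where mn: "m \<ge> d" "n \<ge> e" "p \<in> qpaths Q m" "q \<in> qpaths Q n" by auto
  then have "pcat p q \<in> qpaths Q (m + n)" "d + e \<le> m + n"
    using qpaths_pcat[OF fin_digraph_axioms mn(3,4)] single by auto
  with single show ?case
    by (auto simp: kmul_simps path_simps ptgt_pcat intro!: free_on_simps)
qed (auto simp: kmul_rules free_on_simps)

lemma pcorner_E:
  assumes "w \<in> qpaths Q L" "i \<le> j" "j \<le> L" "d \<le> j - i"
  shows "E w i j \<in> (pcorner d (vx Q w i) (vx Q w j) :: ('v, 'a, 'k::field) palg set)"
  using assms seg_in_qpaths[OF fin_digraph_axioms assms(1-3)] qpaths_plen[OF assms(1)]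
  by (auto simp: pcorner_def seg_simps ptgt_seg intro!: free_on_simps)

lemma pcorner_ev: "v \<in> verts Q \<Longrightarrow> ev v \<in> (pcorner 0 v v :: ('v, 'a, 'k::field) palg set)"
  using vert_qpaths[OF fin_digraph_axioms, of v]
  by (auto simp: pcorner_def path_simps intro!: free_on_simps)

lemma pcorner_ev_mult:
  fixes x :: "('v, 'a, 'k::field) palg"
  assumes "x \<in> pcorner d v w" shows "ev v \<star> x = x" "x \<star> ev w = x"
proof -
  have "ev v \<star> x = x \<and> x \<star> ev w = x"
    using assms unfolding pcorner_def
  proof (induction rule: free_on_induct)
    case (single p c)
    then have "pcat (v, []) p = p" using path_simps(8)[of p] by auto
    then show ?case using single by (auto simp: kmul_simps path_simps)
  qed (auto simp: kmul_rules)
  then show "ev v \<star> x = x" "x \<star> ev w = x" by auto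
qed

lemma ten_corner:
  fixes x y :: "('v, 'a, 'k::field) palg"
  assumes "x \<in> pcorner d u (psrc \<pi>)" "\<pi> \<in> qpaths Q (res_len N n)" "y \<in> pcorner e (ptgt Q \<pi>) v"
  shows "ten x \<pi> y \<in> corner n u v"
  using assms(1,3) unfolding pcorner_def
proof (induction rule: bilin_free_on_induct)
  case (single p c q d)
  then show ?case using assms(2)
    by (auto simp: ten_single corner_def res_basis_def alg_basis_def free_on_simps dest: qpaths_plen intro!: free_on_simps)
qed (auto simp: ten_rules corner_def free_on_simps)

lemma corner_act:
  fixes x :: "('v, 'a, 'k::field) bimod"
  assumes "x \<in> corner n v w" shows "lact Q N (ev v) x = x" "ract Q N x (ev w) = x"
    "ptgt Q p \<noteq> v \<Longrightarrow> lact Q N (single p c) x = 0"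
    "psrc p \<noteq> w \<Longrightarrow> ract Q N x (single p c) = 0"
proof -
  have "lact Q N (ev v) x = x \<and> ract Q N x (ev w) = x \<and>
     (ptgt Q p \<noteq> v \<longrightarrow> lact Q N (single p c) x = 0) \<and>
     (psrc p \<noteq> w \<longrightarrow> ract Q N x (single p c) = 0)"
    using assms unfolding corner_def
  proof (induction rule: free_on_induct)
    case (single b d)
    then obtain \<alpha> \<pi> \<beta> where b: "b = (\<alpha>, \<pi>, \<beta>)" "(\<alpha>, \<pi>, \<beta>) \<in> res_basis Q N n" "psrc \<alpha> = v" "ptgt Q \<beta> = w" by auto
    then have "pcat (v, []) \<alpha> = \<alpha>" "plen \<alpha> < N" "plen \<beta> < N"
      using path_simps(8)[of \<alpha>] by (auto simp: res_basis_def alg_basis_def dest!: qpaths_plen)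
    then show ?case using b by (auto simp: act_single path_simps tens_def scal_simps)
  qed (auto simp: lact_rules ract_rules)
  then show "lact Q N (ev v) x = x" "ract Q N x (ev w) = x"
    "ptgt Q p \<noteq> v \<Longrightarrow> lact Q N (single p c) x = 0"
    "psrc p \<noteq> w \<Longrightarrow> ract Q N x (single p c) = 0" by auto
qed

section \<open>The differential\<close>

text \<open>
  A path with at least \<open>N\<close> arrows is zero in \<open>A\<close>. This is why
  the two ends of the telescoping sums for \<open>d \<circ> d\<close> vanish.
\<close>

lemma ten_long:
  fixes x y :: "('v, 'a, 'k::field) palg"
  assumes "j \<le> plen w" "i + N \<le> j"
  shows "ten (x \<star> E w i j) \<pi> y = 0" "ten (E w i j) \<pi> y = 0" "ten x \<pi> (E w i j \<star> y) = 0"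
proof -
  have E: "trunc N (E w i j) = (0 :: ('v, 'a, 'k) palg)"
    using assms by (auto simp: trunc_eqs seg_simps)
  have "trunc N (x \<star> E w i j) = 0" "trunc N (E w i j \<star> y) = 0"
    using trunc_mult(1)[of "E w i j" y] trunc_mult(2)[of x "E w i j"] E by (simp_all add: kmul_rules trunc_eqs)
  then show "ten (x \<star> E w i j) \<pi> y = 0" "ten (E w i j) \<pi> y = 0" "ten x \<pi> (E w i j \<star> y) = 0"
    using E by (metis ten_trunc ten_rules(3,4))+
qed

lemma res_term_ten:
  fixes x y :: "('v, 'a, 'k::field) palg"
  assumes "plen \<pi> = L" "j + l \<le> L"
  shows "lin_ext (res_term Q N l j) (ten x \<pi> y) =
    ten (x \<star> E \<pi> 0 j) (seg Q \<pi> j (j + l)) (E \<pi> (j + l) L \<star> y)"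
  using free_on_all[of x] free_on_all[of y]
proof (induction rule: bilin_free_on_induct)
  case (single p c q d)
  have [simp]: "psub Q \<pi> 0 j = seg Q \<pi> 0 j" "psub Q \<pi> j l = seg Q \<pi> j (j + l)"
    "psub Q \<pi> (j + l) (plen \<pi> - (j + l)) = seg Q \<pi> (j + l) L"
    using assms by (simp_all add: seg_def)
  have "psrc \<pi> = vx Q \<pi> 0" "ptgt Q \<pi> = vx Q \<pi> L"
    using assms vx_plen[of Q \<pi>] by (simp_all add: vx_0)
  then show ?case
    using assms by (auto simp: ten_single res_term_def tens_def kmul_simps ten_rules seg_simps ptgt_seg ptgt_pcat path_simps scal_simps)
qed (auto simp: lin_ext_add lin_ext_rules ten_rules kmul_rules)

lemma E_refl: "E w i i = ev (vx Q w i)"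
  by (simp add: seg_simps)

lemma ten_E_refl:
  fixes x y :: "('v, 'a, 'k::field) palg"
  assumes "i \<le> j" "j \<le> plen w"
  shows "ten (x \<star> E w i i) (seg Q w i j) y = ten x (seg Q w i j) y"
    "ten x (seg Q w i j) (E w j j \<star> y) = ten x (seg Q w i j) y"
  using assms by (simp_all add: E_refl ten_ev seg_simps ptgt_seg)

text \<open>
  The differential moves the bars along \<open>w\<close>; the outer factors absorb the arrows that leave the middle.
\<close>

lemma res_diff_even:
  fixes x y :: "('v, 'a, 'k::field) palg"
  assumes "b = a + k * N + N" "b \<le> plen w"
  shows "bd (2 * k + 2) (ten x (seg Q w a b) y) =
    (\<Sum>j<N. ten (x \<star> E w a (a + j)) (seg Q w (a + j) (a + j + k * N + 1)) (E w (a + j + k * N + 1) b \<star> y))"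
proof -
  have "bd (2 * k + 2) (ten x (seg Q w a b) y) =
     (\<Sum>j<N. lin_ext (res_term Q N (k * N + 1) j) (ten x (seg Q w a b) y))"
    by (simp add: res_diff_def lin_ext_fun_sum[symmetric] res_len_simps)
  also have "\<dots> = (\<Sum>j<N. ten (x \<star> E w a (a + j)) (seg Q w (a + j) (a + j + k * N + 1)) (E w (a + j + k * N + 1) b \<star> y))"
  proof (rule sum.cong)
    fix j assume "j \<in> {..<N}"
    then have j: "j + (k * N + 1) \<le> b - a" using assms by simp
    have b: "a + (b - a) = b" using assms by simp
    have "plen (seg Q w a b) = b - a" using assms by (simp add: seg_simps)
    from res_term_ten[OF this j, of x y]
    show "lin_ext (res_term Q N (k * N + 1) j) (ten x (seg Q w a b) y) =
        ten (x \<star> E w a (a + j)) (seg Q w (a + j) (a + j + k * N + 1)) (E w (a + j + k * N + 1) b \<star> y)"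
      using j assms by (simp add: seg_seg add.assoc)
  qed simp
  finally show ?thesis .
qed

lemma res_diff_odd:
  fixes x y :: "('v, 'a, 'k::field) palg"
  assumes "b = a + k * N + 1" "b \<le> plen w"
  shows "bd (2 * k + 1) (ten x (seg Q w a b) y) =
    ten (x \<star> E w a (a + 1)) (seg Q w (a + 1) b) y - ten x (seg Q w a (a + k * N)) (E w (a + k * N) b \<star> y)"
proof -
  have "bd (2 * k + 1) (ten x (seg Q w a b) y) =
     lin_ext (res_term Q N (k * N) 1) (ten x (seg Q w a b) y) - lin_ext (res_term Q N (k * N) 0) (ten x (seg Q w a b) y)"
    by (simp add: res_diff_def lin_ext_fun_diff[symmetric] res_len_simps)
  moreover have "plen (seg Q w a b) = b - a" using assms by (simp add: seg_simps)
  from res_term_ten[OF this, of 1 "k * N" x y] res_term_ten[OF this, of 0 "k * N" x y]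
  have "lin_ext (res_term Q N (k * N) 1) (ten x (seg Q w a b) y) = ten (x \<star> E w a (a + 1)) (seg Q w (a + 1) b) (E w b b \<star> y)"
    "lin_ext (res_term Q N (k * N) 0) (ten x (seg Q w a b) y) =
       ten (x \<star> E w a a) (seg Q w a (a + k * N)) (E w (a + k * N) b \<star> y)"
    using assms by (auto simp: seg_seg simp del: seg_simps(2))
  ultimately show ?thesis
    using assms ten_E_refl(1)[of a "a + k * N" w x] ten_E_refl(2)[of "a + 1" b w _ y] by simp
qed

lemma res_diff_0: "bd 0 x = 0"
  by (simp add: res_diff_def)

lemma res_diff_rules:
  fixes x y :: "('v, 'a, 'k::field) bimod"
  shows "bd n (x + y) = bd n x + bd n y" "bd n 0 = (0 :: ('v, 'a, 'k) bimod)"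
    "bd n (scal c x) = scal c (bd n x)" "bd n (- x) = - bd n x"
    "bd n (x - y) = bd n x - bd n y"
    "bd n (sum g S) = (\<Sum>s\<in>S. bd n (g s))"
  by (simp_all add: res_diff_def lin_ext_add lin_ext_rules)

lemma parity_cases: obtains k :: nat where "n = 2 * k" | k where "n = 2 * k + 1"
  by (metis oddE evenE)

text \<open>Presents a path as a segment of itself, so that the segment formulas apply to generators.\<close>

lemma seg_self: "\<pi> \<in> qpaths Q L \<Longrightarrow> \<pi> = seg Q \<pi> 0 L"
  using seg_full[of Q \<pi>] by (simp add: qpaths_plen)

text \<open>
  Both composites telescope. What remains are the two extreme positions of the bars, and there an
  outer factor contains \<open>N\<close> arrows.
\<close>

lemma res_diff_diff_ten:
  fixes x y :: "('v, 'a, 'k::field) palg"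
  assumes "\<pi> \<in> qpaths Q (res_len N (Suc n))"
  shows "bd n (bd (Suc n) (ten x \<pi> y)) = 0"
proof (cases n rule: parity_cases)
  case (1 k)
  define L where "L = k * N + 1"
  have L: "plen \<pi> = L" and \<pi>: "\<pi> = seg Q \<pi> 0 L"
    using seg_self[OF assms] qpaths_plen[OF assms] 1 by (simp_all add: L_def res_len_simps)
  show ?thesis
  proof (cases k)
    case 0
    then show ?thesis by (simp add: 1 res_diff_0)
  next
    case (Suc k')
    have "2 * k' + 2 = n" "2 * k + 1 = Suc n" using Suc 1 by auto
    define U where "U j = ten (x \<star> E \<pi> 0 j) (seg Q \<pi> j (j + k' * N + 1)) (E \<pi> (j + k' * N + 1) L \<star> y)" for j
    have kN: "k * N = k' * N + N" using Suc by simp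
    have "bd (2 * k + 1) (ten x (seg Q \<pi> 0 L) y) =
       ten (x \<star> E \<pi> 0 1) (seg Q \<pi> 1 L) y - ten x (seg Q \<pi> 0 (k * N)) (E \<pi> (k * N) L \<star> y)"
      using res_diff_odd[of L 0 k \<pi> x y] L by (simp add: L_def)
    moreover have "bd (2 * k' + 2) (ten (x \<star> E \<pi> 0 1) (seg Q \<pi> 1 L) y) = (\<Sum>j<N. U (Suc j))"
      using L kN by (subst res_diff_even) (auto simp: L_def U_def mult_assoc E_mult intro!: sum.cong)
    moreover have "bd (2 * k' + 2) (ten x (seg Q \<pi> 0 (k * N)) (E \<pi> (k * N) L \<star> y)) = (\<Sum>j<N. U j)"
      using L kN by (subst res_diff_even) (auto simp: L_def U_def mult_assoc E_mult intro!: sum.cong)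
    ultimately have "bd (2 * k' + 2) (bd (2 * k + 1) (ten x (seg Q \<pi> 0 L) y)) =
       (\<Sum>j<N. U (Suc j)) - (\<Sum>j<N. U j)"
      by (simp only: res_diff_rules)
    also have "\<dots> = U N - U 0" by (simp add: sum_subtractf[symmetric] sum_lessThan_telescope)
    also have "\<dots> = 0"
      using L kN ten_long(1)[of N \<pi> 0 x] ten_long(3)[of L \<pi> "k' * N + 1"] by (simp add: U_def L_def del: seg_simps(2))
    finally show ?thesis
      using \<pi> \<open>2 * k' + 2 = n\<close> \<open>2 * k + 1 = Suc n\<close> by simp
  qed
next
  case (2 k)
  define L where "L = k * N + N"
  have L: "plen \<pi> = L" and \<pi>: "\<pi> = seg Q \<pi> 0 L"
    using seg_self[OF assms] qpaths_plen[OF assms] 2 res_len_simps(4)[of N k] by (simp_all add: L_def)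
  have n: "2 * k + 2 = Suc n" using 2 by simp
  define T where "T j = ten (x \<star> E \<pi> 0 j) (seg Q \<pi> j (j + k * N)) (E \<pi> (j + k * N) L \<star> y)" for j
  have "bd (2 * k + 2) (ten x (seg Q \<pi> 0 L) y) =
     (\<Sum>j<N. ten (x \<star> E \<pi> 0 j) (seg Q \<pi> j (j + k * N + 1)) (E \<pi> (j + k * N + 1) L \<star> y))"
    using res_diff_even[of L 0 k \<pi> x y] L by (simp add: L_def)
  moreover have "bd (2 * k + 1) (ten (x \<star> E \<pi> 0 j) (seg Q \<pi> j (j + k * N + 1)) (E \<pi> (j + k * N + 1) L \<star> y)) =
      T (Suc j) - T j" if "j < N" for j
    using L that by (subst res_diff_odd) (auto simp: L_def T_def mult_assoc E_mult)
  ultimately have "bd (2 * k + 1) (bd (2 * k + 2) (ten x (seg Q \<pi> 0 L) y)) =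
     (\<Sum>j<N. T (Suc j) - T j)"
    by (simp only: res_diff_rules) simp
  also have "\<dots> = T N - T 0" by (simp add: sum_lessThan_telescope)
  also have "\<dots> = 0"
    using L ten_long(1)[of N \<pi> 0 x] ten_long(3)[of L \<pi> "k * N"] by (simp add: T_def L_def del: seg_simps(2))
  finally show ?thesis using \<pi> 2 n by simp
qed

lemma res_diff_diff: "x \<in> res_mod Q N (Suc n) \<Longrightarrow> bd n (bd (Suc n) x) = 0"
  for x :: "('v, 'a, 'k::field) bimod"
  by (induction rule: res_mod_induct) (auto simp: res_diff_rules res_basis_def res_diff_diff_ten)


section \<open>Bimodule homomorphisms\<close>

lemma alg_basis_iff: "p \<in> alg_basis Q N \<longleftrightarrow> p \<in> paths \<and> plen p < N"
  by (auto simp: alg_basis_def dest: qpaths_plen)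

lemma pcat_paths: "p \<in> paths \<Longrightarrow> q \<in> paths \<Longrightarrow> ptgt Q p = psrc q \<Longrightarrow> pcat p q \<in> paths"
  using qpaths_pcat[OF fin_digraph_axioms, of p _ q] by blast

lemma scal_tens_free_on:
  "(plen \<alpha> < N \<Longrightarrow> plen \<beta> < N \<Longrightarrow> (\<alpha>, \<pi>, \<beta>) \<in> B) \<Longrightarrow> scal c (tens N \<alpha> \<pi> \<beta>) \<in> (free_on B :: ('v, 'a, 'k::field) bimod set)"
  by (auto simp: tens_def scal_simps free_on_simps)

lemma single_pcorner: "p \<in> qpaths Q n \<Longrightarrow> d \<le> n \<Longrightarrow> single p c \<in> pcorner d (psrc p) (ptgt Q p)"
  by (auto simp: pcorner_def intro!: free_on_simps)

lemma gen_corner: "\<pi> \<in> qpaths Q (res_len N n) \<Longrightarrow> gen \<pi> \<in> (corner n (psrc \<pi>) (ptgt Q \<pi>) :: ('v, 'a, 'k::field) bimod set)"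
  using qpaths_vert[OF fin_digraph_axioms, of \<pi>]
  by (auto simp: gen_def intro!: ten_corner pcorner_ev)

lemma act_res_mod:
  fixes x :: "('v, 'a, 'k::field) bimod"
  assumes "a \<in> free_on (alg_basis Q N)" "x \<in> res_mod Q N n"
  shows "lact Q N a x \<in> res_mod Q N n" "ract Q N x a \<in> res_mod Q N n"
proof -
  have "lact Q N a x \<in> res_mod Q N n \<and> ract Q N x a \<in> res_mod Q N n"
    using assms unfolding res_mod_def
  proof (induction rule: bilin_free_on_induct)
    case (single p c b c')
    obtain \<alpha> \<pi> \<beta> where b: "b = (\<alpha>, \<pi>, \<beta>)" by (cases b)
    have "p \<in> paths" "\<alpha> \<in> paths" "\<beta> \<in> paths" "ptgt Q \<alpha> = psrc \<pi>" "ptgt Q \<pi> = psrc \<beta>" "\<pi> \<in> qpaths Q (res_len N n)"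
      using single b by (auto simp: res_basis_def alg_basis_iff)
    with b pcat_paths[of p \<alpha>] pcat_paths[of \<beta> p] show ?case
      by (auto simp: act_single free_on_simps res_basis_def alg_basis_iff path_simps ptgt_pcat scal_simps intro!: scal_tens_free_on)
  qed (auto simp: lact_rules ract_rules free_on_simps)
  then show "lact Q N a x \<in> res_mod Q N n" "ract Q N x a \<in> res_mod Q N n" by auto
qed

lemma single_alg_basis: "(\<alpha>, \<pi>, \<beta>) \<in> res_basis Q N n \<Longrightarrow> single \<alpha> c \<in> free_on (alg_basis Q N)"
  "(\<alpha>, \<pi>, \<beta>) \<in> res_basis Q N n \<Longrightarrow> single \<beta> c \<in> free_on (alg_basis Q N)"
  by (auto simp: res_basis_def intro!: free_on_simps)

text \<open>
  The bimodule map with prescribed values \<open>c \<pi>\<close> on the generators \<open>1 \<otimes> \<pi> \<otimes> 1\<close>.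
\<close>

definition bext :: "(('v, 'a) qpath \<Rightarrow> ('v, 'a, 'k::field) bimod) \<Rightarrow> ('v, 'a, 'k) bimod \<Rightarrow> ('v, 'a, 'k) bimod" where
  "bext c = lin_ext (\<lambda>(\<alpha>, \<pi>, \<beta>). lact Q N (single \<alpha> 1) (ract Q N (c \<pi>) (single \<beta> 1)))"

lemma bext_rules:
  fixes x y :: "('v, 'a, 'k::field) bimod"
  shows "bext c (x + y) = bext c x + bext c y" "bext c 0 = 0"
    "bext c (scal d x) = scal d (bext c x)" "bext c (- x) = - bext c x"
    "bext c (x - y) = bext c x - bext c y" "bext c (sum g S) = (\<Sum>s\<in>S. bext c (g s))"
  by (simp_all add: bext_def lin_ext_add lin_ext_rules)

lemma act_long:
  fixes x :: "('v, 'a, 'k::field) bimod"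
  assumes "N \<le> plen p"
  shows "lact Q N (single p c) x = 0" "ract Q N x (single p c) = 0"
  using assms act_trunc(1)[of "single p c" x] act_trunc(2)[of x "single p c"]
  by (auto simp: trunc_eqs lact_rules ract_rules)

lemma bext_ten:
  fixes x y :: "('v, 'a, 'k::field) palg"
  assumes "c \<pi> \<in> corner n (psrc \<pi>) (ptgt Q \<pi>)"
  shows "bext c (ten x \<pi> y) = lact Q N x (ract Q N (c \<pi>) y)"
  using free_on_all[of x] free_on_all[of y]
proof (induction rule: bilin_free_on_induct)
  case (single p d q e)
  have "lact Q N (single p d) (ract Q N (c \<pi>) (single q e)) =
      scal (d * e) (lact Q N (single p 1) (ract Q N (c \<pi>) (single q 1)))"
    by (simp add: single_scal[of p d] single_scal[of q e] lact_rules ract_rules scal_simps mult.commute del: scal_simps(7))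
  moreover have "ptgt Q p \<noteq> psrc \<pi> \<Longrightarrow> lact Q N (single p d) (ract Q N (c \<pi>) (single q e)) = 0"
    using corner_act(3)[OF assms, of p d] by (simp add: lact_ract ract_rules)
  moreover have "psrc q \<noteq> ptgt Q \<pi> \<Longrightarrow> lact Q N (single p d) (ract Q N (c \<pi>) (single q e)) = 0"
    using corner_act(4)[OF assms, of q e] by (simp add: lact_rules)
  ultimately show ?case
    by (auto simp: ten_single bext_def lin_ext_rules lact_rules act_long not_less)
qed (auto simp: bext_rules ten_rules lact_rules ract_rules)

text \<open>
  Freeness of \<open>P\<^sub>m\<close>: the values on the generators may be chosen arbitrarily within the corners.
\<close>

lemma bext_hom:
  fixes c :: "('v, 'a) qpath \<Rightarrow> ('v, 'a, 'k::field) bimod"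
  assumes c: "\<And>\<pi>. \<pi> \<in> qpaths Q (res_len N m) \<Longrightarrow> c \<pi> \<in> corner n (psrc \<pi>) (ptgt Q \<pi>)"
  shows "bext c \<in> res_hom Q N m n"
proof -
  have lin: "bext c (lact Q N a x) = lact Q N a (bext c x) \<and> bext c (ract Q N x a) = ract Q N (bext c x) a"
    if "x \<in> res_mod Q N m" for a x using that
  proof (induction rule: res_mod_induct)
    case (ten \<alpha> \<pi> \<beta> d)
    then have "c \<pi> \<in> corner n (psrc \<pi>) (ptgt Q \<pi>)" using c[of \<pi>] by (auto simp: res_basis_def)
    from bext_ten[where c = c and \<pi> = \<pi>, OF this] show ?case
      by (simp add: lact_ten ract_ten lact_mult ract_mult lact_ract)
  qed (auto simp: bext_rules lact_rules ract_rules)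
  have "bext c x \<in> res_mod Q N n" if "x \<in> res_mod Q N m" for x using that
  proof (induction rule: res_mod_induct)
    case (ten \<alpha> \<pi> \<beta> d)
    then have c\<pi>: "c \<pi> \<in> corner n (psrc \<pi>) (ptgt Q \<pi>)" using c[of \<pi>] by (auto simp: res_basis_def)
    then have "c \<pi> \<in> res_mod Q N n" using corner_sub by blast
    then show ?case
      unfolding bext_ten[where c = c and \<pi> = \<pi>, OF c\<pi>] using ten single_alg_basis act_res_mod by blast
  qed (auto simp: bext_rules res_mod_def free_on_simps)
  then show ?thesis using lin by (auto simp: res_hom_def bext_rules)
qed

lemma ev_alg_basis: "v \<in> verts Q \<Longrightarrow> ev v \<in> (free_on (alg_basis Q N) :: ('v, 'a, 'k::field) palg set)"
  using vert_qpaths[OF fin_digraph_axioms, of v] N_pos by (force simp: alg_basis_def intro!: free_on_simps)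

text \<open>
  The idempotents \<open>e\<^sub>v\<close> and \<open>e\<^sub>w\<close> project onto the corner; since bimodule maps commute with them, they preserve
  corners.
\<close>

lemma corner_iff:
  fixes x :: "('v, 'a, 'k::field) bimod"
  assumes "x \<in> res_mod Q N n" "v \<in> verts Q" "w \<in> verts Q" "lact Q N (ev v) (ract Q N x (ev w)) = x"
  shows "x \<in> corner n v w"
proof -
  have "lact Q N (ev v) (ract Q N x (ev w)) \<in> corner n v w"
    using assms(1)
  proof (induction rule: res_mod_induct)
    case (ten \<alpha> \<pi> \<beta> c)
    have "lact Q N (ev v) (ract Q N (ten (single \<alpha> c) \<pi> (single \<beta> 1)) (ev w)) =
       (if v = psrc \<alpha> \<and> w = ptgt Q \<beta> then ten (single \<alpha> c) \<pi> (single \<beta> 1) else 0)"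
      by (simp add: lact_ten ract_ten kmul_simps path_simps ten_rules)
    then show ?case using ten by (auto simp: ten_single corner_def free_on_simps)
  qed (auto simp: lact_rules ract_rules corner_def free_on_simps)
  then show ?thesis using assms(4) by simp
qed

lemma vertex_verts: "\<pi> \<in> qpaths Q n \<Longrightarrow> psrc \<pi> \<in> verts Q" "\<pi> \<in> qpaths Q n \<Longrightarrow> ptgt Q \<pi> \<in> verts Q"
  using qpaths_vert[OF fin_digraph_axioms, of \<pi>] by auto

lemma res_homD:
  fixes \<phi> :: "('v, 'a, 'k::field) bimod \<Rightarrow> ('v, 'a, 'k) bimod"
  assumes "\<phi> \<in> res_hom Q N m n" "x \<in> res_mod Q N m"
  shows "\<phi> x \<in> res_mod Q N n" "y \<in> res_mod Q N m \<Longrightarrow> \<phi> (x + y) = \<phi> x + \<phi> y"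
    "\<phi> (scal c x) = scal c (\<phi> x)"
    "a \<in> free_on (alg_basis Q N) \<Longrightarrow> \<phi> (lact Q N a x) = lact Q N a (\<phi> x)"
    "a \<in> free_on (alg_basis Q N) \<Longrightarrow> \<phi> (ract Q N x a) = ract Q N (\<phi> x) a"
  using assms by (auto simp: res_hom_def)

lemma res_hom_0: "\<phi> \<in> res_hom Q N m n \<Longrightarrow> \<phi> 0 = 0"
  for \<phi> :: "('v, 'a, 'k::field) bimod \<Rightarrow> ('v, 'a, 'k) bimod"
  using res_homD(3)[of \<phi> m n 0 0] by (simp add: res_mod_def free_on_simps scal_simps)

lemma res_hom_corner:
  fixes \<phi> :: "('v, 'a, 'k::field) bimod \<Rightarrow> ('v, 'a, 'k) bimod"
  assumes \<phi>: "\<phi> \<in> res_hom Q N m n" and x: "x \<in> corner m v w" and vw: "v \<in> verts Q" "w \<in> verts Q"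
  shows "\<phi> x \<in> corner n v w"
proof (rule corner_iff[OF _ vw])
  have xm: "x \<in> res_mod Q N m" using x corner_sub by blast
  then show "\<phi> x \<in> res_mod Q N n" using res_homD(1)[OF \<phi>] by blast
  have "\<phi> (lact Q N (ev v) (ract Q N x (ev w))) = lact Q N (ev v) (ract Q N (\<phi> x) (ev w))"
    using res_homD(4)[OF \<phi> act_res_mod(2)[OF ev_alg_basis[OF vw(2)] xm] ev_alg_basis[OF vw(1)]]
      res_homD(5)[OF \<phi> xm ev_alg_basis[OF vw(2)]] by simp
  then show "lact Q N (ev v) (ract Q N (\<phi> x) (ev w)) = \<phi> x"
    by (simp add: corner_act[OF x])
qed

lemma gen_res_mod: "\<pi> \<in> qpaths Q (res_len N m) \<Longrightarrow> gen \<pi> \<in> (res_mod Q N m :: ('v, 'a, 'k::field) bimod set)"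
  using gen_corner corner_sub by blast

text \<open>\<open>P\<^sub>m\<close> is generated by the elements \<open>1 \<otimes> \<pi> \<otimes> 1\<close>.\<close>

lemma res_hom_bext:
  fixes \<phi> :: "('v, 'a, 'k::field) bimod \<Rightarrow> ('v, 'a, 'k) bimod"
  assumes \<phi>: "\<phi> \<in> res_hom Q N m n" and x: "x \<in> res_mod Q N m"
  shows "\<phi> x = bext (\<lambda>\<pi>. \<phi> (gen \<pi>)) x"
  using x
proof (induction rule: res_mod_induct)
  case zero
  then show ?case using res_hom_0[OF \<phi>] by (simp add: bext_rules)
next
  case (ten \<alpha> \<pi> \<beta> c)
  then have \<pi>: "\<pi> \<in> qpaths Q (res_len N m)" by (auto simp: res_basis_def)
  have "\<phi> (gen \<pi>) \<in> corner n (psrc \<pi>) (ptgt Q \<pi>)"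
    by (rule res_hom_corner[OF \<phi> gen_corner[OF \<pi>] vertex_verts[OF \<pi>]])
  then have "bext (\<lambda>\<pi>. \<phi> (gen \<pi>)) (ten (single \<alpha> c) \<pi> (single \<beta> 1)) =
    lact Q N (single \<alpha> c) (ract Q N (\<phi> (gen \<pi>)) (single \<beta> 1))"
    by (rule bext_ten[where c = "\<lambda>\<pi>. \<phi> (gen \<pi>)" and \<pi> = \<pi>])
  moreover have "\<phi> (lact Q N (single \<alpha> c) (ract Q N (gen \<pi>) (single \<beta> 1))) =
    lact Q N (single \<alpha> c) (ract Q N (\<phi> (gen \<pi>)) (single \<beta> 1))"
    using res_homD(4)[OF \<phi> act_res_mod(2)[OF single_alg_basis(2)[OF ten] gen_res_mod[OF \<pi>]] single_alg_basis(1)[OF ten]]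
      res_homD(5)[OF \<phi> gen_res_mod[OF \<pi>] single_alg_basis(2)[OF ten]] by simp
  ultimately show ?case by (simp add: ten_gen)
next
  case (add x y)
  then show ?case using res_homD(2)[OF \<phi>] by (simp add: bext_rules)
qed

lemma res_hom_eqI:
  fixes \<phi> :: "('v, 'a, 'k::field) bimod \<Rightarrow> ('v, 'a, 'k) bimod"
  assumes "\<phi> \<in> res_hom Q N m n" "\<psi> \<in> res_hom Q N m n" "x \<in> res_mod Q N m"
    "\<And>\<pi>. \<pi> \<in> qpaths Q (res_len N m) \<Longrightarrow> \<phi> (gen \<pi>) = \<psi> (gen \<pi>)"
  shows "\<phi> x = \<psi> x"
proof -
  have "bext (\<lambda>\<pi>. \<phi> (gen \<pi>)) x = bext (\<lambda>\<pi>. \<psi> (gen \<pi>)) x"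
    using assms(3)
  proof (induction rule: res_mod_induct)
    case (ten \<alpha> \<pi> \<beta> c)
    then have "\<phi> (gen \<pi>) = \<psi> (gen \<pi>)" using assms(4) by (auto simp: res_basis_def)
    then show ?case by (simp add: bext_def lin_ext_rules ten_single)
  qed (auto simp: bext_rules)
  then show ?thesis using res_hom_bext[OF assms(1,3)] res_hom_bext[OF assms(2,3)] by simp
qed

lemma res_hom_comp:
  "\<psi> \<in> res_hom Q N n p \<Longrightarrow> \<phi> \<in> res_hom Q N m n \<Longrightarrow> (\<lambda>x. \<psi> (\<phi> x) :: ('v, 'a, 'k::field) bimod) \<in> res_hom Q N m p"
  by (simp add: res_hom_def)

lemma res_hom_diff:
  fixes \<phi> :: "('v, 'a, 'k::field) bimod \<Rightarrow> ('v, 'a, 'k) bimod"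
  assumes "\<phi> \<in> res_hom Q N m n" "\<psi> \<in> res_hom Q N m n"
  shows "(\<lambda>x. \<phi> x - \<psi> x) \<in> res_hom Q N m n"
  using assms by (simp add: res_hom_def lact_rules ract_rules scal_rules) (simp add: res_mod_def free_on_rules)

lemma res_hom_add:
  fixes \<phi> :: "('v, 'a, 'k::field) bimod \<Rightarrow> ('v, 'a, 'k) bimod"
  assumes "\<phi> \<in> res_hom Q N m n" "\<psi> \<in> res_hom Q N m n"
  shows "(\<lambda>x. \<phi> x + \<psi> x) \<in> res_hom Q N m n"
  using assms by (simp add: res_hom_def lact_rules ract_rules scal_simps add_ac) (simp add: res_mod_def free_on_simps)

lemma res_diff_even_self:
  fixes x y :: "('v, 'a, 'k::field) palg"
  assumes "\<pi> \<in> qpaths Q (res_len N n)" "n = 2 * k + 2"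
  shows "bd n (ten x \<pi> y) =
    (\<Sum>j<N. ten (x \<star> E \<pi> 0 j) (seg Q \<pi> j (j + k * N + 1)) (E \<pi> (j + k * N + 1) (res_len N n) \<star> y))"
proof -
  have len: "res_len N n = 0 + k * N + N" by (simp only: assms res_len_simps)
  show ?thesis
    using res_diff_even[OF len, of \<pi> x y] qpaths_plen[OF assms(1)] seg_self[OF assms(1), symmetric] assms(2) by simp
qed

lemma res_diff_odd_self:
  fixes x y :: "('v, 'a, 'k::field) palg"
  assumes "\<pi> \<in> qpaths Q (res_len N n)" "n = 2 * k + 1"
  shows "bd n (ten x \<pi> y) = ten (x \<star> E \<pi> 0 1) (seg Q \<pi> 1 (res_len N n)) y -
      ten x (seg Q \<pi> 0 (k * N)) (E \<pi> (k * N) (res_len N n) \<star> y)"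
proof -
  have len: "res_len N n = 0 + k * N + 1" by (simp only: assms res_len_simps)
  show ?thesis
    using res_diff_odd[OF len, of \<pi> x y] qpaths_plen[OF assms(1)] seg_self[OF assms(1), symmetric] assms(2) by simp
qed

lemma res_index_cases:
  obtains "(n::nat) = 0" | k where "n = 2 * k + 1" | k where "n = 2 * k + 2"
proof -
  have "n = 0 \<or> (\<exists>k. n = 2 * k + 1) \<or> (\<exists>k. n = 2 * k + 2)" by presburger
  then show ?thesis using that by blast
qed

lemma res_diff_act_ten:
  fixes x y a :: "('v, 'a, 'k::field) palg"
  assumes "\<pi> \<in> qpaths Q (res_len N n)"
  shows "bd n (ten (a \<star> x) \<pi> y) = lact Q N a (bd n (ten x \<pi> y))"
    "bd n (ten x \<pi> (y \<star> a)) = ract Q N (bd n (ten x \<pi> y)) a"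
proof -
  have "bd n (ten (a \<star> x) \<pi> y) = lact Q N a (bd n (ten x \<pi> y)) \<and>
    bd n (ten x \<pi> (y \<star> a)) = ract Q N (bd n (ten x \<pi> y)) a"
  proof (cases n rule: res_index_cases)
    case 1
    then show ?thesis by (simp add: res_diff_0 lact_rules ract_rules)
  next
    case (2 k)
    show ?thesis
      by (simp add: res_diff_odd_self[OF assms 2] lact_rules ract_rules lact_ten ract_ten mult_assoc)
  next
    case (3 k)
    show ?thesis
      by (simp add: res_diff_even_self[OF assms 3] lact_rules ract_rules lact_ten ract_ten mult_assoc)
  qed
  then show "bd n (ten (a \<star> x) \<pi> y) = lact Q N a (bd n (ten x \<pi> y))"
    "bd n (ten x \<pi> (y \<star> a)) = ract Q N (bd n (ten x \<pi> y)) a" by auto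
qed

lemma seg_paths: "w \<in> qpaths Q L \<Longrightarrow> i \<le> j \<Longrightarrow> j \<le> L \<Longrightarrow> m = j - i \<Longrightarrow> seg Q w i j \<in> qpaths Q m"
  using seg_in_qpaths[OF fin_digraph_axioms] by blast

lemma ten_seg_corner:
  fixes x y :: "('v, 'a, 'k::field) palg"
  assumes "w \<in> qpaths Q L" "i \<le> j" "j \<le> L" "res_len N n = j - i"
    "x \<in> pcorner d u (vx Q w i)" "y \<in> pcorner e (vx Q w j) v"
  shows "ten x (seg Q w i j) y \<in> corner n u v"
  using assms qpaths_plen[OF assms(1)]
  by (intro ten_corner) (auto simp: seg_simps ptgt_seg intro: seg_paths)

lemma corner_0: "0 \<in> (corner n v w :: ('v, 'a, 'k::field) bimod set)"
  and corner_add: "x \<in> corner n v w \<Longrightarrow> y \<in> corner n v w \<Longrightarrow> x + y \<in> (corner n v w :: ('v, 'a, 'k) bimod set)"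
  and corner_diff: "x \<in> corner n v w \<Longrightarrow> y \<in> corner n v w \<Longrightarrow> x - y \<in> (corner n v w :: ('v, 'a, 'k) bimod set)"
  and corner_sum: "(\<And>s. s \<in> S \<Longrightarrow> f s \<in> corner n v w) \<Longrightarrow> sum f S \<in> (corner n v w :: ('v, 'a, 'k) bimod set)"
  by (auto simp: corner_def free_on_simps free_on_rules)

lemma pcorner_E_0:
  assumes "w \<in> qpaths Q L" "i \<le> j" "j \<le> L"
  shows "E w i j \<in> (pcorner 0 (vx Q w i) (vx Q w j) :: ('v, 'a, 'k::field) palg set)"
  using pcorner_E[OF assms, of 0] by simp

lemma pcorner_mult_0: "x \<in> pcorner 0 u v \<Longrightarrow> y \<in> pcorner 0 v w \<Longrightarrow> x \<star> y \<in> (pcorner 0 u w :: ('v, 'a, 'k::field) palg set)"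
  using pcorner_mult[of x 0 u v y 0 w] by simp

lemma res_diff_corner:
  fixes x y :: "('v, 'a, 'k::field) palg"
  assumes \<pi>: "\<pi> \<in> qpaths Q (res_len N (Suc n))" and x: "x \<in> pcorner 0 u (psrc \<pi>)" and y: "y \<in> pcorner 0 (ptgt Q \<pi>) v"
  shows "bd (Suc n) (ten x \<pi> y) \<in> corner n u v"
proof -
  note \<pi>' = seg_self[OF \<pi>, symmetric] qpaths_plen[OF \<pi>]
  have x': "x \<in> pcorner 0 u (vx Q \<pi> 0)" and y': "y \<in> pcorner 0 (vx Q \<pi> (res_len N (Suc n))) v"
    using x y \<pi>' vx_plen[of Q \<pi>] by (simp_all add: vx_0)
  show ?thesis
  proof (cases n rule: parity_cases)
    case (1 k)
    then have n: "Suc n = 2 * k + 1" by simp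
    then have len: "res_len N (Suc n) = 0 + k * N + 1" by (simp only: res_len_simps)
    have "bd (Suc n) (ten x \<pi> y) =
        ten (x \<star> E \<pi> 0 1) (seg Q \<pi> 1 (res_len N (Suc n))) y - ten x (seg Q \<pi> 0 (k * N)) (E \<pi> (k * N) (res_len N (Suc n)) \<star> y)"
      by (rule res_diff_odd_self[OF \<pi> n])
    also have "\<dots> \<in> corner n u v"
      using x' y' len 1 \<pi>
      by (intro corner_diff ten_seg_corner[OF \<pi>, where d = 0 and e = 0] pcorner_mult_0[OF x'] pcorner_mult_0[OF _ y'] pcorner_E_0[OF \<pi>])
        (auto simp: res_len_simps)
    finally show ?thesis .
  next
    case (2 k)
    then have n: "Suc n = 2 * k + 2" by simp
    then have len: "res_len N (Suc n) = 0 + k * N + N" by (simp only: res_len_simps)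
    have "bd (Suc n) (ten x \<pi> y) =
        (\<Sum>j<N. ten (x \<star> E \<pi> 0 j) (seg Q \<pi> j (j + k * N + 1)) (E \<pi> (j + k * N + 1) (res_len N (Suc n)) \<star> y))"
      by (rule res_diff_even_self[OF \<pi> n])
    also have "\<dots> \<in> corner n u v"
      using x' y' len 2 \<pi>
      by (intro corner_sum ten_seg_corner[OF \<pi>, where d = 0 and e = 0] pcorner_mult_0[OF x'] pcorner_mult_0[OF _ y'] pcorner_E_0[OF \<pi>])
        (auto simp: res_len_simps)
    finally show ?thesis .
  qed
qed

lemma res_diff_hom: "bd (Suc n) \<in> (res_hom Q N (Suc n) n :: (('v, 'a, 'k::field) bimod \<Rightarrow> _) set)"
proof -
  have lin: "bd (Suc n) (lact Q N a x) = lact Q N a (bd (Suc n) x) \<and>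
      bd (Suc n) (ract Q N x a) = ract Q N (bd (Suc n) x) a"
    if "x \<in> res_mod Q N (Suc n)" for a and x :: "('v, 'a, 'k) bimod" using that
  proof (induction rule: res_mod_induct)
    case (ten \<alpha> \<pi> \<beta> d)
    then have "\<pi> \<in> qpaths Q (res_len N (Suc n))" by (auto simp: res_basis_def)
    from res_diff_act_ten[OF this, where ?'k = 'k] show ?case
      by (simp add: lact_ten ract_ten)
  qed (auto simp: res_diff_rules lact_rules ract_rules)
  have "bd (Suc n) x \<in> res_mod Q N n" if "x \<in> res_mod Q N (Suc n)" for x :: "('v, 'a, 'k) bimod" using that
  proof (induction rule: res_mod_induct)
    case (ten \<alpha> \<pi> \<beta> d)
    then obtain i j where "\<alpha> \<in> qpaths Q i" "\<beta> \<in> qpaths Q j" "\<pi> \<in> qpaths Q (res_len N (Suc n))"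
      "ptgt Q \<alpha> = psrc \<pi>" "psrc \<beta> = ptgt Q \<pi>"
      by (auto simp: res_basis_def alg_basis_def)
    then have "bd (Suc n) (ten (single \<alpha> d) \<pi> (single \<beta> 1)) \<in> corner n (psrc \<alpha>) (ptgt Q \<beta>)"
      using single_pcorner[of \<alpha> i 0 d] single_pcorner[of \<beta> j 0 1] by (intro res_diff_corner) auto
    then show ?case using corner_sub by blast
  qed (auto simp: res_diff_rules res_mod_def free_on_simps)
  then show ?thesis using lin by (auto simp: res_hom_def res_diff_rules)
qed

section \<open>Cochains as bimodule homomorphisms\<close>

lemma lookup_coch_val: "lookup (coch_val f \<pi>) \<alpha> = lookup f (\<alpha>, \<pi>)"
  for f :: "('v, 'a, 'k::field) cochain"
  using free_on_all[of f]
  by (induction rule: free_on_induct)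
    (auto simp: coch_val_def lin_ext_add lookup_add lookup_single when_def split: prod.splits)

lemma coch_val_rules:
  fixes f g :: "('v, 'a, 'k::field) cochain"
  shows "coch_val (f + g) \<pi> = coch_val f \<pi> + coch_val g \<pi>" "coch_val 0 \<pi> = (0 :: ('v, 'a, 'k) palg)"
    "coch_val (f - g) \<pi> = coch_val f \<pi> - coch_val g \<pi>" "coch_val (- f) \<pi> = - coch_val f \<pi>"
  by (simp_all add: coch_val_def lin_ext_add lin_ext_rules)

lemma cochains_keys:
  fixes f :: "('v, 'a, 'k::field) cochain"
  assumes "f \<in> cochains Q N n" "lookup f (\<alpha>, \<pi>) \<noteq> 0"
  shows "plen \<alpha> < N" "\<alpha> \<in> qpaths Q (plen \<alpha>)" "\<pi> \<in> qpaths Q (res_len N n)"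
    "psrc \<alpha> = psrc \<pi>" "ptgt Q \<alpha> = ptgt Q \<pi>"
proof -
  have "(\<alpha>, \<pi>) \<in> (\<Union>i<N. coch_basis Q N n i)"
    using assms by (auto simp: cochains_def free_on_def in_keys_iff)
  then obtain i where "(\<alpha>, \<pi>) \<in> coch_basis Q N n i" by blast
  then have "i < N \<and> \<alpha> \<in> qpaths Q i \<and> \<pi> \<in> qpaths Q (res_len N n) \<and> psrc \<alpha> = psrc \<pi> \<and> ptgt Q \<alpha> = ptgt Q \<pi>"
    by (simp add: coch_basis_def)
  then show "plen \<alpha> < N" "\<alpha> \<in> qpaths Q (plen \<alpha>)" "\<pi> \<in> qpaths Q (res_len N n)"
    "psrc \<alpha> = psrc \<pi>" "ptgt Q \<alpha> = ptgt Q \<pi>" using qpaths_plen[of \<alpha> Q i] by simp_all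
qed

lemma coch_val_corner:
  fixes f :: "('v, 'a, 'k::field) cochain"
  assumes f: "f \<in> cochains Q N n"
  shows "coch_val f \<pi> \<in> pcorner 0 (psrc \<pi>) (ptgt Q \<pi>)" "trunc N (coch_val f \<pi>) = coch_val f \<pi>"
proof -
  show "coch_val f \<pi> \<in> pcorner 0 (psrc \<pi>) (ptgt Q \<pi>)"
    using cochains_keys[OF f, of _ \<pi>] by (fastforce simp: pcorner_def free_on_def in_keys_iff lookup_coch_val)
  show "trunc N (coch_val f \<pi>) = coch_val f \<pi>"
    using cochains_keys[OF f, of _ \<pi>]
    by (intro poly_mapping_eqI) (auto simp: lookup_trunc[OF fin_digraph_axioms] lookup_coch_val)
qed

lemma cochain_eqI:
  fixes f g :: "('v, 'a, 'k::field) cochain"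
  assumes "f \<in> cochains Q N n" "g \<in> cochains Q N n"
    "\<And>\<pi>. \<pi> \<in> qpaths Q (res_len N n) \<Longrightarrow> coch_val f \<pi> = coch_val g \<pi>"
  shows "f = g"
proof (rule poly_mapping_eqI)
  fix b :: "('v, 'a) qpath \<times> ('v, 'a) qpath"
  obtain \<alpha> \<pi> where b: "b = (\<alpha>, \<pi>)" by (cases b)
  show "lookup f b = lookup g b"
  proof (cases "\<pi> \<in> qpaths Q (res_len N n)")
    case True
    then show ?thesis using assms(3)[OF True] lookup_coch_val[of f \<pi> \<alpha>] lookup_coch_val[of g \<pi> \<alpha>] b by simp
  next
    case False
    then have "lookup f (\<alpha>, \<pi>) = 0" "lookup g (\<alpha>, \<pi>) = 0"
      using cochains_keys(3)[OF assms(1), of \<alpha> \<pi>] cochains_keys(3)[OF assms(2), of \<alpha> \<pi>] by blast+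
    then show ?thesis using b by simp
  qed
qed

lemma hom_of_rules:
  fixes x y :: "('v, 'a, 'k::field) bimod"
  shows "hom_of Q N f (x + y) = hom_of Q N f x + hom_of Q N f y" "hom_of Q N f 0 = 0"
    "hom_of Q N f (scal c x) = scal c (hom_of Q N f x)" "hom_of Q N f (- x) = - hom_of Q N f x"
    "hom_of Q N f (x - y) = hom_of Q N f x - hom_of Q N f y"
    "hom_of Q N f (sum g S) = (\<Sum>s\<in>S. hom_of Q N f (g s))"
  by (simp_all add: hom_of_def lin_ext_add lin_ext_rules)

lemma trunc_mult_long:
  fixes x y :: "('v, 'a, 'k::field) palg"
  shows "trunc N x = 0 \<Longrightarrow> trunc N (x \<star> y) = 0" "trunc N y = 0 \<Longrightarrow> trunc N (x \<star> y) = 0"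
  using trunc_mult(1)[of x y] trunc_mult(2)[of x y] by (simp_all add: kmul_rules trunc_eqs)

text \<open>
  Holds for all elements of the path algebra because the value at \<open>\<pi>\<close> starts and ends where \<open>\<pi>\<close> does, so
  that non-composable factors annihilate both sides.
\<close>

lemma hom_of_ten:
  fixes x y :: "('v, 'a, 'k::field) palg"
  assumes f: "f \<in> cochains Q N n"
  shows "hom_of Q N f (ten x \<pi> y) = trunc N (x \<star> (coch_val f \<pi> \<star> y))"
  using free_on_all[of x] free_on_all[of y]
proof (induction rule: bilin_free_on_induct)
  case (single p c q d)
  let ?p = "single p c" and ?q = "single q d" and ?v = "coch_val f \<pi>"
  note v = pcorner_ev_mult[OF coch_val_corner(1)[OF f]]
  consider "ptgt Q p \<noteq> psrc \<pi>" | "psrc q \<noteq> ptgt Q \<pi>" | "N \<le> plen p" | "N \<le> plen q"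
    | "ptgt Q p = psrc \<pi>" "ptgt Q \<pi> = psrc q" "plen p < N" "plen q < N" by force
  then show ?case
  proof cases
    case 1
    then have "?p \<star> (ev (psrc \<pi>) \<star> ?v) = 0"
      by (simp only: mult_assoc[symmetric]) (simp add: kmul_simps path_simps kmul_rules)
    then have "?p \<star> ?v = 0" by (simp add: v)
    then show ?thesis using 1 by (simp add: ten_single hom_of_rules mult_assoc[symmetric] kmul_rules trunc_eqs)
  next
    case 2
    then have "?v \<star> ev (ptgt Q \<pi>) \<star> ?q = 0"
      by (simp only: mult_assoc) (simp add: kmul_simps path_simps kmul_rules)
    then have "?v \<star> ?q = 0" by (simp add: v)
    then show ?thesis using 2 by (auto simp add: ten_single hom_of_rules kmul_rules trunc_eqs)
  next
    case 3
    then show ?thesis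
      using trunc_mult_long(1)[of ?p "?v \<star> ?q"] by (simp add: ten_single hom_of_rules trunc_eqs)
  next
    case 4
    then show ?thesis
      using trunc_mult_long(2)[of ?q "?p \<star> ?v"] by (simp add: ten_single hom_of_rules trunc_eqs mult_assoc)
  next
    case 5
    have "?p \<star> (?v \<star> ?q) = scal (c * d) (single p 1 \<star> (?v \<star> single q 1))"
      by (simp add: single_scal[of p c] single_scal[of q d] kmul_rules scal_simps mult.commute del: scal_simps(7))
    then show ?thesis
      using 5 by (simp add: ten_single hom_of_def amul_def trunc_mult mult_assoc trunc_rules)
  qed
qed (auto simp: hom_of_rules ten_rules kmul_rules trunc_eqs)

text \<open>
  The bimodule maps \<open>P\<^sub>n \<rightarrow> A\<close>. They are identified with cochains through
  \<open>hom_of\<close> and \<open>coch_of\<close> in \<open>hom_of_coch_of\<close> and \<open>coch_of_eq_iff\<close>.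
\<close>

definition alg_hom :: "nat \<Rightarrow> (('v, 'a, 'k::field) bimod \<Rightarrow> ('v, 'a, 'k) palg) set" where
  "alg_hom n = {F. (\<forall>x\<in>res_mod Q N n. F x \<in> free_on (alg_basis Q N)) \<and>
     (\<forall>x\<in>res_mod Q N n. \<forall>y\<in>res_mod Q N n. F (x + y) = F x + F y) \<and>
     (\<forall>a\<in>free_on (alg_basis Q N). \<forall>x\<in>res_mod Q N n.
        F (lact Q N a x) = amul Q N a (F x) \<and> F (ract Q N x a) = amul Q N (F x) a)}"

lemma free_on_alg_basis_paths: "free_on (alg_basis Q N) \<subseteq> (free_on (paths_ge Q 0) :: ('v, 'a, 'k::field) palg set)"
  by (rule alg_basis_sub[OF fin_digraph_axioms])

lemma pcorner_paths: "pcorner 0 v w \<subseteq> (free_on (paths_ge Q 0) :: ('v, 'a, 'k::field) palg set)"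
  unfolding pcorner_def by (intro free_on_mono) auto

lemma amul_closed:
  "x \<in> free_on (paths_ge Q 0) \<Longrightarrow> y \<in> free_on (paths_ge Q 0) \<Longrightarrow> amul Q N x y \<in> (free_on (alg_basis Q N) :: ('v, 'a, 'k::field) palg set)"
  using kmul_closed[OF fin_digraph_axioms, of x 0 y 0] trunc_closed[OF fin_digraph_axioms, of "x \<star> y" N]
  by (simp add: amul_def)

lemma hom_of_alg_hom:
  fixes f :: "('v, 'a, 'k::field) cochain"
  assumes f: "f \<in> cochains Q N n"
  shows "hom_of Q N f \<in> alg_hom n"
proof -
  have lin: "hom_of Q N f (lact Q N a x) = amul Q N a (hom_of Q N f x) \<and> hom_of Q N f (ract Q N x a) = amul Q N (hom_of Q N f x) a"
    if "x \<in> res_mod Q N n" for a x using that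
    by (induction rule: res_mod_induct)
      (auto simp: hom_of_rules lact_rules ract_rules lact_ten ract_ten hom_of_ten[OF f] amul_def trunc_mult mult_assoc
        kmul_rules trunc_eqs)
  have "hom_of Q N f x \<in> free_on (alg_basis Q N)" if "x \<in> res_mod Q N n" for x using that
  proof (induction rule: res_mod_induct)
    case (ten \<alpha> \<pi> \<beta> c)
    have "single \<alpha> c \<in> free_on (paths_ge Q 0)" "single \<beta> (1::'k) \<in> free_on (paths_ge Q 0)"
      using single_alg_basis[OF ten] free_on_alg_basis_paths by blast+
    moreover have "coch_val f \<pi> \<star> single \<beta> 1 \<in> free_on (paths_ge Q 0)"
      using kmul_closed[OF fin_digraph_axioms, of _ 0 _ 0] calculation coch_val_corner(1)[OF f, of \<pi>] pcorner_paths
      by fastforce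
    ultimately show ?case
      using amul_closed by (simp add: hom_of_ten[OF f] amul_def)
  qed (auto simp: hom_of_rules free_on_simps)
  then show ?thesis using lin by (auto simp: alg_hom_def hom_of_rules)
qed

lemma alg_homD:
  fixes F :: "('v, 'a, 'k::field) bimod \<Rightarrow> ('v, 'a, 'k) palg"
  assumes "F \<in> alg_hom n" "x \<in> res_mod Q N n"
  shows "F x \<in> free_on (alg_basis Q N)" "y \<in> res_mod Q N n \<Longrightarrow> F (x + y) = F x + F y"
    "a \<in> free_on (alg_basis Q N) \<Longrightarrow> F (lact Q N a x) = amul Q N a (F x)"
    "a \<in> free_on (alg_basis Q N) \<Longrightarrow> F (ract Q N x a) = amul Q N (F x) a"
  using assms by (auto simp: alg_hom_def)

lemma alg_hom_comp:
  "F \<in> alg_hom n \<Longrightarrow> \<phi> \<in> res_hom Q N m n \<Longrightarrow> F \<circ> \<phi> \<in> (alg_hom m :: (('v, 'a, 'k::field) bimod \<Rightarrow> _) set)"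
  by (simp add: res_hom_def alg_hom_def)

text \<open>
  Again by the idempotents: the value at a generator lies in \<open>e\<^sub>v A e\<^sub>w\<close>, that is, it is a combination of
  paths parallel to \<open>\<pi>\<close>, which is what makes \<open>coch_of\<close> lose no information.
\<close>

lemma alg_hom_gen:
  fixes F :: "('v, 'a, 'k::field) bimod \<Rightarrow> ('v, 'a, 'k) palg"
  assumes F: "F \<in> alg_hom n" and \<pi>: "\<pi> \<in> qpaths Q (res_len N n)"
  shows "F (gen \<pi>) \<in> pcorner 0 (psrc \<pi>) (ptgt Q \<pi>)" "trunc N (F (gen \<pi>)) = F (gen \<pi>)"
proof -
  note g = gen_res_mod[OF \<pi>] and e = ev_alg_basis[OF vertex_verts(1)[OF \<pi>]] ev_alg_basis[OF vertex_verts(2)[OF \<pi>]]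
  have Fg: "F (gen \<pi>) \<in> free_on (alg_basis Q N)" by (rule alg_homD(1)[OF F g])
  then show "trunc N (F (gen \<pi>)) = F (gen \<pi>)" by (rule trunc_id[OF fin_digraph_axioms])
  have "F (gen \<pi>) = F (lact Q N (ev (psrc \<pi>)) (ract Q N (gen \<pi>) (ev (ptgt Q \<pi>))))"
    by (simp add: corner_act[OF gen_corner[OF \<pi>]])
  also have "\<dots> = trunc N (ev (psrc \<pi>) \<star> (F (gen \<pi>) \<star> ev (ptgt Q \<pi>)))"
    by (simp add: alg_homD(3)[OF F act_res_mod(2)[OF e(2) g] e(1)] alg_homD(4)[OF F g e(2)] amul_def trunc_mult)
  finally have eq: "F (gen \<pi>) = trunc N (ev (psrc \<pi>) \<star> (F (gen \<pi>) \<star> ev (ptgt Q \<pi>)))" .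
  have "trunc N (ev v \<star> (z \<star> ev w)) \<in> pcorner 0 v w" if "z \<in> free_on (alg_basis Q N)" for v w and z :: "('v, 'a, 'k) palg"
    using that
  proof (induction rule: free_on_induct)
    case (single p c)
    have "trunc N (ev v \<star> (single p c \<star> ev w)) =
       (if v = psrc p \<and> w = ptgt Q p \<and> plen p < N then single p c else 0)"
      by (auto simp: kmul_simps path_simps kmul_rules trunc_eqs)
    then show ?case using single by (auto simp: pcorner_def alg_basis_iff intro!: free_on_simps)
  qed (auto simp: kmul_rules trunc_eqs pcorner_def free_on_simps)
  from this[OF Fg] show "F (gen \<pi>) \<in> pcorner 0 (psrc \<pi>) (ptgt Q \<pi>)" using eq by metis
qed

lemma finite_coch_basis: "finite (\<Union>i<N. coch_basis Q N n i)"
proof (rule finite_subset)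
  show "(\<Union>i<N. coch_basis Q N n i) \<subseteq> (\<Union>i<N. qpaths Q i) \<times> qpaths Q (res_len N n)"
    by (auto simp: coch_basis_def)
qed (auto intro!: finite_cartesian_product finite_qpaths[OF fin_digraph_axioms])

lemma lookup_coch_of:
  fixes F :: "('v, 'a, 'k::field) bimod \<Rightarrow> ('v, 'a, 'k) palg"
  shows "lookup (coch_of Q N n F) (\<alpha>, \<pi>) =
    (if (\<alpha>, \<pi>) \<in> (\<Union>i<N. coch_basis Q N n i) then lookup (F (gen \<pi>)) \<alpha> else 0)"
proof -
  have "lookup (coch_of Q N n F) (\<alpha>, \<pi>) =
     (\<Sum>b\<in>(\<Union>i<N. coch_basis Q N n i). if b = (\<alpha>, \<pi>) then lookup (F (gen \<pi>)) \<alpha> else 0)"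
    unfolding coch_of_def lookup_sum gen_eq
    by (intro sum.cong) (auto simp: lookup_single when_def split: prod.splits if_splits)
  also have "\<dots> = (if (\<alpha>, \<pi>) \<in> (\<Union>i<N. coch_basis Q N n i) then lookup (F (gen \<pi>)) \<alpha> else 0)"
    using finite_coch_basis[of n] by (subst sum.delta) auto
  finally show ?thesis .
qed

lemma coch_of_cochains: "coch_of Q N n F \<in> (cochains Q N n :: ('v, 'a, 'k::field) cochain set)"
proof -
  have "lookup (coch_of Q N n F) b = 0" if "b \<notin> (\<Union>i<N. coch_basis Q N n i)" for b
    using that lookup_coch_of[of n F "fst b" "snd b"] by simp
  then show ?thesis unfolding cochains_def free_on_def by (metis (no_types, lifting) in_keys_iff mem_Collect_eq subsetI)
qed

lemma coch_val_coch_of: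
  fixes F :: "('v, 'a, 'k::field) bimod \<Rightarrow> ('v, 'a, 'k) palg"
  assumes F: "F \<in> alg_hom n" and \<pi>: "\<pi> \<in> qpaths Q (res_len N n)"
  shows "coch_val (coch_of Q N n F) \<pi> = F (gen \<pi>)"
proof (rule poly_mapping_eqI)
  fix \<alpha> :: "('v, 'a) qpath"
  have "lookup (F (gen \<pi>)) \<alpha> = 0" if "(\<alpha>, \<pi>) \<notin> (\<Union>i<N. coch_basis Q N n i)"
  proof (rule ccontr)
    assume nz: "lookup (F (gen \<pi>)) \<alpha> \<noteq> 0"
    then have "\<alpha> \<in> keys (F (gen \<pi>))" by (simp add: in_keys_iff)
    then obtain m where "\<alpha> \<in> qpaths Q m" "psrc \<alpha> = psrc \<pi>" "ptgt Q \<alpha> = ptgt Q \<pi>"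
      using alg_hom_gen(1)[OF F \<pi>] by (auto simp: pcorner_def free_on_def)
    moreover have "plen \<alpha> < N"
      using nz lookup_trunc[OF fin_digraph_axioms, of N "F (gen \<pi>)" \<alpha>] alg_hom_gen(2)[OF F \<pi>] by (auto split: if_splits)
    ultimately show False using that \<pi> by (auto simp: coch_basis_def dest: qpaths_plen)
  qed
  then show "lookup (coch_val (coch_of Q N n F) \<pi>) \<alpha> = lookup (F (gen \<pi>)) \<alpha>"
    by (simp add: lookup_coch_val lookup_coch_of)
qed

lemma alg_hom_0: "F \<in> alg_hom n \<Longrightarrow> F 0 = 0"
  for F :: "('v, 'a, 'k::field) bimod \<Rightarrow> ('v, 'a, 'k) palg"
  using alg_homD(2)[of F n 0 0] by (simp add: res_mod_def free_on_simps)

lemma alg_hom_ten: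
  fixes F :: "('v, 'a, 'k::field) bimod \<Rightarrow> ('v, 'a, 'k) palg"
  assumes F: "F \<in> alg_hom n" and b: "(\<alpha>, \<pi>, \<beta>) \<in> res_basis Q N n"
  shows "F (ten (single \<alpha> c) \<pi> (single \<beta> d)) =
    trunc N (single \<alpha> c \<star> (F (gen \<pi>) \<star> single \<beta> d))"
proof -
  have \<pi>: "\<pi> \<in> qpaths Q (res_len N n)" using b by (auto simp: res_basis_def)
  note g = gen_res_mod[OF \<pi>]
  show ?thesis
    using alg_homD(3)[OF F act_res_mod(2)[OF single_alg_basis(2)[OF b] g] single_alg_basis(1)[OF b], of c d]
      alg_homD(4)[OF F g single_alg_basis(2)[OF b], of d]
    by (simp add: ten_gen[of _ \<pi>] amul_def trunc_mult)
qed

lemma alg_hom_eqI: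
  fixes F G :: "('v, 'a, 'k::field) bimod \<Rightarrow> ('v, 'a, 'k) palg"
  assumes F: "F \<in> alg_hom n" and G: "G \<in> alg_hom n" and x: "x \<in> res_mod Q N n"
    and eq: "\<And>\<pi>. \<pi> \<in> qpaths Q (res_len N n) \<Longrightarrow> F (gen \<pi>) = G (gen \<pi>)"
  shows "F x = G x"
  using x
proof (induction rule: res_mod_induct)
  case zero
  then show ?case by (simp add: alg_hom_0[OF F] alg_hom_0[OF G])
next
  case (ten \<alpha> \<pi> \<beta> c)
  then have "\<pi> \<in> qpaths Q (res_len N n)" by (auto simp: res_basis_def)
  then show ?case by (simp add: alg_hom_ten[OF F ten] alg_hom_ten[OF G ten] eq)
next
  case (add x y)
  then show ?case by (simp add: alg_homD(2)[OF F] alg_homD(2)[OF G])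
qed

lemma hom_of_gen:
  "f \<in> cochains Q N n \<Longrightarrow> hom_of Q N f (gen \<pi>) = (coch_val f \<pi> :: ('v, 'a, 'k::field) palg)"
  using pcorner_ev_mult[OF coch_val_corner(1)[of f n \<pi>]] coch_val_corner(2)[of f n \<pi>]
  by (simp add: gen_def hom_of_ten)

lemma hom_of_coch_of:
  fixes F :: "('v, 'a, 'k::field) bimod \<Rightarrow> ('v, 'a, 'k) palg"
  assumes F: "F \<in> alg_hom n" and x: "x \<in> res_mod Q N n"
  shows "hom_of Q N (coch_of Q N n F) x = F x"
  by (rule alg_hom_eqI[OF hom_of_alg_hom[OF coch_of_cochains] F x])
    (simp add: hom_of_gen[OF coch_of_cochains] coch_val_coch_of[OF F])

lemma coch_of_eq_iff:
  fixes F :: "('v, 'a, 'k::field) bimod \<Rightarrow> ('v, 'a, 'k) palg"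
  assumes F: "F \<in> alg_hom n" and f: "f \<in> cochains Q N n"
  shows "coch_of Q N n F = f \<longleftrightarrow> (\<forall>\<pi>\<in>qpaths Q (res_len N n). F (gen \<pi>) = coch_val f \<pi>)"
  using cochain_eqI[OF coch_of_cochains f, of F] coch_val_coch_of[OF F] by auto

section \<open>The cochain complex\<close>

lemma hom_of_diff: "f \<in> cochains Q N n \<Longrightarrow> hom_of Q N f \<circ> bd (Suc n) \<in> (alg_hom (Suc n) :: (('v, 'a, 'k::field) bimod \<Rightarrow> _) set)"
  by (intro alg_hom_comp[OF _ res_diff_hom] hom_of_alg_hom)

lemma coch_diff_cochains: "coch_diff Q N n f \<in> (cochains Q N (Suc n) :: ('v, 'a, 'k::field) cochain set)"
  by (simp add: coch_diff_def coch_of_cochains)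

lemma hom_of_coch_diff:
  "f \<in> cochains Q N n \<Longrightarrow> x \<in> res_mod Q N (Suc n) \<Longrightarrow> hom_of Q N (coch_diff Q N n f) x = hom_of Q N f (bd (Suc n) x)"
  for x :: "('v, 'a, 'k::field) bimod"
  using hom_of_coch_of[OF hom_of_diff] by (simp add: coch_diff_def)

lemma coch_val_coch_diff:
  "f \<in> cochains Q N n \<Longrightarrow> \<pi> \<in> qpaths Q (res_len N (Suc n)) \<Longrightarrow>
    coch_val (coch_diff Q N n f) \<pi> = (hom_of Q N f (bd (Suc n) (gen \<pi>)) :: ('v, 'a, 'k::field) palg)"
  using coch_val_coch_of[OF hom_of_diff] by (simp add: coch_diff_def)

lemma cochains_0: "0 \<in> (cochains Q N n :: ('v, 'a, 'k::field) cochain set)"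
  and cochains_add: "f \<in> cochains Q N n \<Longrightarrow> g \<in> cochains Q N n \<Longrightarrow> f + g \<in> (cochains Q N n :: ('v, 'a, 'k) cochain set)"
  and cochains_diff: "f \<in> cochains Q N n \<Longrightarrow> g \<in> cochains Q N n \<Longrightarrow> f - g \<in> (cochains Q N n :: ('v, 'a, 'k) cochain set)"
  by (auto simp: cochains_def free_on_simps free_on_rules free_on_uminus)

lemma hom_of_fun_add: "hom_of Q N (f + g) x = hom_of Q N f x + hom_of Q N g x"
  for x :: "('v, 'a, 'k::field) bimod"
  unfolding hom_of_def lin_ext_fun_add[symmetric]
  by (intro arg_cong2[where f = lin_ext] ext) (auto simp: coch_val_rules amul_def kmul_rules trunc_eqs split: prod.splits)

lemma hom_of_fun_0: "hom_of Q N 0 x = 0"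
  for x :: "('v, 'a, 'k::field) bimod"
  using hom_of_fun_add[of 0 0 x] by simp

lemma coch_diff_add:
  fixes f g :: "('v, 'a, 'k::field) cochain"
  assumes "f \<in> cochains Q N n" "g \<in> cochains Q N n"
  shows "coch_diff Q N n (f + g) = coch_diff Q N n f + coch_diff Q N n g"
  using assms
  by (intro cochain_eqI[of _ "Suc n"] cochains_add coch_diff_cochains)
    (simp add: coch_val_coch_diff cochains_add coch_val_rules hom_of_fun_add)

lemma coch_diff_0: "coch_diff Q N n 0 = (0 :: ('v, 'a, 'k::field) cochain)"
  using coch_diff_add[of 0 n 0] cochains_0 by fastforce

lemma coch_diff_diff:
  fixes f g :: "('v, 'a, 'k::field) cochain"
  assumes "f \<in> cochains Q N n" "g \<in> cochains Q N n"
  shows "coch_diff Q N n (f - g) = coch_diff Q N n f - coch_diff Q N n g"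
  using coch_diff_add[of "f - g" n g] assms cochains_diff by fastforce

lemma cocycle_iff:
  fixes f :: "('v, 'a, 'k::field) cochain"
  assumes f: "f \<in> cochains Q N n"
  shows "f \<in> cocycles Q N n \<longleftrightarrow> (\<forall>\<pi>\<in>qpaths Q (res_len N (Suc n)). hom_of Q N f (bd (Suc n) (gen \<pi>)) = 0)"
  using cochain_eqI[OF coch_diff_cochains cochains_0, of n f] coch_val_coch_diff[OF f] f
  by (auto simp: cocycles_def coch_val_rules)

lemma cocycleD:
  fixes x :: "('v, 'a, 'k::field) bimod"
  assumes "f \<in> cocycles Q N n" "x \<in> res_mod Q N (Suc n)"
  shows "hom_of Q N f (bd (Suc n) x) = 0"
proof -
  have "hom_of Q N f (bd (Suc n) x) = hom_of Q N (coch_diff Q N n f) x"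
    using assms hom_of_coch_diff[of f n x] by (simp add: cocycles_def)
  then show ?thesis using assms by (simp add: cocycles_def hom_of_fun_0)
qed

section \<open>Exactness of the resolution\<close>

text \<open>
  The contracting homotopy of right modules. In even degrees it undoes the two-term differential by
  summing over all bar positions to the left of the given one; in odd degrees only left
  factors of the maximal length \<open>N - 1\<close> contribute, and they are absorbed into the middle, which thereby
  gets the next even length.
\<close>

definition contr_even :: "('v, 'a, 'k::field) bimod \<Rightarrow> ('v, 'a, 'k) bimod" where
  "contr_even = lin_ext (\<lambda>(\<alpha>, \<pi>, \<beta>). \<Sum>p<plen \<alpha>. cut (pcat \<alpha> \<pi>) p (p + plen \<pi> + 1)
     (E (pcat \<alpha> \<pi>) (p + plen \<pi> + 1) (plen \<alpha> + plen \<pi>) \<star> single \<beta> 1))"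

definition contr_odd :: "('v, 'a, 'k::field) bimod \<Rightarrow> ('v, 'a, 'k) bimod" where
  "contr_odd = lin_ext (\<lambda>(\<alpha>, \<pi>, \<beta>).
     if plen \<alpha> = N - 1 then ten (ev (psrc \<alpha>)) (pcat \<alpha> \<pi>) (single \<beta> 1) else 0)"

lemma contr_rules:
  fixes x y :: "('v, 'a, 'k::field) bimod"
  shows "contr_even (x + y) = contr_even x + contr_even y" "contr_even 0 = (0 :: ('v, 'a, 'k) bimod)"
    "contr_even (x - y) = contr_even x - contr_even y" "contr_even (- x) = - contr_even x" "contr_even (sum g S) = (\<Sum>s\<in>S. contr_even (g s))"
    "contr_odd (x + y) = contr_odd x + contr_odd y" "contr_odd 0 = (0 :: ('v, 'a, 'k) bimod)"
    "contr_odd (x - y) = contr_odd x - contr_odd y" "contr_odd (sum g S) = (\<Sum>s\<in>S. contr_odd (g s))"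
  by (simp_all add: contr_even_def contr_odd_def lin_ext_add lin_ext_rules)

lemma E_single_zero: "j \<le> plen w \<Longrightarrow> i \<le> j \<Longrightarrow> psrc \<beta> \<noteq> vx Q w j \<Longrightarrow> E w i j \<star> single \<beta> c = (0 :: ('v, 'a, 'k::field) palg)"
  by (auto simp: kmul_simps ptgt_seg)

lemma ten_long_right: "N \<le> plen \<beta> \<Longrightarrow> ten x \<pi> (y \<star> single \<beta> c) = 0"
  for x y :: "('v, 'a, 'k::field) palg"
proof -
  assume "N \<le> plen \<beta>"
  then have "trunc N (y \<star> single \<beta> c) = trunc N 0"
    using trunc_mult_long(2)[of "single \<beta> c" y] by (simp add: trunc_eqs)
  from ten_trunc_cong(2)[OF this] show ?thesis by (simp add: ten_rules)
qed

text \<open>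
  The condition \<open>r < N\<close> matters: for \<open>r \<ge> N\<close> the left side is zero while the sum need not be.
\<close>

lemma contr_even_seg:
  fixes y :: "('v, 'a, 'k::field) palg"
  assumes r: "r \<le> b" "b \<le> plen w" "r < N" and l: "l = b - r"
  shows "contr_even (cut w r b y) =
    (\<Sum>p<r. cut w p (p + l + 1) (E w (p + l + 1) b \<star> y))"
  using free_on_all[of y]
proof (induction rule: free_on_induct)
  case (single \<beta> c)
  have len: "plen (seg Q w 0 r) = r" "plen (seg Q w r b) = l" using assms by (simp_all add: seg_simps)
  consider "psrc \<beta> \<noteq> vx Q w b" | "N \<le> plen \<beta>" | "psrc \<beta> = vx Q w b" "plen \<beta> < N" by force
  then show ?case
  proof cases
    case 1
    then show ?thesis using assms
      by (auto simp: ten_single seg_simps ptgt_seg contr_rules E_single_zero ten_rules intro!: sum.neutral[symmetric])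
  next
    case 2
    then show ?thesis
      by (auto simp: ten_single contr_rules ten_long_right)
  next
    case 3
    have cat: "pcat (seg Q w 0 r) (seg Q w r b) = seg Q w 0 b" using assms by (simp add: pcat_seg)
    have sc: "single \<beta> c = scal c (single \<beta> 1)" by (rule single_scal)
    have "contr_even (cut w r b (single \<beta> c)) =
      scal c (\<Sum>p<r. ten (E (seg Q w 0 b) 0 p) (seg Q (seg Q w 0 b) p (p + l + 1))
        (E (seg Q w 0 b) (p + l + 1) (r + l) \<star> single \<beta> 1))"
      using 3 assms len by (simp add: ten_single contr_even_def cat len ptgt_seg seg_simps(1))
    also have "\<dots> = (\<Sum>p<r. cut w p (p + l + 1) (E w (p + l + 1) b \<star> single \<beta> c))"
      unfolding sc using r l by (simp add: kmul_rules ten_rules scal_sum seg_seg)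
    finally show ?thesis .
  qed
qed (auto simp: contr_rules ten_rules kmul_rules sum.distrib)

lemma contr_odd_seg:
  fixes y :: "('v, 'a, 'k::field) palg"
  assumes r: "r \<le> b" "b \<le> plen w"
  shows "contr_odd (cut w r b y) = (if r = N - 1 then cut w 0 b y else 0)"
  using free_on_all[of y]
proof (induction rule: free_on_induct)
  case (single \<beta> c)
  have len: "plen (seg Q w 0 r) = r" using assms by (simp add: seg_simps)
  have cat: "pcat (seg Q w 0 r) (seg Q w r b) = seg Q w 0 b" using assms by (simp add: pcat_seg)
  show ?case
    using assms N_pos len
    by (auto simp: ten_single contr_odd_def lin_ext_rules pcat_seg ptgt_seg seg_simps(1) ten_rules scal_simps path_simps E_refl)
qed (auto simp: contr_rules ten_rules)

text \<open>Replaces a triple \<open>\<alpha> \<otimes> \<pi> \<otimes> \<beta>\<close> by the path \<open>\<alpha>\<pi>\<close> with two bars. The induction rules below pass this view on.\<close>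

lemma res_basis_cut:
  assumes "(\<alpha>, \<pi>, \<beta>) \<in> res_basis Q N n"
  obtains w r where "w \<in> qpaths Q (r + res_len N n)" "r < N" "vx Q w 0 = psrc \<alpha>" "psrc \<beta> = vx Q w (r + res_len N n)"
    "\<And>c. ten (single \<alpha> c) \<pi> (single \<beta> 1) =
      (cut w r (r + res_len N n) (single \<beta> c) :: ('v, 'a, 'k::field) bimod)"
proof -
  obtain m where \<alpha>: "\<alpha> \<in> qpaths Q m" "m < N" "ptgt Q \<alpha> = psrc \<pi>" and \<pi>: "\<pi> \<in> qpaths Q (res_len N n)" "ptgt Q \<pi> = psrc \<beta>"
    using assms by (auto simp: res_basis_def alg_basis_def)
  note len = qpaths_plen[OF \<alpha>(1)] qpaths_plen[OF \<pi>(1)]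
  have w: "pcat \<alpha> \<pi> \<in> qpaths Q (m + res_len N n)" by (rule qpaths_pcat[OF fin_digraph_axioms \<alpha>(1) \<pi>(1) \<alpha>(3)])
  have s: "seg Q (pcat \<alpha> \<pi>) 0 m = \<alpha>" "seg Q (pcat \<alpha> \<pi>) m (m + res_len N n) = \<pi>"
    using seg_pcat[OF \<alpha>(3)] len by simp_all
  show ?thesis
  proof (rule that[OF w \<alpha>(2)])
    show "vx Q (pcat \<alpha> \<pi>) 0 = psrc \<alpha>" by (simp add: vx_0 path_simps)
    show "psrc \<beta> = vx Q (pcat \<alpha> \<pi>) (m + res_len N n)"
      using vx_plen[of Q "pcat \<alpha> \<pi>"] qpaths_plen[OF w] ptgt_pcat[OF \<alpha>(3)] \<pi>(2) by simp
    show "ten (single \<alpha> c) \<pi> (single \<beta> 1) =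
      (cut (pcat \<alpha> \<pi>) m (m + res_len N n) (single \<beta> c) :: ('v, 'a, 'k) bimod)" for c
      by (simp add: s ten_single)
  qed
qed

lemma res_mod_cut_induct [consumes 1, case_names zero cut add]:
  fixes x :: "('v, 'a, 'k::field) bimod"
  assumes "x \<in> res_mod Q N n" "P 0"
    "\<And>w r \<beta> c. w \<in> qpaths Q (r + res_len N n) \<Longrightarrow> r < N \<Longrightarrow> psrc \<beta> = vx Q w (r + res_len N n) \<Longrightarrow>
       P (cut w r (r + res_len N n) (single \<beta> c))"
    "\<And>x y. P x \<Longrightarrow> P y \<Longrightarrow> P (x + y)"
  shows "P x"
  using assms(1)
proof (induction rule: res_mod_induct)
  case (ten \<alpha> \<pi> \<beta> c)
  from res_basis_cut[OF ten, where ?'k = 'k] show ?case using assms(3) by metis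
qed (use assms in auto)

lemma corner_cut_induct [consumes 1, case_names zero cut add]:
  fixes x :: "('v, 'a, 'k::field) bimod"
  assumes "x \<in> corner n u v" "P 0"
    "\<And>w r y. w \<in> qpaths Q (r + res_len N n) \<Longrightarrow> r < N \<Longrightarrow> vx Q w 0 = u \<Longrightarrow>
       y \<in> pcorner 0 (vx Q w (r + res_len N n)) v \<Longrightarrow> P (cut w r (r + res_len N n) y)"
    "\<And>x y. P x \<Longrightarrow> P y \<Longrightarrow> P (x + y)"
  shows "P x"
  using assms(1) unfolding corner_def
proof (induction rule: free_on_induct)
  case (single b c)
  obtain \<alpha> \<pi> \<beta> where b: "b = (\<alpha>, \<pi>, \<beta>)" by (cases b)
  with single have bas: "(\<alpha>, \<pi>, \<beta>) \<in> res_basis Q N n" and uv: "psrc \<alpha> = u" "ptgt Q \<beta> = v" by auto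
  obtain m where m: "\<beta> \<in> qpaths Q m" using bas by (auto simp: res_basis_def alg_basis_def)
  have s: "single b c = ten (single \<alpha> c) \<pi> (single \<beta> 1)"
    using bas b by (auto simp: ten_single res_basis_def alg_basis_iff)
  from res_basis_cut[OF bas, where ?'k = 'k] obtain w r where
    w: "w \<in> qpaths Q (r + res_len N n)" "r < N" "vx Q w 0 = psrc \<alpha>" "psrc \<beta> = vx Q w (r + res_len N n)"
    and eq: "\<And>c. ten (single \<alpha> c) \<pi> (single \<beta> 1) = (cut w r (r + res_len N n) (single \<beta> c) :: ('v, 'a, 'k) bimod)" by metis
  show ?case
    unfolding s eq using w uv single_pcorner[OF m, of 0 c] by (intro assms(3)) simp_all
qed (use assms in auto)

text \<open>
  The sum telescopes; the second term on the right is the position in which the left factor is empty.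
\<close>

lemma diff_contr_even:
  fixes y :: "('v, 'a, 'k::field) palg"
  assumes r: "r < N" and b: "b = r + k * N" "b \<le> plen w"
  shows "bd (2 * k + 1) (contr_even (cut w r b y)) =
    cut w r b y - cut w 0 (k * N) (E w (k * N) b \<star> y)"
proof -
  define T where "T p = cut w p (p + k * N) (E w (p + k * N) b \<star> y)" for p
  have "bd (2 * k + 1) (cut w p (p + k * N + 1) (E w (p + k * N + 1) b \<star> y)) = T (Suc p) - T p"
    if "p < r" for p
    using that b by (subst res_diff_odd) (auto simp: T_def E_mult)
  then have "bd (2 * k + 1) (contr_even (cut w r b y)) = (\<Sum>p<r. T (Suc p) - T p)"
    using r b by (subst contr_even_seg[where l = "k * N"]) (auto simp: res_diff_rules)
  also have "\<dots> = T r - T 0" by (simp add: sum_lessThan_telescope)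
  also have "T r = cut w r b y"
    using b by (simp only: T_def) (rule ten_E_refl, auto)
  finally show ?thesis by (simp add: T_def)
qed

text \<open>
  Of the \<open>N\<close> terms of the differential exactly one has its left bar at position \<open>N - 1\<close>, and it produces the
  term that is left over in \<open>diff_contr_even\<close>.
\<close>

lemma contr_odd_diff:
  fixes y :: "('v, 'a, 'k::field) palg"
  assumes r: "r < N" and b: "b = r + (k * N + N)" "b \<le> plen w"
  shows "contr_odd (bd (2 * k + 2) (cut w r b y)) =
    cut w 0 (k * N + N) (E w (k * N + N) b \<star> y)"
proof -
  have "contr_odd (bd (2 * k + 2) (cut w r b y)) =
     (\<Sum>j<N. contr_odd (cut w (r + j) (r + j + k * N + 1) (E w (r + j + k * N + 1) b \<star> y)))"
    using b by (subst res_diff_even) (auto simp: contr_rules E_mult)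
  also have "\<dots> = (\<Sum>j<N. if j = N - 1 - r then cut w 0 (k * N + N) (E w (k * N + N) b \<star> y) else 0)"
  proof (rule sum.cong)
    fix j assume "j \<in> {..<N}"
    then have j: "r + j + k * N + 1 \<le> plen w" "j < N" using b by auto
    then have "contr_odd (cut w (r + j) (r + j + k * N + 1) (E w (r + j + k * N + 1) b \<star> y)) =
      (if r + j = N - 1 then cut w 0 (r + j + k * N + 1) (E w (r + j + k * N + 1) b \<star> y) else 0)"
      by (subst contr_odd_seg) auto
    moreover have "r + j = N - 1 \<longleftrightarrow> j = N - 1 - r" using r j by auto
    moreover have "r + j + k * N + 1 = k * N + N" if "j = N - 1 - r" using r that by auto
    ultimately show "contr_odd (cut w (r + j) (r + j + k * N + 1) (E w (r + j + k * N + 1) b \<star> y)) =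
      (if j = N - 1 - r then cut w 0 (k * N + N) (E w (k * N + N) b \<star> y) else 0)"
      by (auto simp: add.commute simp del: seg_simps(2))
  qed simp
  also have "\<dots> = cut w 0 (k * N + N) (E w (k * N + N) b \<star> y)"
    using r by (subst sum.delta) auto
  finally show ?thesis .
qed

text \<open>
  If the left factor can still absorb an arrow, the even homotopy applied to the two terms of the
  differential leaves a single summand. If it is full, one of the two terms vanishes and the
  differential of the odd homotopy supplies the missing sum.
\<close>

lemma contr_odd_homotopy:
  fixes y :: "('v, 'a, 'k::field) palg"
  assumes r: "r < N" and b: "b = r + (k * N + 1)" "b \<le> plen w"
  shows "bd (2 * k + 2) (contr_odd (cut w r b y)) +
    contr_even (bd (2 * k + 1) (cut w r b y)) = cut w r b y"
proof -
  define V where "V p = cut w p (p + k * N + 1) (E w (p + k * N + 1) b \<star> y)" for p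
  have Vr: "V r = cut w r b y"
    using b ten_E_refl(2)[of r b w _ y] by (simp add: V_def)
  have d: "bd (2 * k + 1) (cut w r b y) =
     cut w (r + 1) b y - cut w r (r + k * N) (E w (r + k * N) b \<star> y)"
    using b by (subst res_diff_odd) (auto simp: E_mult)
  have low: "contr_even (cut w r (r + k * N) (E w (r + k * N) b \<star> y)) = (\<Sum>p<r. V p)"
    using r b by (subst contr_even_seg[where l = "k * N"]) (auto simp: V_def E_mult intro!: sum.cong)
  show ?thesis
  proof (cases "r = N - 1")
    case True
    have "contr_odd (cut w r b y) = cut w 0 b y"
      using b True by (subst contr_odd_seg) auto
    also have "bd (2 * k + 2) \<dots> = (\<Sum>j<N. V j)"
      using b True N_pos by (subst res_diff_even) (auto simp: V_def E_mult intro!: sum.cong simp del: seg_simps(2))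
    also have "\<dots> = (\<Sum>j<r. V j) + V r"
      using True N_pos sum.lessThan_Suc[of V r] by simp
    finally have "bd (2 * k + 2) (contr_odd (cut w r b y)) = (\<Sum>j<r. V j) + V r" .
    moreover have "cut w (r + 1) b y = 0"
      using True b N_pos by (intro ten_long(2)) auto
    ultimately show ?thesis using d low Vr by (simp add: contr_rules)
  next
    case False
    have "contr_odd (cut w r b y) = 0"
      using b False by (subst contr_odd_seg) auto
    moreover have "contr_even (cut w (r + 1) b y) = (\<Sum>p<r + 1. V p)"
      using b False r by (subst contr_even_seg[where l = "k * N"]) (auto simp: V_def simp del: sum.lessThan_Suc)
    ultimately show ?thesis using d low Vr by (simp add: contr_rules res_diff_rules)
  qed
qed

lemma contr_even_corner:
  fixes x :: "('v, 'a, 'k::field) bimod"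
  assumes "x \<in> corner (2 * k) u v" shows "contr_even x \<in> corner (2 * k + 1) u v"
  using assms
proof (induction rule: corner_cut_induct)
  case (cut w r y)
  note y = cut(4)[unfolded res_len_simps]
  have "contr_even (cut w r (r + res_len N (2 * k)) y) =
    (\<Sum>p<r. cut w p (p + k * N + 1) (E w (p + k * N + 1) (r + k * N) \<star> y))"
    using cut qpaths_plen[OF cut(1)] by (subst contr_even_seg[where l = "k * N"]) (auto simp: res_len_simps)
  also have "\<dots> \<in> corner (2 * k + 1) u v"
    using cut y
    by (intro corner_sum ten_seg_corner[OF cut(1), where d = 0 and e = 0] pcorner_mult_0[OF _ y] pcorner_E_0[OF cut(1)])
      (auto simp: res_len_simps intro: pcorner_E_0)
  finally show ?case .
qed (auto simp: contr_rules corner_0 corner_add)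

lemma contr_odd_corner:
  fixes x :: "('v, 'a, 'k::field) bimod"
  assumes "x \<in> corner (2 * k + 1) u v" shows "contr_odd x \<in> corner (2 * k + 2) u v"
  using assms
proof (induction rule: corner_cut_induct)
  case (cut w r y)
  have "contr_odd (cut w r (r + res_len N (2 * k + 1)) y) =
    (if r = N - 1 then cut w 0 (r + res_len N (2 * k + 1)) y else 0)"
    using cut qpaths_plen[OF cut(1)] by (simp add: contr_odd_seg)
  also have "\<dots> \<in> corner (2 * k + 2) u v"
  proof (cases "r = N - 1")
    case True
    have "cut w 0 (r + res_len N (2 * k + 1)) y \<in> corner (2 * k + 2) u v"
    proof (rule ten_seg_corner[OF cut(1) _ _ _ _ cut(4)])
      show "res_len N (2 * k + 2) = r + res_len N (2 * k + 1) - 0"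
        using True N_pos by (simp only: res_len_simps)
      show "E w 0 0 \<in> (pcorner 0 u (vx Q w 0) :: ('v, 'a, 'k) palg set)"
        using pcorner_E_0[OF cut(1), of 0 0] cut(3) by simp
    qed auto
    then show ?thesis using True by simp
  qed (simp add: corner_0)
  finally show ?case .
qed (auto simp: contr_rules corner_0 corner_add)

lemma res_aug_rules:
  fixes x y :: "('v, 'a, 'k::field) bimod"
  shows "res_aug Q N (x + y) = res_aug Q N x + res_aug Q N y" "res_aug Q N 0 = (0 :: ('v, 'a, 'k) palg)"
    "res_aug Q N (x - y) = res_aug Q N x - res_aug Q N y"
  by (simp_all add: res_aug_def lin_ext_add lin_ext_rules)

lemma res_aug_ten:
  fixes x y :: "('v, 'a, 'k::field) palg"
  shows "res_aug Q N (ten x (v, []) y) = trunc N (x \<star> (ev v \<star> y))"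
  using free_on_all[of x] free_on_all[of y]
proof (induction rule: bilin_free_on_induct)
  case (single p c q d)
  show ?case
    by (auto simp: ten_single res_aug_def lin_ext_rules amul_def kmul_simps path_simps kmul_rules trunc_eqs scal_simps not_less)
qed (auto simp: res_aug_rules ten_rules kmul_rules trunc_eqs)

lemma qpaths_0: "\<pi> \<in> qpaths Q 0 \<longleftrightarrow> (\<exists>v\<in>verts Q. \<pi> = (v, []))"
proof
  assume "\<pi> \<in> qpaths Q 0"
  then show "\<exists>v\<in>verts Q. \<pi> = (v, [])"
    using vertex_verts(1)[of \<pi> 0] by (auto simp: qpaths_def plen_def psrc_def intro!: bexI[of _ "fst \<pi>"] prod_eqI)
qed (auto intro: vert_qpaths[OF fin_digraph_axioms])

lemma res_aug_alg_hom: "res_aug Q N \<in> (alg_hom 0 :: (('v, 'a, 'k::field) bimod \<Rightarrow> _) set)"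
proof -
  have lin: "res_aug Q N (lact Q N a x) = amul Q N a (res_aug Q N x) \<and> res_aug Q N (ract Q N x a) = amul Q N (res_aug Q N x) a"
    if "x \<in> res_mod Q N 0" for a and x :: "('v, 'a, 'k) bimod" using that
  proof (induction rule: res_mod_induct)
    case (ten \<alpha> \<pi> \<beta> c)
    then obtain v where "\<pi> = (v, [])" by (auto simp: res_basis_def qpaths_0 res_len_simps)
    then show ?case by (simp add: lact_ten ract_ten res_aug_ten amul_def trunc_mult mult_assoc)
  qed (auto simp: res_aug_rules lact_rules ract_rules amul_def kmul_rules trunc_eqs)
  have "res_aug Q N x \<in> free_on (alg_basis Q N)" if "x \<in> res_mod Q N 0" for x :: "('v, 'a, 'k) bimod" using that
  proof (induction rule: res_mod_induct)
    case (ten \<alpha> \<pi> \<beta> c)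
    have "single \<alpha> c \<in> free_on (paths_ge Q 0)" "single \<beta> (1::'k) \<in> free_on (paths_ge Q 0)"
      using single_alg_basis[OF ten] free_on_alg_basis_paths by blast+
    moreover obtain v where v: "\<pi> = (v, [])" "ptgt Q \<alpha> = v" "psrc \<beta> = v"
      using ten by (auto simp: res_basis_def qpaths_0 res_len_simps path_simps)
    moreover have "ev v \<star> single \<beta> 1 = single \<beta> (1::'k)"
      using v path_simps(8)[of \<beta>] by (simp add: kmul_simps path_simps)
    ultimately show ?case using amul_closed by (simp add: res_aug_ten amul_def)
  qed (auto simp: res_aug_rules free_on_simps)
  then show ?thesis using lin by (auto simp: alg_hom_def res_aug_rules)
qed

text \<open>
  The right module map \<open>p \<mapsto> 1 \<otimes> 1 \<otimes> p\<close>, a section of the augmentation.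
\<close>

definition aug_section :: "('v, 'a, 'k::field) palg \<Rightarrow> ('v, 'a, 'k) bimod" where
  "aug_section = lin_ext (\<lambda>p. ten (ev (psrc p)) (psrc p, []) (single p 1))"

lemma aug_section_single:
  "aug_section (trunc N (single p c)) = (ten (ev (psrc p)) (psrc p, []) (single p c) :: ('v, 'a, 'k::field) bimod)"
proof (cases "plen p < N")
  case True
  then show ?thesis by (simp add: trunc_eqs aug_section_def ten_rules(10)[symmetric] scal_simps)
next
  case False
  have "pcat (psrc p, []) p = p" by (simp add: path_simps)
  then show ?thesis
    using False ten_long_right[of p "ev (psrc p)" "(psrc p, [])" "ev (psrc p)" c]
    by (simp add: trunc_eqs aug_section_def kmul_simps path_simps)
qed

lemma contr_aug:
  fixes x :: "('v, 'a, 'k::field) bimod"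
  assumes "x \<in> res_mod Q N 0"
  shows "bd 1 (contr_even x) = x - aug_section (res_aug Q N x)"
  using assms
proof (induction rule: res_mod_cut_induct)
  case w: (cut w r \<beta> c)
  have len: "plen w = r" using qpaths_plen[OF w(1)] by (simp add: res_len_simps)
  have t: "vx Q w r = psrc \<beta>" using w by (simp add: res_len_simps)
  have b: "pcat (psrc \<beta>, []) \<beta> = \<beta>" by (simp add: path_simps)
  have \<beta>: "E w 0 r \<star> single \<beta> c = single (pcat (seg Q w 0 r) \<beta>) c"
    using len t by (simp add: kmul_simps ptgt_seg)
  have "bd (2 * 0 + 1) (contr_even (cut w r r (single \<beta> c))) =
    cut w r r (single \<beta> c) - cut w 0 (0 * N) (E w (0 * N) r \<star> single \<beta> c)"
    using w len by (intro diff_contr_even) auto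
  moreover have "aug_section (res_aug Q N (cut w r r (single \<beta> c))) =
    ten (ev (vx Q w 0)) (vx Q w 0, []) (E w 0 r \<star> single \<beta> c)"
    using len t
    by (simp add: seg_simps(2) res_aug_ten kmul_simps path_simps b ptgt_seg aug_section_single)
      (simp add: seg_simps)
  ultimately show ?case
    by (simp add: res_len_simps E_refl) (simp add: seg_simps)
qed (auto simp: contr_rules res_diff_rules res_aug_rules aug_section_def lin_ext_add)

lemma contr_pos:
  fixes x :: "('v, 'a, 'k::field) bimod"
  assumes "x \<in> res_mod Q N (Suc n)" "bd (Suc n) x = 0"
  shows "Suc n = 2 * k + 1 \<Longrightarrow> bd (Suc (Suc n)) (contr_odd x) = x"
    "Suc n = 2 * k + 2 \<Longrightarrow> bd (Suc (Suc n)) (contr_even x) = x"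
proof -
  assume n: "Suc n = 2 * k + 1"
  then have n': "Suc (Suc n) = 2 * k + 2" by simp
  from assms(1) have "bd (2 * k + 2) (contr_odd x) + contr_even (bd (2 * k + 1) x) = x"
    unfolding n
  proof (induction rule: res_mod_cut_induct)
    case w: (cut w r \<beta> c)
    show ?case using w qpaths_plen[OF w(1)]
      by (intro contr_odd_homotopy) (auto simp: res_len_simps)
  qed (auto simp: contr_rules res_diff_rules algebra_simps)
  then show "bd (Suc (Suc n)) (contr_odd x) = x"
    using assms(2) unfolding n n' by (simp add: contr_rules)
next
  assume n: "Suc n = 2 * k + 2"
  then have n': "Suc (Suc n) = 2 * (k + 1) + 1" by simp
  have kN: "(k + 1) * N = k * N + N" by simp
  from assms(1) have "bd (2 * (k + 1) + 1) (contr_even x) + contr_odd (bd (2 * k + 2) x) = x"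
    unfolding n
  proof (induction rule: res_mod_cut_induct)
    case w: (cut w r \<beta> c)
    have b: "r + res_len N (2 * k + 2) = r + (k + 1) * N" "r + res_len N (2 * k + 2) = r + (k * N + N)"
      "r + res_len N (2 * k + 2) \<le> plen w"
      using qpaths_plen[OF w(1)] unfolding kN by (simp_all only: res_len_simps)
    show ?case unfolding diff_contr_even[OF w(2) b(1,3)] contr_odd_diff[OF w(2) b(2,3)] kN by simp
  qed (auto simp: contr_rules res_diff_rules algebra_simps)
  then show "bd (Suc (Suc n)) (contr_even x) = x"
    using assms(2) unfolding n n' by (simp add: contr_rules)
qed

text \<open>
  The homotopy respects sources and ends, so a cycle in a corner is the boundary of an
  element of the same corner. This is the form of exactness that lifting bimodule maps requires.
\<close>

lemma exact_aug:
  fixes x :: "('v, 'a, 'k::field) bimod"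
  assumes "x \<in> corner 0 u v" "res_aug Q N x = 0"
  shows "\<exists>y\<in>corner 1 u v. bd 1 y = x"
proof -
  have "bd 1 (contr_even x) = x"
    using assms corner_sub[of 0 u v] contr_aug[of x] by (auto simp: aug_section_def)
  then show ?thesis using contr_even_corner[of x 0 u v] assms by (intro bexI[of _ "contr_even x"]) simp_all
qed

lemma exact_pos:
  fixes x :: "('v, 'a, 'k::field) bimod"
  assumes "x \<in> corner (Suc n) u v" "bd (Suc n) x = 0"
  shows "\<exists>y\<in>corner (Suc (Suc n)) u v. bd (Suc (Suc n)) y = x"
proof (cases "Suc n" rule: res_index_cases)
  case (2 k)
  then have n: "Suc (Suc n) = 2 * k + 2" by simp
  have "contr_odd x \<in> corner (Suc (Suc n)) u v"
    unfolding n by (rule contr_odd_corner) (use assms(1)[unfolded 2] in simp)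
  moreover have "bd (Suc (Suc n)) (contr_odd x) = x"
    using contr_pos(1)[OF _ assms(2) 2] corner_sub assms(1) by blast
  ultimately show ?thesis by blast
next
  case (3 k)
  then have n: "Suc (Suc n) = 2 * (k + 1) + 1" "Suc n = 2 * (k + 1)" by simp_all
  have "contr_even x \<in> corner (Suc (Suc n)) u v"
    unfolding n(1) by (rule contr_even_corner) (use assms(1)[unfolded n(2)] in simp)
  moreover have "bd (Suc (Suc n)) (contr_even x) = x"
    using contr_pos(2)[OF _ assms(2) 3] corner_sub assms(1) by blast
  ultimately show ?thesis by blast
qed simp

section \<open>Comparison of lifts\<close>

lemma bext_gen:
  fixes c :: "('v, 'a) qpath \<Rightarrow> ('v, 'a, 'k::field) bimod"
  assumes "c \<pi> \<in> corner n (psrc \<pi>) (ptgt Q \<pi>)"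
  shows "bext c (gen \<pi>) = c \<pi>"
  using bext_ten[where c = c and \<pi> = \<pi>, OF assms] corner_act(1,2)[OF assms] by (simp add: gen_def)

text \<open>Projectivity: preimages of the generators extend to a bimodule map.\<close>

lemma lift_through:
  fixes G :: "('v, 'a, 'k::field) bimod \<Rightarrow> ('v, 'a, 'k) bimod"
  assumes G: "G \<in> res_hom Q N m n"
    and ex: "\<And>\<pi>. \<pi> \<in> qpaths Q (res_len N m) \<Longrightarrow>
      \<exists>y\<in>corner (Suc n) (psrc \<pi>) (ptgt Q \<pi>). bd (Suc n) y = G (gen \<pi>)"
  shows "\<exists>t\<in>res_hom Q N m (Suc n). \<forall>x\<in>res_mod Q N m. bd (Suc n) (t x) = G x"
proof -
  obtain c where c: "c \<pi> \<in> corner (Suc n) (psrc \<pi>) (ptgt Q \<pi>)" "bd (Suc n) (c \<pi>) = G (gen \<pi>)"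
    if "\<pi> \<in> qpaths Q (res_len N m)" for \<pi>
    using ex by metis
  have t: "bext c \<in> res_hom Q N m (Suc n)" using c(1) by (rule bext_hom)
  have "bd (Suc n) (bext c x) = G x" if "x \<in> res_mod Q N m" for x
    by (rule res_hom_eqI[OF res_hom_comp[OF res_diff_hom t] G that])
      (simp add: bext_gen[where c = c, OF c(1)] c(2))
  then show ?thesis using t by blast
qed

lemma lift_through_aug:
  fixes G :: "('v, 'a, 'k::field) bimod \<Rightarrow> ('v, 'a, 'k) bimod"
  assumes G: "G \<in> res_hom Q N m 0" and z: "\<And>x. x \<in> res_mod Q N m \<Longrightarrow> res_aug Q N (G x) = 0"
  shows "\<exists>t\<in>res_hom Q N m 1. \<forall>x\<in>res_mod Q N m. bd 1 (t x) = G x"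
  unfolding One_nat_def
proof (rule lift_through[OF G])
  fix \<pi> assume \<pi>: "\<pi> \<in> qpaths Q (res_len N m)"
  show "\<exists>y\<in>corner (Suc 0) (psrc \<pi>) (ptgt Q \<pi>). bd (Suc 0) y = G (gen \<pi>)"
    using exact_aug[OF res_hom_corner[OF G gen_corner[OF \<pi>] vertex_verts[OF \<pi>]] z[OF gen_res_mod[OF \<pi>]]] by simp
qed

lemma lift_through_diff:
  fixes G :: "('v, 'a, 'k::field) bimod \<Rightarrow> ('v, 'a, 'k) bimod"
  assumes G: "G \<in> res_hom Q N m (Suc n)" and z: "\<And>x. x \<in> res_mod Q N m \<Longrightarrow> bd (Suc n) (G x) = 0"
  shows "\<exists>t\<in>res_hom Q N m (Suc (Suc n)). \<forall>x\<in>res_mod Q N m. bd (Suc (Suc n)) (t x) = G x"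
proof (rule lift_through[OF G])
  fix \<pi> assume \<pi>: "\<pi> \<in> qpaths Q (res_len N m)"
  show "\<exists>y\<in>corner (Suc (Suc n)) (psrc \<pi>) (ptgt Q \<pi>). bd (Suc (Suc n)) y = G (gen \<pi>)"
    by (rule exact_pos[OF res_hom_corner[OF G gen_corner[OF \<pi>] vertex_verts[OF \<pi>]] z[OF gen_res_mod[OF \<pi>]]])
qed

text \<open>
  Successive lifting of \<open>\<psi>\<^sub>i - t\<^bsub>i-1\<^esub> d\<close>, which is a cycle by construction.
\<close>

lemma null_homotopy:
  fixes \<psi> :: "nat \<Rightarrow> ('v, 'a, 'k::field) bimod \<Rightarrow> ('v, 'a, 'k) bimod"
  assumes hom: "\<And>i. \<psi> i \<in> res_hom Q N (n + i) i"
    and aug: "\<And>x. x \<in> res_mod Q N n \<Longrightarrow> res_aug Q N (\<psi> 0 x) = 0"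
    and chain: "\<And>i x. x \<in> res_mod Q N (n + Suc i) \<Longrightarrow> bd (Suc i) (\<psi> (Suc i) x) = \<psi> i (bd (n + Suc i) x)"
  obtains t where "\<And>i. t i \<in> res_hom Q N (n + i) (Suc i)"
    "\<And>x. x \<in> res_mod Q N n \<Longrightarrow> bd 1 (t 0 x) = \<psi> 0 x"
    "\<And>i x. x \<in> res_mod Q N (n + Suc i) \<Longrightarrow>
       bd (Suc (Suc i)) (t (Suc i) x) = \<psi> (Suc i) x - t i (bd (n + Suc i) x)"
proof -
  \<comment> \<open>The second clause is what makes the next difference a cycle; the third starts the recursion.\<close>
  let ?P = "\<lambda>i t. t \<in> res_hom Q N (n + i) (Suc i) \<and>
     (\<forall>y\<in>res_mod Q N (n + Suc i). bd (Suc i) (t (bd (n + Suc i) y)) = \<psi> i (bd (n + Suc i) y)) \<and>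
     (i = 0 \<longrightarrow> (\<forall>x\<in>res_mod Q N n. bd 1 (t x) = \<psi> 0 x))"
  let ?R = "\<lambda>i t t'. \<forall>x\<in>res_mod Q N (n + Suc i).
       bd (Suc (Suc i)) (t' x) = \<psi> (Suc i) x - t (bd (n + Suc i) x)"
  have d: "bd (n + Suc i) x \<in> res_mod Q N (n + i)" if "x \<in> res_mod Q N (n + Suc i)" for i and x :: "('v, 'a, 'k) bimod"
    using res_homD(1)[OF res_diff_hom, of x "n + i"] that by simp
  have start: "\<exists>t. ?P 0 t"
  proof -
    obtain t where t: "t \<in> res_hom Q N n 1" "\<forall>x\<in>res_mod Q N n. bd 1 (t x) = \<psi> 0 x"
      using lift_through_aug[OF hom[of 0, simplified] aug] by blast
    then show ?thesis using d[of _ 0] by (intro exI[of _ t]) simp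
  qed
  have step: "\<exists>t'. ?P (Suc i) t' \<and> ?R i t t'" if t: "?P i t" for t i
  proof -
    let ?G = "\<lambda>x. \<psi> (Suc i) x - t (bd (n + Suc i) x)"
    have dh: "bd (n + Suc i) \<in> (res_hom Q N (n + Suc i) (n + i) :: (('v, 'a, 'k) bimod \<Rightarrow> _) set)"
      using res_diff_hom[of "n + i"] by simp
    have G: "?G \<in> res_hom Q N (n + Suc i) (Suc i)"
      using t by (intro res_hom_diff[OF hom] res_hom_comp[OF _ dh]) blast
    have "bd (Suc i) (?G x) = 0" if "x \<in> res_mod Q N (n + Suc i)" for x
      using chain[OF that] t that by (simp add: res_diff_rules del: add_Suc_right)
    from lift_through_diff[OF G this] obtain t' where t': "t' \<in> res_hom Q N (n + Suc i) (Suc (Suc i))" "?R i t t'" by blast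
    have "bd (Suc (Suc i)) (t' (bd (n + Suc (Suc i)) y)) = \<psi> (Suc i) (bd (n + Suc (Suc i)) y)"
      if y: "y \<in> res_mod Q N (n + Suc (Suc i))" for y
    proof -
      have "bd (n + Suc i) (bd (n + Suc (Suc i)) y) = 0"
        using res_diff_diff[of y "n + Suc i"] y by simp
      moreover have "t 0 = 0" using t res_hom_0 by blast
      moreover have "bd (n + Suc (Suc i)) y \<in> res_mod Q N (n + Suc i)" using d[OF y] .
      ultimately show ?thesis using t'(2) by (simp del: add_Suc_right)
    qed
    then show ?thesis using t' by blast
  qed
  from dependent_nat_choice[of ?P ?R, OF start step]
  obtain t where t: "\<forall>i. ?P i (t i) \<and> ?R i (t i) (t (Suc i))" by blast
  show ?thesis
  proof (rule that[of t])
    show "t i \<in> res_hom Q N (n + i) (Suc i)" for i using t by blast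
    show "bd 1 (t 0 x) = \<psi> 0 x" if "x \<in> res_mod Q N n" for x using t that by blast
    show "bd (Suc (Suc i)) (t (Suc i) x) = \<psi> (Suc i) x - t i (bd (n + Suc i) x)"
      if "x \<in> res_mod Q N (n + Suc i)" for i x using t that by blast
  qed
qed

lemma coboundaries_Suc: "b \<in> coboundaries Q N (Suc n) \<longleftrightarrow> (\<exists>f\<in>cochains Q N n. b = coch_diff Q N n f)"
  by (auto simp: coboundaries_def)

lemma coboundaries_0: "0 \<in> (coboundaries Q N n :: ('v, 'a, 'k::field) cochain set)"
  using coch_diff_0 cochains_0 by (cases n) (force simp: coboundaries_def image_iff)+

lemma coboundaries_diff:
  fixes f g :: "('v, 'a, 'k::field) cochain"
  assumes "f \<in> coboundaries Q N n" "g \<in> coboundaries Q N n"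
  shows "f - g \<in> coboundaries Q N n"
proof (cases n)
  case 0
  then show ?thesis using assms by (simp add: coboundaries_def)
next
  case (Suc m)
  obtain f' g' where "f' \<in> cochains Q N m" "f = coch_diff Q N m f'" "g' \<in> cochains Q N m" "g = coch_diff Q N m g'"
    using assms unfolding Suc coboundaries_Suc by blast
  then show ?thesis unfolding Suc coboundaries_Suc
    by (intro bexI[of _ "f' - g'"]) (simp_all add: coch_diff_diff cochains_diff)
qed

lemma coboundaries_minus: "f \<in> coboundaries Q N n \<Longrightarrow> - f \<in> (coboundaries Q N n :: ('v, 'a, 'k::field) cochain set)"
  using coboundaries_diff[OF coboundaries_0, of f n] by simp

lemma coboundaries_add:
  "f \<in> coboundaries Q N n \<Longrightarrow> g \<in> coboundaries Q N n \<Longrightarrow> f + g \<in> (coboundaries Q N n :: ('v, 'a, 'k::field) cochain set)"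
  using coboundaries_diff[OF _ coboundaries_minus, of f n g] by simp

lemma cocycles_cochains: "f \<in> cocycles Q N n \<Longrightarrow> f \<in> (cochains Q N n :: ('v, 'a, 'k::field) cochain set)"
  by (simp add: cocycles_def)

lemma cocycles_0: "0 \<in> (cocycles Q N n :: ('v, 'a, 'k::field) cochain set)"
  and cocycles_add: "f \<in> cocycles Q N n \<Longrightarrow> g \<in> cocycles Q N n \<Longrightarrow> f + g \<in> (cocycles Q N n :: ('v, 'a, 'k) cochain set)"
  and cocycles_diff: "f \<in> cocycles Q N n \<Longrightarrow> g \<in> cocycles Q N n \<Longrightarrow> f - g \<in> (cocycles Q N n :: ('v, 'a, 'k) cochain set)"
  by (auto simp: cocycles_def cochains_0 cochains_add cochains_diff coch_diff_0 coch_diff_add coch_diff_diff)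

lemma coh_class_self: "f \<in> (coh_class Q N n f :: ('v, 'a, 'k::field) cochain set)"
  using coboundaries_0 by (force simp: coh_class_def)

lemma coh_class_eq_iff: "coh_class Q N n f = coh_class Q N n g \<longleftrightarrow> f - g \<in> (coboundaries Q N n :: ('v, 'a, 'k::field) cochain set)"
proof
  assume "coh_class Q N n f = coh_class Q N n g"
  then have "f \<in> coh_class Q N n g" using coh_class_self by blast
  then show "f - g \<in> coboundaries Q N n" by (auto simp: coh_class_def)
next
  assume d: "f - g \<in> coboundaries Q N n"
  have "coh_class Q N n f \<subseteq> coh_class Q N n g" if "f - g \<in> coboundaries Q N n" for f g :: "('v, 'a, 'k) cochain"
  proof
    fix x assume "x \<in> coh_class Q N n f"
    then obtain b where b: "b \<in> coboundaries Q N n" "x = f + b" by (auto simp: coh_class_def)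
    have "x = g + ((f - g) + b)" using b by (simp add: algebra_simps)
    then show "x \<in> coh_class Q N n g" using coboundaries_add[OF that b(1)] unfolding coh_class_def by blast
  qed
  from this[OF d] this[of g f] coboundaries_minus[OF d] show "coh_class Q N n f = coh_class Q N n g" by simp
qed

text \<open>
  Two maps that differ by \<open>H \<circ> d\<close> represent the same class; used for every change of representative or lift.
\<close>

lemma coch_of_boundary:
  fixes F G H :: "('v, 'a, 'k::field) bimod \<Rightarrow> ('v, 'a, 'k) palg"
  assumes F: "F \<in> alg_hom (Suc n)" and G: "G \<in> alg_hom (Suc n)" and H: "H \<in> alg_hom n"
    and eq: "\<And>x. x \<in> res_mod Q N (Suc n) \<Longrightarrow> F x - G x = H (bd (Suc n) x)"
  shows "coch_of Q N (Suc n) F - coch_of Q N (Suc n) G \<in> coboundaries Q N (Suc n)"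
  unfolding coboundaries_Suc
proof (rule bexI[OF _ coch_of_cochains], rule cochain_eqI)
  fix \<pi> assume \<pi>: "\<pi> \<in> qpaths Q (res_len N (Suc n))"
  have "bd (Suc n) (gen \<pi>) \<in> (res_mod Q N n :: ('v, 'a, 'k) bimod set)"
    by (rule res_homD(1)[OF res_diff_hom gen_res_mod[OF \<pi>]])
  then show "coch_val (coch_of Q N (Suc n) F - coch_of Q N (Suc n) G) \<pi> = coch_val (coch_diff Q N n (coch_of Q N n H)) \<pi>"
    using eq[OF gen_res_mod[OF \<pi>]]
    by (simp add: coch_val_rules coch_val_coch_of[OF F \<pi>] coch_val_coch_of[OF G \<pi>]
        coch_val_coch_diff[OF coch_of_cochains \<pi>] hom_of_coch_of[OF H])
qed (intro cochains_diff coch_of_cochains coch_diff_cochains)+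

lemma coch_of_cong:
  fixes F G :: "('v, 'a, 'k::field) bimod \<Rightarrow> ('v, 'a, 'k) palg"
  assumes F: "F \<in> alg_hom n" and G: "G \<in> alg_hom n" and eq: "\<And>x. x \<in> res_mod Q N n \<Longrightarrow> F x = G x"
  shows "coch_of Q N n F = coch_of Q N n G"
  using eq[OF gen_res_mod]
  by (intro cochain_eqI[OF coch_of_cochains coch_of_cochains]) (simp add: coch_val_coch_of[OF F] coch_val_coch_of[OF G])

lemma cocycle_liftD:
  fixes g :: "('v, 'a, 'k::field) cochain"
  assumes "cocycle_lift Q N n g \<phi>"
  shows "\<phi> i \<in> res_hom Q N (n + i) i" "x \<in> res_mod Q N n \<Longrightarrow> res_aug Q N (\<phi> 0 x) = hom_of Q N g x"
    "x \<in> res_mod Q N (n + Suc i) \<Longrightarrow> bd (Suc i) (\<phi> (Suc i) x) = \<phi> i (bd (n + Suc i) x)"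
  using assms by (auto simp: cocycle_lift_def)

lemma cocycle_liftI:
  fixes g :: "('v, 'a, 'k::field) cochain"
  assumes "\<And>i. \<phi> i \<in> res_hom Q N (n + i) i" "\<And>x. x \<in> res_mod Q N n \<Longrightarrow> res_aug Q N (\<phi> 0 x) = hom_of Q N g x"
    "\<And>i x. x \<in> res_mod Q N (n + Suc i) \<Longrightarrow> bd (Suc i) (\<phi> (Suc i) x) = \<phi> i (bd (n + Suc i) x)"
  shows "cocycle_lift Q N n g \<phi>"
  using assms by (simp add: cocycle_lift_def)

lemma lift_alg_hom:
  fixes f g :: "('v, 'a, 'k::field) cochain"
  assumes "f \<in> cochains Q N m" "cocycle_lift Q N n g \<phi>"
  shows "hom_of Q N f \<circ> \<phi> m \<in> alg_hom (m + n)"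
  using alg_hom_comp[OF hom_of_alg_hom[OF assms(1)] cocycle_liftD(1)[OF assms(2)]] by (simp add: add.commute)

text \<open>
  With a null homotopy \<open>t\<close> of the difference of the lifts, \<open>f \<circ> (\<phi>\<^sub>m - \<phi>'\<^sub>m) = f \<circ> d \<circ> t\<^sub>m + f \<circ> t\<^bsub>m-1\<^esub> \<circ> d\<close>, and the first
  summand vanishes because \<open>f\<close> is a cocycle.
\<close>

lemma lift_product_unique:
  fixes f g :: "('v, 'a, 'k::field) cochain"
  assumes f: "f \<in> cocycles Q N m" and \<phi>: "cocycle_lift Q N n g \<phi>" and \<phi>': "cocycle_lift Q N n g \<phi>'"
  shows "coch_of Q N (m + n) (hom_of Q N f \<circ> \<phi> m) - coch_of Q N (m + n) (hom_of Q N f \<circ> \<phi>' m) \<in> coboundaries Q N (m + n)"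
proof -
  let ?\<psi> = "\<lambda>i x. \<phi> i x - \<phi>' i x"
  note fc = cocycles_cochains[OF f]
  note F = lift_alg_hom[OF fc \<phi>] lift_alg_hom[OF fc \<phi>']
  have d: "bd (n + Suc i) x \<in> res_mod Q N (n + i)" if "x \<in> res_mod Q N (n + Suc i)" for i and x :: "('v, 'a, 'k) bimod"
    using res_homD(1)[OF res_diff_hom, of x "n + i"] that by simp
  obtain t where t: "\<And>i. t i \<in> res_hom Q N (n + i) (Suc i)"
    "\<And>x. x \<in> res_mod Q N n \<Longrightarrow> bd 1 (t 0 x) = ?\<psi> 0 x"
    "\<And>i x. x \<in> res_mod Q N (n + Suc i) \<Longrightarrow>
       bd (Suc (Suc i)) (t (Suc i) x) = ?\<psi> (Suc i) x - t i (bd (n + Suc i) x)"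
  proof (rule null_homotopy[of ?\<psi> n])
    show "?\<psi> i \<in> res_hom Q N (n + i) i" for i
      by (rule res_hom_diff[OF cocycle_liftD(1)[OF \<phi>] cocycle_liftD(1)[OF \<phi>']])
    show "res_aug Q N (?\<psi> 0 x) = 0" if "x \<in> res_mod Q N n" for x
      using cocycle_liftD(2)[OF \<phi> that] cocycle_liftD(2)[OF \<phi>' that] by (simp add: res_aug_rules)
    show "bd (Suc i) (?\<psi> (Suc i) x) = ?\<psi> i (bd (n + Suc i) x)" if "x \<in> res_mod Q N (n + Suc i)" for i x
      using cocycle_liftD(3)[OF \<phi> that] cocycle_liftD(3)[OF \<phi>' that] by (simp add: res_diff_rules)
  qed blast
  show ?thesis
  proof (cases m)
    case 0
    have "(hom_of Q N f \<circ> \<phi> m) x = (hom_of Q N f \<circ> \<phi>' m) x" if x: "x \<in> res_mod Q N (m + n)" for x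
    proof -
      have xn: "x \<in> res_mod Q N n" using x 0 by simp
      have "t 0 x \<in> res_mod Q N (Suc 0)" using res_homD(1)[OF t(1)[of 0]] xn by simp
      then have "hom_of Q N f (bd (Suc 0) (t 0 x)) = 0" using cocycleD[of f 0] f 0 by blast
      then show ?thesis using t(2)[OF xn] 0 by (simp add: hom_of_rules)
    qed
    from coch_of_cong[OF F this] show ?thesis by (simp only: diff_self coboundaries_0)
  next
    case (Suc i)
    have mn: "m + n = Suc (n + i)" using Suc by simp
    have "(hom_of Q N f \<circ> \<phi> m) x - (hom_of Q N f \<circ> \<phi>' m) x = (hom_of Q N f \<circ> t i) (bd (Suc (n + i)) x)"
      if x: "x \<in> res_mod Q N (Suc (n + i))" for x
    proof -
      have xn: "x \<in> res_mod Q N (n + Suc i)" using x by simp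
      have "t (Suc i) x \<in> res_mod Q N (Suc (Suc i))" using res_homD(1)[OF t(1)[of "Suc i"] xn] .
      then have "hom_of Q N f (bd (Suc (Suc i)) (t (Suc i) x)) = 0" using cocycleD[of f "Suc i"] f Suc by blast
      then show ?thesis unfolding t(3)[OF xn] using Suc by (simp add: hom_of_rules)
    qed
    then show ?thesis
      using F fc unfolding mn unfolding Suc
      by (intro coch_of_boundary[where H = "hom_of Q N f \<circ> t i"] alg_hom_comp[OF hom_of_alg_hom t(1)]) auto
  qed
qed

text \<open>
  A coboundary \<open>\<beta> \<circ> d\<close> added to \<open>f\<close> changes the product by \<open>\<beta> \<circ> d \<circ> \<phi>\<^sub>m = \<beta> \<circ> \<phi>\<^bsub>m-1\<^esub> \<circ> d\<close>. A coboundary added to \<open>g\<close> changes the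
  lift in degree 0 only, by a composite with \<open>d\<close>; after that, uniqueness for a fixed cocycle applies.
\<close>

lemma yoneda_eq:
  fixes f g :: "('v, 'a, 'k::field) cochain"
  assumes f: "f \<in> cocycles Q N m" and g: "g \<in> cocycles Q N n" and \<phi>: "cocycle_lift Q N n g \<phi>"
  shows "yoneda Q N m n (coh_class Q N m f) (coh_class Q N n g) =
    coh_class Q N (m + n) (coch_of Q N (m + n) (hom_of Q N f \<circ> \<phi> m))"
proof -
  let ?c = "\<lambda>f \<phi>. coch_of Q N (m + n) (hom_of Q N f \<circ> \<phi> m)"
  note fc = cocycles_cochains[OF f] and gc = cocycles_cochains[OF g]
  have left: "?c (f + b) \<phi>' - ?c f \<phi>' \<in> coboundaries Q N (m + n)"
    if b: "b \<in> coboundaries Q N m" and \<phi>': "cocycle_lift Q N n g' \<phi>'" for b g' \<phi>'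
  proof (cases m)
    case 0
    then show ?thesis using b by (simp add: coboundaries_def coboundaries_0[of n, unfolded coboundaries_def])
  next
    case (Suc i)
    then obtain \<beta> where \<beta>: "\<beta> \<in> cochains Q N i" "b = coch_diff Q N i \<beta>" using b by (auto simp: coboundaries_Suc)
    have mn: "m + n = Suc (n + i)" using Suc by simp
    have bc: "b \<in> cochains Q N m" using \<beta> Suc coch_diff_cochains by simp
    have H: "hom_of Q N \<beta> \<circ> \<phi>' i \<in> alg_hom (n + i)" using lift_alg_hom[OF \<beta>(1) \<phi>'] by (simp add: add.commute)
    show ?thesis unfolding mn
    proof (rule coch_of_boundary[OF _ _ H])
      show "hom_of Q N (f + b) \<circ> \<phi>' m \<in> alg_hom (Suc (n + i))" "hom_of Q N f \<circ> \<phi>' m \<in> alg_hom (Suc (n + i))"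
        using lift_alg_hom[OF cochains_add[OF fc bc] \<phi>'] lift_alg_hom[OF fc \<phi>'] mn by simp_all
      fix x :: "('v, 'a, 'k) bimod" assume x: "x \<in> res_mod Q N (Suc (n + i))"
      then have xn: "x \<in> res_mod Q N (n + Suc i)" by simp
      have "hom_of Q N b (\<phi>' (Suc i) x) = hom_of Q N \<beta> (bd (Suc i) (\<phi>' (Suc i) x))"
        unfolding \<beta>(2) by (rule hom_of_coch_diff[OF \<beta>(1) res_homD(1)[OF cocycle_liftD(1)[OF \<phi>'] xn]])
      then show "(hom_of Q N (f + b) \<circ> \<phi>' m) x - (hom_of Q N f \<circ> \<phi>' m) x = (hom_of Q N \<beta> \<circ> \<phi>' i) (bd (Suc (n + i)) x)"
        using cocycle_liftD(3)[OF \<phi>' xn] Suc by (simp add: hom_of_fun_add)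
    qed
  qed
  have right: "?c f \<phi>' - ?c f \<phi> \<in> coboundaries Q N (m + n)"
    if b: "b \<in> coboundaries Q N n" and \<phi>': "cocycle_lift Q N n (g + b) \<phi>'" for b \<phi>'
  proof (cases n)
    case 0
    then have "g + b = g" using b by (simp add: coboundaries_def)
    then show ?thesis using lift_product_unique[OF f _ \<phi>] \<phi>' by metis
  next
    case (Suc j)
    then obtain \<beta> where \<beta>: "\<beta> \<in> cochains Q N j" "b = coch_diff Q N j \<beta>" using b by (auto simp: coboundaries_Suc)
    \<comment> \<open>The lift of \<open>b = \<beta> \<circ> d\<close> is concentrated in degree 0, where it is \<open>d\<close> followed by a lift of \<open>\<beta>\<close>.\<close>
    define c where "c \<pi> = ten (ev (psrc \<pi>)) (psrc \<pi>, []) (coch_val \<beta> \<pi>)" for \<pi>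
    have c: "c \<pi> \<in> corner 0 (psrc \<pi>) (ptgt Q \<pi>)" if \<pi>: "\<pi> \<in> qpaths Q (res_len N j)" for \<pi>
      unfolding c_def using vertex_verts[OF \<pi>] vert_qpaths[OF fin_digraph_axioms] coch_val_corner(1)[OF \<beta>(1), of \<pi>]
      by (intro ten_corner[where d = 0 and e = 0]) (auto simp: path_simps res_len_simps intro: pcorner_ev)
    have \<sigma>: "bext c \<in> res_hom Q N j 0" by (rule bext_hom[OF c])
    have aug: "res_aug Q N (bext c x) = hom_of Q N \<beta> x" if "x \<in> res_mod Q N j" for x
    proof -
      have "(res_aug Q N \<circ> bext c) x = hom_of Q N \<beta> x"
      proof (rule alg_hom_eqI[OF alg_hom_comp[OF res_aug_alg_hom \<sigma>] hom_of_alg_hom[OF \<beta>(1)] that])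
        fix \<pi> assume \<pi>: "\<pi> \<in> qpaths Q (res_len N j)"
        show "(res_aug Q N \<circ> bext c) (gen \<pi>) = hom_of Q N \<beta> (gen \<pi>)"
          using coch_val_corner[OF \<beta>(1), of \<pi>] pcorner_ev_mult[OF coch_val_corner(1)[OF \<beta>(1), of \<pi>]]
          by (simp add: bext_gen[where c = c, OF c[OF \<pi>]] c_def res_aug_ten hom_of_gen[OF \<beta>(1)])
      qed
      then show ?thesis by simp
    qed
    have d: "bd n \<in> (res_hom Q N n j :: (('v, 'a, 'k) bimod \<Rightarrow> _) set)" using res_diff_hom[of j] Suc by simp
    define \<chi> where "\<chi> i = (if i = 0 then \<lambda>x. \<phi> 0 x + bext c (bd n x) else \<phi> i)" for i
    have \<chi>: "cocycle_lift Q N n (g + b) \<chi>"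
    proof (rule cocycle_liftI)
      show "\<chi> i \<in> res_hom Q N (n + i) i" for i
      proof (cases "i = 0")
        case True
        then show ?thesis
          using res_hom_add[OF cocycle_liftD(1)[OF \<phi>, of 0, simplified] res_hom_comp[OF \<sigma> d]] by (simp add: \<chi>_def)
      qed (simp add: \<chi>_def cocycle_liftD(1)[OF \<phi>])
      show "res_aug Q N (\<chi> 0 x) = hom_of Q N (g + b) x" if x: "x \<in> res_mod Q N n" for x
        using aug[OF res_homD(1)[OF d x]] cocycle_liftD(2)[OF \<phi> x] hom_of_coch_diff[OF \<beta>(1), of x] x Suc \<beta>(2)
        by (simp add: \<chi>_def res_aug_rules hom_of_fun_add)
      show "bd (Suc i) (\<chi> (Suc i) x) = \<chi> i (bd (n + Suc i) x)" if x: "x \<in> res_mod Q N (n + Suc i)" for i x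
        using cocycle_liftD(3)[OF \<phi> x] res_diff_diff[of x n] x by (auto simp: \<chi>_def bext_rules)
    qed
    have "?c f \<phi>' - ?c f \<chi> \<in> coboundaries Q N (m + n)" by (rule lift_product_unique[OF f \<phi>' \<chi>])
    moreover have "?c f \<chi> - ?c f \<phi> \<in> coboundaries Q N (m + n)"
    proof (cases "m = 0")
      case True
      have mn: "m + n = Suc j" using True Suc by simp
      show ?thesis unfolding mn
      proof (rule coch_of_boundary)
        show "hom_of Q N f \<circ> \<chi> m \<in> alg_hom (Suc j)" "hom_of Q N f \<circ> \<phi> m \<in> alg_hom (Suc j)"
          using lift_alg_hom[OF fc \<chi>] lift_alg_hom[OF fc \<phi>] mn by simp_all
        show "hom_of Q N f \<circ> bext c \<in> alg_hom j"
          using fc True by (intro alg_hom_comp[OF hom_of_alg_hom \<sigma>]) simp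
      qed (simp add: True \<chi>_def hom_of_rules Suc)
    qed (simp add: \<chi>_def coboundaries_0)
    ultimately show ?thesis using coboundaries_add by fastforce
  qed
  have "coh_class Q N (m + n) (?c f' \<phi>') = coh_class Q N (m + n) (?c f \<phi>)"
    if "f' \<in> coh_class Q N m f" "g' \<in> coh_class Q N n g" "cocycle_lift Q N n g' \<phi>'" for f' g' \<phi>'
  proof -
    obtain b1 b2 where b: "b1 \<in> coboundaries Q N m" "f' = f + b1" "b2 \<in> coboundaries Q N n" "g' = g + b2"
      using \<open>f' \<in> _\<close> \<open>g' \<in> _\<close> by (auto simp: coh_class_def)
    have "?c f' \<phi>' - ?c f \<phi> = (?c (f + b1) \<phi>' - ?c f \<phi>') + (?c f \<phi>' - ?c f \<phi>)" by (simp add: b)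
    also have "\<dots> \<in> coboundaries Q N (m + n)"
      using left[OF b(1)] right[OF b(3)] that(3) b(4) by (intro coboundaries_add) auto
    finally show ?thesis by (simp add: coh_class_eq_iff)
  qed
  then have "{coh_class Q N (m + n) (?c f' \<phi>') |f' g' \<phi>'. f' \<in> coh_class Q N m f \<and> g' \<in> coh_class Q N n g \<and> cocycle_lift Q N n g' \<phi>'} =
      {coh_class Q N (m + n) (?c f \<phi>)}"
    using coh_class_self \<phi> by blast
  then show ?thesis by (simp add: yoneda_def)
qed

section \<open>Explicit lifts\<close>

lemma coch_seg_corner:
  fixes g :: "('v, 'a, 'k::field) cochain"
  assumes "g \<in> cochains Q N n" "i \<le> j" "j \<le> plen w"
  shows "val g w i j \<in> pcorner 0 (vx Q w i) (vx Q w j)"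
  using coch_val_corner(1)[OF assms(1), of "seg Q w i j"] assms by (simp add: seg_simps(1) ptgt_seg)

lemma coch_seg_E:
  fixes g :: "('v, 'a, 'k::field) cochain"
  assumes "g \<in> cochains Q N n" "i \<le> j" "j \<le> plen w"
  shows "E w i i \<star> val g w i j = val g w i j"
    "E w i i \<star> (val g w i j \<star> z) = val g w i j \<star> z"
    "val g w i j \<star> E w j j = val g w i j"
    "val g w i j \<star> (E w j j \<star> z) = val g w i j \<star> z"
  using pcorner_ev_mult[OF coch_seg_corner[OF assms]] by (simp_all add: E_refl mult_assoc[symmetric])

lemma gen_seg:
  "i \<le> j \<Longrightarrow> j \<le> plen w \<Longrightarrow> gen (seg Q w i j) = (ten (E w i i) (seg Q w i j) (E w j j) :: ('v, 'a, 'k::field) bimod)"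
  by (simp add: gen_def E_refl seg_simps(1) ptgt_seg)

text \<open>This is the cocycle condition itself, the differential in odd degrees having two terms.\<close>

lemma even_cocycle_step:
  fixes g :: "('v, 'a, 'k::field) cochain"
  assumes g: "g \<in> cocycles Q N (2 * l)" and w: "w \<in> qpaths Q L" and i: "i + l * N + 1 \<le> L"
  shows "trunc N (E w i (Suc i) \<star> val g w (Suc i) (Suc i + l * N)) =
    trunc N (val g w i (i + l * N) \<star> E w (i + l * N) (Suc i + l * N))"
proof -
  note gc = cocycles_cochains[OF g]
  have L: "plen w = L" by (rule qpaths_plen[OF w])
  define b where "b = i + l * N + 1"
  have b: "i \<le> b" "b \<le> plen w" using i L by (auto simp: b_def)
  have "seg Q w i b \<in> qpaths Q (res_len N (2 * l + 1))"
    using w b L by (intro seg_paths[OF w]) (auto simp: b_def res_len_simps)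
  then have "hom_of Q N g (bd (2 * l + 1) (gen (seg Q w i b))) = 0"
    using cocycleD[OF g] gen_res_mod by (metis Suc_eq_plus1)
  also have "bd (2 * l + 1) (gen (seg Q w i b)) =
      ten (E w i (i + 1)) (seg Q w (i + 1) b) (E w b b) - ten (E w i i) (seg Q w i (i + l * N)) (E w (i + l * N) b)"
    unfolding gen_seg[OF b] using b by (subst res_diff_odd) (auto simp: b_def E_mult)
  finally have "trunc N (E w i (i + 1) \<star> val g w (i + 1) b) =
      trunc N (val g w i (i + l * N) \<star> E w (i + l * N) b)"
    using b by (simp add: hom_of_rules hom_of_ten[OF gc] coch_seg_E[OF gc] b_def del: seg_simps(2))
  then show ?thesis by (simp add: b_def)
qed

text \<open>Iterating the previous lemma arrow by arrow.\<close>

lemma even_cocycle_slide: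
  fixes g :: "('v, 'a, 'k::field) cochain"
  assumes g: "g \<in> cocycles Q N (2 * l)" and w: "w \<in> qpaths Q L" and ij: "i \<le> j" "j + l * N \<le> L"
  shows "trunc N (E w i j \<star> val g w j (j + l * N)) =
    trunc N (val g w i (i + l * N) \<star> E w (i + l * N) (j + l * N))"
  using ij
proof (induction j rule: dec_induct)
  case base
  then show ?case using qpaths_plen[OF w] cocycles_cochains[OF g] by (simp add: coch_seg_E del: seg_simps(2))
next
  case (step j)
  let ?G = "\<lambda>j. val g w j (j + l * N)"
  have L: "plen w = L" by (rule qpaths_plen[OF w])
  have "trunc N (E w i (Suc j) \<star> ?G (Suc j)) = trunc N (E w i j \<star> (E w j (Suc j) \<star> ?G (Suc j)))"
    using step L by (simp add: E_mult)
  also have "\<dots> = trunc N (E w i j \<star> (?G j \<star> E w (j + l * N) (Suc j + l * N)))"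
    by (rule trunc_mult_cong(2)[OF even_cocycle_step[OF g w]]) (use step in simp)
  also have "\<dots> = trunc N (?G i \<star> E w (i + l * N) (j + l * N) \<star> E w (j + l * N) (Suc j + l * N))"
    unfolding mult_assoc[symmetric] by (rule trunc_mult_cong(1)) (use step in simp)
  also have "\<dots> = trunc N (?G i \<star> E w (i + l * N) (Suc j + l * N))"
    using step L by (simp add: mult_assoc E_mult)
  finally show ?case .
qed

lemma odd_cocycle_sum:
  fixes g :: "('v, 'a, 'k::field) cochain"
  assumes g: "g \<in> cocycles Q N (2 * l + 1)" and w: "w \<in> qpaths Q L" and b: "b = a + l * N + N" "b \<le> L"
  shows "trunc N (\<Sum>j<N. E w a (a + j) \<star> (val g w (a + j) (a + j + l * N + 1) \<star> E w (a + j + l * N + 1) b)) = 0"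
proof -
  note gc = cocycles_cochains[OF g]
  have L: "plen w = L" by (rule qpaths_plen[OF w])
  have ab: "a \<le> b" "b \<le> plen w" using b L by auto
  have "seg Q w a b \<in> qpaths Q (res_len N (Suc (2 * l + 1)))"
  proof (rule seg_paths[OF w])
    show "res_len N (Suc (2 * l + 1)) = b - a" using b res_len_simps(4)[of N l] by simp
  qed (use ab L in auto)
  then have "hom_of Q N g (bd (2 * l + 2) (gen (seg Q w a b))) = 0"
    using cocycleD[OF g] gen_res_mod by (metis add_2_eq_Suc' Suc_eq_plus1)
  also have "bd (2 * l + 2) (gen (seg Q w a b)) =
      (\<Sum>j<N. ten (E w a (a + j)) (seg Q w (a + j) (a + j + l * N + 1)) (E w (a + j + l * N + 1) b))"
    unfolding gen_seg[OF ab] using b ab by (subst res_diff_even) (auto simp: E_mult intro!: sum.cong)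
  finally show ?thesis
    by (simp add: hom_of_rules hom_of_ten[OF gc] trunc_rules)
qed

text \<open>
  Values of the lifts on generators. \<open>right_lift\<close> evaluates \<open>g\<close> on the last part of \<open>\<pi>\<close> and \<open>left_lift\<close> on the first
  part. In \<open>odd_lift\<close>, which serves \<open>g\<close> of degree \<open>2 * l + 1\<close> in degree \<open>2 * k + 1\<close>, the index \<open>j\<close> is the position of \<open>g\<close> in the
  cocycle condition and \<open>p\<close> comes from undoing the two-term differential below \<open>j\<close>.
\<close>

definition right_lift :: "('v, 'a, 'k::field) cochain \<Rightarrow> nat \<Rightarrow> ('v, 'a) qpath \<Rightarrow> ('v, 'a, 'k) bimod" where
  "right_lift g i \<pi> = cut \<pi> 0 (res_len N i) (val g \<pi> (res_len N i) (plen \<pi>))"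

definition left_lift :: "('v, 'a, 'k::field) cochain \<Rightarrow> nat \<Rightarrow> ('v, 'a) qpath \<Rightarrow> ('v, 'a, 'k) bimod" where
  "left_lift g i \<pi> = (let r = plen \<pi> - res_len N i in
     ten (val g \<pi> 0 r) (seg Q \<pi> r (plen \<pi>)) (E \<pi> (plen \<pi>) (plen \<pi>)))"

definition odd_lift :: "nat \<Rightarrow> ('v, 'a, 'k::field) cochain \<Rightarrow> nat \<Rightarrow> ('v, 'a) qpath \<Rightarrow> ('v, 'a, 'k) bimod" where
  "odd_lift l g k \<pi> = (\<Sum>j<N. \<Sum>p<j. cut \<pi> p (p + k * N + 1)
     (E \<pi> (p + k * N + 1) (j + k * N) \<star> (val g \<pi> (j + k * N) (j + k * N + l * N + 1) \<star>
        E \<pi> (j + k * N + l * N + 1) (plen \<pi>))))"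

lemma vx_ends: "\<pi> \<in> qpaths Q L \<Longrightarrow> psrc \<pi> = vx Q \<pi> 0" "\<pi> \<in> qpaths Q L \<Longrightarrow> ptgt Q \<pi> = vx Q \<pi> L"
  using vx_plen[of Q \<pi>] by (auto simp: vx_0 dest: qpaths_plen)

lemma right_lift_corner:
  fixes g :: "('v, 'a, 'k::field) cochain"
  assumes g: "g \<in> cochains Q N n" and \<pi>: "\<pi> \<in> qpaths Q L" and L: "res_len N i \<le> L"
  shows "right_lift g i \<pi> \<in> corner i (psrc \<pi>) (ptgt Q \<pi>)"
  unfolding right_lift_def vx_ends[OF \<pi>] using L qpaths_plen[OF \<pi>]
  by (intro ten_seg_corner[OF \<pi>, where d = 0 and e = 0] pcorner_E_0[OF \<pi>]) (auto intro: coch_seg_corner[OF g])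

lemma left_lift_corner:
  fixes g :: "('v, 'a, 'k::field) cochain"
  assumes g: "g \<in> cochains Q N n" and \<pi>: "\<pi> \<in> qpaths Q L" and L: "res_len N i \<le> L"
  shows "left_lift g i \<pi> \<in> corner i (psrc \<pi>) (ptgt Q \<pi>)"
  unfolding left_lift_def vx_ends[OF \<pi>] Let_def using L qpaths_plen[OF \<pi>]
  by (intro ten_seg_corner[OF \<pi>, where d = 0 and e = 0] pcorner_E_0[OF \<pi>])
    (auto intro: coch_seg_corner[OF g] pcorner_E_0[OF \<pi>])

lemma odd_lift_corner:
  fixes g :: "('v, 'a, 'k::field) cochain"
  assumes g: "g \<in> cochains Q N n" and \<pi>: "\<pi> \<in> qpaths Q L" and L: "L = k * N + l * N + N"
  shows "odd_lift l g k \<pi> \<in> corner (2 * k + 1) (psrc \<pi>) (ptgt Q \<pi>)"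
  unfolding odd_lift_def vx_ends[OF \<pi>] using L qpaths_plen[OF \<pi>]
  by (intro corner_sum ten_seg_corner[OF \<pi>, where d = 0 and e = 0] pcorner_mult_0[OF pcorner_E_0[OF \<pi>]]
      pcorner_mult_0[OF coch_seg_corner[OF g]] pcorner_E_0[OF \<pi>])
    (auto simp: res_len_simps intro: pcorner_E_0[OF \<pi>])

lemma bext_seg:
  fixes c :: "('v, 'a) qpath \<Rightarrow> ('v, 'a, 'k::field) bimod"
  assumes "c (seg Q w a b) \<in> corner n (vx Q w a) (vx Q w b)" "a \<le> b" "b \<le> plen w"
  shows "bext c (ten x (seg Q w a b) y) = lact Q N x (ract Q N (c (seg Q w a b)) y)"
  using assms by (intro bext_ten[where n = n]) (simp add: seg_simps(1) ptgt_seg)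

text \<open>
  This and the next two lemmas transport the values on generators to an arbitrary segment of a
  path \<open>w\<close>, the form in which both sides of the chain map identity can be compared.
\<close>

lemma bext_right_lift:
  fixes g :: "('v, 'a, 'k::field) cochain"
  assumes g: "g \<in> cochains Q N n" and w: "w \<in> qpaths Q L" and b: "a + res_len N i \<le> b" "b \<le> L"
  shows "bext (right_lift g i) (ten x (seg Q w a b) y) =
    ten x (seg Q w a (a + res_len N i)) (val g w (a + res_len N i) b \<star> y)"
proof -
  have s: "seg Q w a b \<in> qpaths Q (b - a)" using b by (intro seg_paths[OF w]) auto
  have L: "plen w = L" by (rule qpaths_plen[OF w])
  have ab: "a \<le> b" using b by simp
  have "right_lift g i (seg Q w a b) \<in> corner i (vx Q w a) (vx Q w b)"
    using right_lift_corner[OF g s, of i] b L by (simp add: seg_simps(1) ptgt_seg)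
  from bext_seg[where c = "right_lift g i", OF this ab, of x y] show ?thesis
    using b L by (simp add: right_lift_def ract_ten lact_ten seg_seg ten_E_refl seg_simps(3) del: seg_simps(2))
qed

lemma bext_left_lift:
  fixes g :: "('v, 'a, 'k::field) cochain"
  assumes g: "g \<in> cochains Q N n" and w: "w \<in> qpaths Q L" and b: "b = c + res_len N i" "b \<le> L" "a \<le> c"
  shows "bext (left_lift g i) (ten x (seg Q w a b) y) =
    ten (x \<star> val g w a c) (seg Q w c b) y"
proof -
  have s: "seg Q w a b \<in> qpaths Q (b - a)" using b by (intro seg_paths[OF w]) auto
  have L: "plen w = L" by (rule qpaths_plen[OF w])
  have ab: "a \<le> b" "b - a - res_len N i = c - a" using b by simp_all
  have "left_lift g i (seg Q w a b) \<in> corner i (vx Q w a) (vx Q w b)"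
    using left_lift_corner[OF g s, of i] b L by (simp add: seg_simps(1) ptgt_seg)
  from bext_seg[where c = "left_lift g i", OF this ab(1), of x y] show ?thesis
    using b L ab by (simp add: left_lift_def Let_def ract_ten lact_ten seg_seg ten_E_refl seg_simps(3) del: seg_simps(2))
qed

lemma bext_odd_lift:
  fixes g :: "('v, 'a, 'k::field) cochain"
  assumes g: "g \<in> cochains Q N n" and w: "w \<in> qpaths Q L" and b: "b = a + k * N + l * N + N" "b \<le> L"
  shows "bext (odd_lift l g k) (ten x (seg Q w a b) y) =
    (\<Sum>j<N. \<Sum>p<j. ten (x \<star> E w a (a + p)) (seg Q w (a + p) (a + p + k * N + 1))
     (E w (a + p + k * N + 1) (a + j + k * N) \<star> (val g w (a + j + k * N) (a + j + k * N + l * N + 1) \<star>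
        (E w (a + j + k * N + l * N + 1) b \<star> y))))"
proof -
  have s: "seg Q w a b \<in> qpaths Q (b - a)" using b by (intro seg_paths[OF w]) auto
  have L: "plen w = L" by (rule qpaths_plen[OF w])
  have ab: "a \<le> b" using b by simp
  have "odd_lift l g k (seg Q w a b) \<in> corner (2 * k + 1) (vx Q w a) (vx Q w b)"
    using odd_lift_corner[OF g s, of k l] b L by (simp add: seg_simps(1) ptgt_seg)
  from bext_seg[where c = "odd_lift l g k", OF this ab, of x y] have "bext (odd_lift l g k) (ten x (seg Q w a b) y) =
     lact Q N x (ract Q N (odd_lift l g k (seg Q w a b)) y)" using b L by simp
  also have "\<dots> = (\<Sum>j<N. \<Sum>p<j. ten (x \<star> E w a (a + p)) (seg Q w (a + p) (a + p + k * N + 1))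
     (E w (a + p + k * N + 1) (a + j + k * N) \<star> (val g w (a + j + k * N) (a + j + k * N + l * N + 1) \<star>
        (E w (a + j + k * N + l * N + 1) b \<star> y))))"
    unfolding odd_lift_def ract_rules lact_rules ract_ten lact_ten mult_assoc
    using b L
    by (intro sum.cong refl) (simp add: seg_seg seg_simps(3) add.assoc del: seg_simps(2))
  finally show ?thesis .
qed

lemma right_lift_aug:
  fixes g :: "('v, 'a, 'k::field) cochain"
  assumes g: "g \<in> cochains Q N n" and x: "x \<in> res_mod Q N n"
  shows "res_aug Q N (bext (right_lift g 0) x) = hom_of Q N g x"
proof -
  have hom: "bext (right_lift g 0) \<in> res_hom Q N n 0"
    by (intro bext_hom right_lift_corner[OF g]) (auto simp: res_len_simps)
  have "(res_aug Q N \<circ> bext (right_lift g 0)) x = hom_of Q N g x"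
  proof (rule alg_hom_eqI[OF alg_hom_comp[OF res_aug_alg_hom hom] hom_of_alg_hom[OF g] x])
    fix \<pi> assume \<pi>: "\<pi> \<in> qpaths Q (res_len N n)"
    have "bext (right_lift g 0) (gen \<pi>) = right_lift g 0 \<pi>"
      by (rule bext_gen[where c = "right_lift g 0", OF right_lift_corner[OF g \<pi>]]) (simp add: res_len_simps)
    moreover have "coch_val g \<pi> = ev (vx Q \<pi> 0) \<star> coch_val g \<pi>"
      using pcorner_ev_mult(1)[OF coch_val_corner(1)[OF g, of \<pi>]] by (simp add: vx_0)
    ultimately show "(res_aug Q N \<circ> bext (right_lift g 0)) (gen \<pi>) = hom_of Q N g (gen \<pi>)"
      using coch_val_corner(2)[OF g, of \<pi>]
      by (simp add: right_lift_def res_len_simps seg_full seg_simps(2) res_aug_ten hom_of_gen[OF g])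
  qed
  then show ?thesis by simp
qed

lemma left_lift_aug:
  fixes g :: "('v, 'a, 'k::field) cochain"
  assumes g: "g \<in> cochains Q N n" and x: "x \<in> res_mod Q N n"
  shows "res_aug Q N (bext (left_lift g 0) x) = hom_of Q N g x"
proof -
  have hom: "bext (left_lift g 0) \<in> res_hom Q N n 0"
    by (intro bext_hom left_lift_corner[OF g]) (auto simp: res_len_simps)
  have "(res_aug Q N \<circ> bext (left_lift g 0)) x = hom_of Q N g x"
  proof (rule alg_hom_eqI[OF alg_hom_comp[OF res_aug_alg_hom hom] hom_of_alg_hom[OF g] x])
    fix \<pi> assume \<pi>: "\<pi> \<in> qpaths Q (res_len N n)"
    have "bext (left_lift g 0) (gen \<pi>) = left_lift g 0 \<pi>"
      by (rule bext_gen[where c = "left_lift g 0", OF left_lift_corner[OF g \<pi>]]) (simp add: res_len_simps)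
    moreover have "coch_val g \<pi> \<star> ev (vx Q \<pi> (plen \<pi>)) = coch_val g \<pi>"
      using pcorner_ev_mult(2)[OF coch_val_corner(1)[OF g, of \<pi>]] by (simp add: vx_plen)
    ultimately show "(res_aug Q N \<circ> bext (left_lift g 0)) (gen \<pi>) = hom_of Q N g (gen \<pi>)"
      using coch_val_corner(2)[OF g, of \<pi>]
      by (simp add: left_lift_def Let_def res_len_simps seg_full seg_simps(2) res_aug_ten hom_of_gen[OF g] kmul_simps path_simps)
  qed
  then show ?thesis by simp
qed

text \<open>Reduces the defining properties of a lift to one identity for each path.\<close>

lemma lift_by_generators:
  fixes g :: "('v, 'a, 'k::field) cochain"
  assumes c: "\<And>i \<pi>. \<pi> \<in> qpaths Q (res_len N (n + i)) \<Longrightarrow> c i \<pi> \<in> corner i (psrc \<pi>) (ptgt Q \<pi>)"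
    and aug: "\<And>x. x \<in> res_mod Q N n \<Longrightarrow> res_aug Q N (bext (c 0) x) = hom_of Q N g x"
    and chain: "\<And>i w L. w \<in> qpaths Q L \<Longrightarrow> L = res_len N (n + Suc i) \<Longrightarrow>
      bd (Suc i) (bext (c (Suc i)) (cut w 0 L (E w L L))) =
      bext (c i) (bd (n + Suc i) (cut w 0 L (E w L L)))"
  shows "cocycle_lift Q N n g (\<lambda>i. bext (c i))"
proof (rule cocycle_liftI)
  show hom: "bext (c i) \<in> res_hom Q N (n + i) i" for i by (rule bext_hom[OF c])
  show "res_aug Q N (bext (c 0) x) = hom_of Q N g x" if "x \<in> res_mod Q N n" for x by (rule aug[OF that])
  have d: "bd (n + Suc i) \<in> (res_hom Q N (n + Suc i) (n + i) :: (('v, 'a, 'k) bimod \<Rightarrow> _) set)" for i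
    using res_diff_hom[of "n + i"] by simp
  show "bd (Suc i) (bext (c (Suc i)) x) = bext (c i) (bd (n + Suc i) x)"
    if x: "x \<in> res_mod Q N (n + Suc i)" for i x
  proof (rule res_hom_eqI[OF res_hom_comp[OF res_diff_hom hom] res_hom_comp[OF hom d] x])
    fix \<pi> assume \<pi>: "\<pi> \<in> qpaths Q (res_len N (n + Suc i))"
    have "gen \<pi> = (cut \<pi> 0 (res_len N (n + Suc i)) (E \<pi> (res_len N (n + Suc i)) (res_len N (n + Suc i))) :: ('v, 'a, 'k) bimod)"
      using gen_seg[of 0 "res_len N (n + Suc i)" \<pi>] qpaths_plen[OF \<pi>] seg_self[OF \<pi>, symmetric] by (simp del: seg_simps(2))
    then show "bd (Suc i) (bext (c (Suc i)) (gen \<pi>)) = bext (c i) (bd (n + Suc i) (gen \<pi>))"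
      using chain[OF \<pi> refl] by simp
  qed
qed


text \<open>
  In both parities the two sides of the chain map identity agree term by term after sliding \<open>g\<close> over
  the arrows that the right factor has absorbed.
\<close>

lemma right_lift_even_cocycle:
  fixes g :: "('v, 'a, 'k::field) cochain"
  assumes g: "g \<in> cocycles Q N (2 * l)"
  shows "cocycle_lift Q N (2 * l) g (\<lambda>i. bext (right_lift g i))"
proof (rule lift_by_generators)
  note gc = cocycles_cochains[OF g]
  show "right_lift g i \<pi> \<in> corner i (psrc \<pi>) (ptgt Q \<pi>)" if "\<pi> \<in> qpaths Q (res_len N (2 * l + i))" for i \<pi>
    by (rule right_lift_corner[OF gc that]) (simp add: res_len_def mod_add_eq)
  show "res_aug Q N (bext (right_lift g 0) x) = hom_of Q N g x" if "x \<in> res_mod Q N (2 * l)" for x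
    by (rule right_lift_aug[OF gc that])
  fix i L and w :: "('v, 'a) qpath"
  assume w: "w \<in> qpaths Q L" and L: "L = res_len N (2 * l + Suc i)"
  note lw = qpaths_plen[OF w]
  show "bd (Suc i) (bext (right_lift g (Suc i)) (cut w 0 L (E w L L))) =
      bext (right_lift g i) (bd (2 * l + Suc i) (cut w 0 L (E w L L)))"
  proof (cases i rule: parity_cases)
    case (1 k)
    have n: "2 * l + Suc i = 2 * (k + l) + 1" "Suc i = 2 * k + 1" using 1 by simp_all
    have L': "L = k * N + l * N + 1" unfolding L n(1) res_len_simps(2) by (simp add: add_mult_distrib)
    have s1: "bext (right_lift g (2 * k + 1)) (cut w 0 L (E w L L)) =
        cut w 0 (k * N + 1) (val g w (k * N + 1) L)"
      using L' lw by (subst bext_right_lift[OF gc w]) (simp_all add: res_len_simps coch_seg_E[OF gc] del: seg_simps(2))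
    have s2: "bd (2 * k + 1) (cut w 0 (k * N + 1) (val g w (k * N + 1) L)) = cut w 1 (k * N + 1) (val g w (k * N + 1) L) -
        cut w 0 (k * N) (E w (k * N) (k * N + 1) \<star> val g w (k * N + 1) L)"
      using L' lw by (subst res_diff_odd) (simp_all add: E_mult)
    have s3: "cut w 0 (k * N) (E w (k * N) (k * N + 1) \<star> val g w (k * N + 1) L) =
        cut w 0 (k * N) (val g w (k * N) (k * N + l * N) \<star> E w (k * N + l * N) L)"
      using even_cocycle_slide[OF g w, of "k * N" "k * N + 1"] L' by (intro ten_trunc_cong(2)) simp
    have lhs: "bd (2 * k + 1) (bext (right_lift g (2 * k + 1)) (cut w 0 L (E w L L))) =
        cut w 1 (k * N + 1) (val g w (k * N + 1) L) -
        cut w 0 (k * N) (val g w (k * N) (k * N + l * N) \<star> E w (k * N + l * N) L)"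
      unfolding s1 s2 s3 by (rule refl)
    have rhs1: "bd (2 * (k + l) + 1) (cut w 0 L (E w L L)) =
        cut w 1 L (E w L L) - cut w 0 (k * N + l * N) (E w (k * N + l * N) L)"
      using L' lw by (subst res_diff_odd) (simp_all add: E_mult add_mult_distrib add.commute)
    have rhs2: "bext (right_lift g (2 * k)) (cut w 1 L (E w L L) - cut w 0 (k * N + l * N) (E w (k * N + l * N) L)) = cut w 1 (k * N + 1) (val g w (k * N + 1) L) -
        cut w 0 (k * N) (val g w (k * N) (k * N + l * N) \<star> E w (k * N + l * N) L)"
      using L' lw bext_right_lift[OF gc w, of 1 "2 * k" L "E w 0 1" "E w L L"]
        bext_right_lift[OF gc w, of 0 "2 * k" "k * N + l * N" "E w 0 0" "E w (k * N + l * N) L"]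
      unfolding bext_rules by (simp add: res_len_simps coch_seg_E[OF gc] del: seg_simps(2))
    show ?thesis unfolding n(1) unfolding n(2) lhs unfolding 1 rhs1 rhs2 by (rule refl)
  next
    case (2 k)
    have n: "2 * l + Suc i = 2 * (k + l) + 2" "Suc i = 2 * k + 2" using 2 by simp_all
    have L': "L = (k * N + N) + l * N" unfolding L n(1) res_len_simps(4) by (simp add: add_mult_distrib)
    have s1: "bext (right_lift g (2 * k + 2)) (cut w 0 L (E w L L)) =
        cut w 0 (k * N + N) (val g w (k * N + N) L)"
      using L' lw res_len_simps(4)[of N k] by (subst bext_right_lift[OF gc w]) (simp_all add: coch_seg_E[OF gc] del: seg_simps(2))
    have s2: "bd (2 * k + 2) (cut w 0 (k * N + N) (val g w (k * N + N) L)) =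
        (\<Sum>j<N. cut w j (j + k * N + 1) (E w (j + k * N + 1) (k * N + N) \<star> val g w (k * N + N) L))"
      using L' lw by (subst res_diff_even) (simp_all add: E_mult)
    have s3: "((\<Sum>j<N. cut w j (j + k * N + 1) (E w (j + k * N + 1) (k * N + N) \<star> val g w (k * N + N) L))) = (\<Sum>j<N. cut w j (j + k * N + 1)
        (val g w (j + k * N + 1) (j + k * N + 1 + l * N) \<star> E w (j + k * N + 1 + l * N) L))"
      using L' even_cocycle_slide[OF g w, of _ "k * N + N"] by (intro sum.cong ten_trunc_cong(2)) simp_all
    have lhs: "bd (2 * k + 2) (bext (right_lift g (2 * k + 2)) (cut w 0 L (E w L L))) =
      (\<Sum>j<N. cut w j (j + k * N + 1)
        (val g w (j + k * N + 1) (j + k * N + 1 + l * N) \<star> E w (j + k * N + 1 + l * N) L))"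
      unfolding s1 s2 s3 by (rule refl)
    have rhs1: "bd (2 * (k + l) + 2) (cut w 0 L (E w L L)) =
        (\<Sum>j<N. cut w j (j + k * N + 1 + l * N) (E w (j + k * N + 1 + l * N) L))"
      using L' lw by (subst res_diff_even) (auto simp: E_mult add_mult_distrib add_ac intro!: sum.cong)
    have rhs2: "bext (right_lift g (2 * k + 1)) (\<Sum>j<N. cut w j (j + k * N + 1 + l * N) (E w (j + k * N + 1 + l * N) L)) = (\<Sum>j<N. cut w j (j + k * N + 1)
        (val g w (j + k * N + 1) (j + k * N + 1 + l * N) \<star> E w (j + k * N + 1 + l * N) L))"
      unfolding bext_rules
    proof (rule sum.cong)
      fix j assume "j \<in> {..<N}"
      then show "bext (right_lift g (2 * k + 1)) (cut w j (j + k * N + 1 + l * N) (E w (j + k * N + 1 + l * N) L)) =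
        cut w j (j + k * N + 1)
        (val g w (j + k * N + 1) (j + k * N + 1 + l * N) \<star> E w (j + k * N + 1 + l * N) L)"
        using L' by (subst bext_right_lift[OF gc w]) (simp_all add: res_len_simps add.assoc del: seg_simps(2))
    qed simp
    show ?thesis unfolding n(1) unfolding n(2) lhs unfolding 2 rhs1 rhs2 by (rule refl)
  qed
qed

text \<open>As before, now sliding \<open>g\<close> over the arrows of the left factor.\<close>

lemma left_lift_even_cocycle:
  fixes g :: "('v, 'a, 'k::field) cochain"
  assumes g: "g \<in> cocycles Q N (2 * l)"
  shows "cocycle_lift Q N (2 * l) g (\<lambda>i. bext (left_lift g i))"
proof (rule lift_by_generators)
  note gc = cocycles_cochains[OF g]
  show "left_lift g i \<pi> \<in> corner i (psrc \<pi>) (ptgt Q \<pi>)" if "\<pi> \<in> qpaths Q (res_len N (2 * l + i))" for i \<pi>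
    by (rule left_lift_corner[OF gc that]) (simp add: res_len_def mod_add_eq)
  show "res_aug Q N (bext (left_lift g 0) x) = hom_of Q N g x" if "x \<in> res_mod Q N (2 * l)" for x
    by (rule left_lift_aug[OF gc that])
  fix i L and w :: "('v, 'a) qpath"
  assume w: "w \<in> qpaths Q L" and L: "L = res_len N (2 * l + Suc i)"
  note lw = qpaths_plen[OF w]
  show "bd (Suc i) (bext (left_lift g (Suc i)) (cut w 0 L (E w L L))) =
      bext (left_lift g i) (bd (2 * l + Suc i) (cut w 0 L (E w L L)))"
  proof (cases i rule: parity_cases)
    case (1 k)
    have n: "2 * l + Suc i = 2 * (k + l) + 1" "Suc i = 2 * k + 1" using 1 by simp_all
    have L': "L = l * N + k * N + 1" unfolding L n(1) res_len_simps(2) by (simp add: add_mult_distrib)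
    have s1: "bext (left_lift g (2 * k + 1)) (cut w 0 L (E w L L)) =
        ten (val g w 0 (l * N)) (seg Q w (l * N) L) (E w L L)"
      using L' lw by (subst bext_left_lift[OF gc w, where c = "l * N"]) (simp_all add: res_len_simps coch_seg_E[OF gc] del: seg_simps(2))
    have s2: "bd (2 * k + 1) (ten (val g w 0 (l * N)) (seg Q w (l * N) L) (E w L L)) = ten (val g w 0 (l * N) \<star> E w (l * N) (l * N + 1)) (seg Q w (l * N + 1) L) (E w L L) -
        ten (val g w 0 (l * N)) (seg Q w (l * N) (l * N + k * N)) (E w (l * N + k * N) L)"
      using L' lw by (subst res_diff_odd) (simp_all add: E_mult)
    have s3: "ten (val g w 0 (l * N) \<star> E w (l * N) (l * N + 1)) (seg Q w (l * N + 1) L) (E w L L) =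
        ten (E w 0 1 \<star> val g w 1 (l * N + 1)) (seg Q w (l * N + 1) L) (E w L L)"
      using even_cocycle_slide[OF g w, of 0 1] L' by (intro ten_trunc_cong(1)) (simp add: add.commute)
    have lhs: "bd (2 * k + 1) (bext (left_lift g (2 * k + 1)) (cut w 0 L (E w L L))) =
        ten (E w 0 1 \<star> val g w 1 (l * N + 1)) (seg Q w (l * N + 1) L) (E w L L) -
        ten (val g w 0 (l * N)) (seg Q w (l * N) (l * N + k * N)) (E w (l * N + k * N) L)"
      unfolding s1 s2 s3 by (rule refl)
    have rhs1: "bd (2 * (k + l) + 1) (cut w 0 L (E w L L)) =
        cut w 1 L (E w L L) - cut w 0 (l * N + k * N) (E w (l * N + k * N) L)"
      using L' lw by (subst res_diff_odd) (simp_all add: E_mult add_mult_distrib add.commute)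
    have rhs2: "bext (left_lift g (2 * k)) (cut w 1 L (E w L L) - cut w 0 (l * N + k * N) (E w (l * N + k * N) L)) = ten (E w 0 1 \<star> val g w 1 (l * N + 1)) (seg Q w (l * N + 1) L) (E w L L) -
        ten (val g w 0 (l * N)) (seg Q w (l * N) (l * N + k * N)) (E w (l * N + k * N) L)"
      using L' lw bext_left_lift[OF gc w, of L "l * N + 1" "2 * k" 1 "E w 0 1" "E w L L"]
        bext_left_lift[OF gc w, of "l * N + k * N" "l * N" "2 * k" 0 "E w 0 0" "E w (l * N + k * N) L"]
      unfolding bext_rules by (simp add: res_len_simps coch_seg_E[OF gc] del: seg_simps(2))
    show ?thesis unfolding n(1) unfolding n(2) lhs unfolding 1 rhs1 rhs2 by (rule refl)
  next
    case (2 k)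
    have n: "2 * l + Suc i = 2 * (k + l) + 2" "Suc i = 2 * k + 2" using 2 by simp_all
    have L': "L = l * N + (k * N + N)" unfolding L n(1) res_len_simps(4) by (simp add: add_mult_distrib)
    have s1: "bext (left_lift g (2 * k + 2)) (cut w 0 L (E w L L)) =
        ten (val g w 0 (l * N)) (seg Q w (l * N) L) (E w L L)"
      using L' lw res_len_simps(4)[of N k]
      by (subst bext_left_lift[OF gc w, where c = "l * N"]) (simp_all add: coch_seg_E[OF gc] del: seg_simps(2))
    have s2: "bd (2 * k + 2) (ten (val g w 0 (l * N)) (seg Q w (l * N) L) (E w L L)) =
        (\<Sum>j<N. ten (val g w 0 (l * N) \<star> E w (l * N) (j + l * N)) (seg Q w (j + l * N) (j + l * N + k * N + 1)) (E w (j + l * N + k * N + 1) L))"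
      using L' lw by (subst res_diff_even[where k = k]) (auto simp add: E_mult add_ac intro!: sum.cong)
    have s3: "((\<Sum>j<N. ten (val g w 0 (l * N) \<star> E w (l * N) (j + l * N)) (seg Q w (j + l * N) (j + l * N + k * N + 1)) (E w (j + l * N + k * N + 1) L))) = (\<Sum>j<N. ten (E w 0 j \<star> val g w j (j + l * N)) (seg Q w (j + l * N) (j + l * N + k * N + 1)) (E w (j + l * N + k * N + 1) L))"
      using L' even_cocycle_slide[OF g w, of 0] by (intro sum.cong ten_trunc_cong(1)) simp_all
    have lhs: "bd (2 * k + 2) (bext (left_lift g (2 * k + 2)) (cut w 0 L (E w L L))) =
      (\<Sum>j<N. ten (E w 0 j \<star> val g w j (j + l * N)) (seg Q w (j + l * N) (j + l * N + k * N + 1)) (E w (j + l * N + k * N + 1) L))"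
      unfolding s1 s2 s3 by (rule refl)
    have rhs1: "bd (2 * (k + l) + 2) (cut w 0 L (E w L L)) =
        (\<Sum>j<N. cut w j (j + l * N + k * N + 1) (E w (j + l * N + k * N + 1) L))"
      using L' lw by (subst res_diff_even) (auto simp: E_mult add_mult_distrib add_ac intro!: sum.cong)
    have rhs2: "bext (left_lift g (2 * k + 1)) (\<Sum>j<N. cut w j (j + l * N + k * N + 1) (E w (j + l * N + k * N + 1) L)) =
      (\<Sum>j<N. ten (E w 0 j \<star> val g w j (j + l * N)) (seg Q w (j + l * N) (j + l * N + k * N + 1)) (E w (j + l * N + k * N + 1) L))"
      unfolding bext_rules
    proof (rule sum.cong)
      fix j assume "j \<in> {..<N}"
      then show "bext (left_lift g (2 * k + 1)) (cut w j (j + l * N + k * N + 1) (E w (j + l * N + k * N + 1) L)) =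
        ten (E w 0 j \<star> val g w j (j + l * N)) (seg Q w (j + l * N) (j + l * N + k * N + 1)) (E w (j + l * N + k * N + 1) L)"
        using L' by (intro bext_left_lift[OF gc w]) (simp_all add: res_len_simps)
    qed simp
    show ?thesis unfolding n(1) unfolding n(2) lhs unfolding 2 rhs1 rhs2 by (rule refl)
  qed
qed

text \<open>
  From degree \<open>2k\<close> to \<open>2k + 1\<close> the sum over \<open>p\<close> telescopes; its upper ends give the right side and its lower
  ends add up to a cocycle sum, which vanishes. From \<open>2k + 1\<close> to \<open>2k + 2\<close> the two terms of the differential
  shift both indices of the double sum by one, so that it telescopes in \<open>j\<close>, again up to a cocycle sum.
\<close>

lemma lift_odd_cocycle:
  fixes g :: "('v, 'a, 'k::field) cochain"
  assumes g: "g \<in> cocycles Q N (2 * l + 1)"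
  shows "cocycle_lift Q N (2 * l + 1) g (\<lambda>i. bext (if even i then right_lift g i else odd_lift l g (i div 2)))"
proof (rule lift_by_generators)
  note gc = cocycles_cochains[OF g]
  show "(if even i then right_lift g i else odd_lift l g (i div 2)) \<pi> \<in> corner i (psrc \<pi>) (ptgt Q \<pi>)"
    if \<pi>: "\<pi> \<in> qpaths Q (res_len N (2 * l + 1 + i))" for i \<pi>
  proof (cases i rule: parity_cases)
    case (1 k)
    have "2 * l + 1 + i = 2 * (l + k) + 1" using 1 by simp
    from \<pi>[unfolded this res_len_simps] show ?thesis
      using right_lift_corner[OF gc, of \<pi> _ i] 1 by (simp add: res_len_simps add_mult_distrib)
  next
    case (2 k)
    have n: "2 * l + 1 + i = 2 * (l + k) + 2" using 2 by simp
    have "odd_lift l g k \<pi> \<in> corner (2 * k + 1) (psrc \<pi>) (ptgt Q \<pi>)"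
      by (rule odd_lift_corner[OF gc \<pi>]) (unfold n res_len_simps(4), simp add: add_mult_distrib)
    then show ?thesis using 2 by simp
  qed
  show "res_aug Q N (bext (if even 0 then right_lift g 0 else odd_lift l g (0 div 2)) x) = hom_of Q N g x"
    if "x \<in> res_mod Q N (2 * l + 1)" for x
    using right_lift_aug[OF gc that] by simp
  fix i L and w :: "('v, 'a) qpath"
  assume w: "w \<in> qpaths Q L" and L: "L = res_len N (2 * l + 1 + Suc i)"
  note lw = qpaths_plen[OF w]
  show "bd (Suc i) (bext (if even (Suc i) then right_lift g (Suc i) else odd_lift l g (Suc i div 2))
        (cut w 0 L (E w L L))) =
      bext (if even i then right_lift g i else odd_lift l g (i div 2))
        (bd (2 * l + 1 + Suc i) (cut w 0 L (E w L L)))"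
  proof (cases i rule: parity_cases)
    case (1 k)
    have n: "2 * l + 1 + Suc i = 2 * (k + l) + 2" "Suc i = 2 * k + 1" using 1 by simp_all
    have L': "L = k * N + l * N + N" unfolding L n(1) res_len_simps(4) by (simp add: add_mult_distrib)
    define T where "T j p = cut w p (p + k * N)
       (E w (p + k * N) (j + k * N) \<star> (val g w (j + k * N) (j + k * N + l * N + 1) \<star> E w (j + k * N + l * N + 1) L))" for j p
    have s1: "bext (odd_lift l g k) (cut w 0 L (E w L L)) =
      (\<Sum>j<N. \<Sum>p<j. cut w p (p + k * N + 1)
       (E w (p + k * N + 1) (j + k * N) \<star> (val g w (j + k * N) (j + k * N + l * N + 1) \<star> E w (j + k * N + l * N + 1) L)))"
      using L' lw by (subst bext_odd_lift[OF gc w]) (auto simp: E_mult intro!: sum.cong)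
    have s2: "bd (2 * k + 1) (cut w p (p + k * N + 1)
       (E w (p + k * N + 1) (j + k * N) \<star> (val g w (j + k * N) (j + k * N + l * N + 1) \<star> E w (j + k * N + l * N + 1) L))) =
       T j (Suc p) - T j p" if "p < j" "j < N" for p j
      using L' lw that by (subst res_diff_odd) (simp_all add: E_mult T_def)
    have "(\<Sum>j<N. T j 0) = cut w 0 (k * N) (\<Sum>j<N. E w (k * N) (k * N + j) \<star>
        (val g w (k * N + j) (k * N + j + l * N + 1) \<star> E w (k * N + j + l * N + 1) L))"
      unfolding ten_rules T_def by (intro sum.cong) (simp_all add: add.commute)
    also have "\<dots> = cut w 0 (k * N) 0"
      using odd_cocycle_sum[OF g w, of L "k * N"] L' by (intro ten_trunc_cong(2)) (simp add: trunc_eqs)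
    finally have z: "(\<Sum>j<N. T j 0) = 0" by (simp add: ten_rules)
    have lhs: "bd (2 * k + 1) (bext (odd_lift l g k) (cut w 0 L (E w L L))) = (\<Sum>j<N. T j j)"
    proof -
      have "bd (2 * k + 1) (bext (odd_lift l g k) (cut w 0 L (E w L L))) =
          (\<Sum>j<N. \<Sum>p<j. T j (Suc p) - T j p)"
        unfolding s1 res_diff_rules using s2 by (intro sum.cong) auto
      then show ?thesis using z by (simp only: sum_lessThan_telescope) (simp add: sum_subtractf)
    qed
    have rhs1: "bd (2 * (k + l) + 2) (cut w 0 L (E w L L)) =
        (\<Sum>j<N. cut w j (j + k * N + l * N + 1) (E w (j + k * N + l * N + 1) L))"
      using L' lw by (subst res_diff_even) (auto simp: E_mult add_mult_distrib add_ac intro!: sum.cong)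
    have rhs2: "bext (right_lift g (2 * k)) (\<Sum>j<N. cut w j (j + k * N + l * N + 1) (E w (j + k * N + l * N + 1) L)) =
        (\<Sum>j<N. T j j)"
      unfolding bext_rules
    proof (rule sum.cong)
      fix j assume "j \<in> {..<N}"
      then show "bext (right_lift g (2 * k)) (cut w j (j + k * N + l * N + 1) (E w (j + k * N + l * N + 1) L)) = T j j"
        using L' lw by (subst bext_right_lift[OF gc w]) (simp_all add: T_def res_len_simps coch_seg_E[OF gc] add.assoc del: seg_simps(2))
    qed simp
    have p: "even i" "odd (Suc i)" "Suc i div 2 = k" using 1 by simp_all
    show ?thesis unfolding n(1) using p by (simp only: n(2) if_True if_False not_True_eq_False) (simp only: lhs 1 rhs1 rhs2)
  next
    case (2 k)
    have n: "2 * l + 1 + Suc i = 2 * (k + 1 + l) + 1" "Suc i = 2 * k + 2" using 2 by simp_all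
    have L': "L = k * N + N + l * N + 1" unfolding L n(1) res_len_simps(2) by (simp add: add_mult_distrib)
    define T where "T p j = cut w p (p + k * N + 1)
       (E w (p + k * N + 1) (j + k * N) \<star> (val g w (j + k * N) (j + k * N + l * N + 1) \<star> E w (j + k * N + l * N + 1) L))" for p j
    have s1: "bext (right_lift g (2 * k + 2)) (cut w 0 L (E w L L)) =
        cut w 0 (k * N + N) (val g w (k * N + N) L)"
      using L' lw res_len_simps(4)[of N k] by (subst bext_right_lift[OF gc w]) (simp_all add: coch_seg_E[OF gc] del: seg_simps(2))
    have s2: "bd (2 * k + 2) (cut w 0 (k * N + N) (val g w (k * N + N) L)) =
        (\<Sum>p<N. T p N)"
      using L' lw coch_seg_E(3)[OF gc, of "k * N + N" L w]
      by (subst res_diff_even) (simp_all add: E_mult T_def add.commute[of N] del: seg_simps(2))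
    have lhs: "bd (2 * k + 2) (bext (right_lift g (2 * k + 2)) (cut w 0 L (E w L L))) = (\<Sum>p<N. T p N)"
      unfolding s1 s2 by (rule refl)
    have rhs1: "bd (2 * (k + 1 + l) + 1) (cut w 0 L (E w L L)) =
        cut w 1 L (E w L L) - cut w 0 (k * N + N + l * N) (E w (k * N + N + l * N) L)"
      using L' lw by (subst res_diff_odd) (simp_all add: E_mult add_mult_distrib add_ac)
    have b1: "bext (odd_lift l g k) (cut w 1 L (E w L L)) = (\<Sum>j<N. \<Sum>p<j. T (Suc p) (Suc j))"
      using L' lw by (subst bext_odd_lift[OF gc w]) (auto simp: E_mult T_def intro!: sum.cong)
    have b2: "bext (odd_lift l g k) (cut w 0 (k * N + N + l * N) (E w (k * N + N + l * N) L)) = (\<Sum>j<N. \<Sum>p<j. T p j)"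
      using L' lw by (subst bext_odd_lift[OF gc w]) (auto simp: E_mult T_def intro!: sum.cong)
    have "(\<Sum>j<N. T 0 (Suc j)) = cut w 0 (k * N + 1) (\<Sum>j<N. E w (k * N + 1) (k * N + 1 + j) \<star>
        (val g w (k * N + 1 + j) (k * N + 1 + j + l * N + 1) \<star> E w (k * N + 1 + j + l * N + 1) L))"
      unfolding ten_rules T_def by (intro sum.cong) (simp_all add: add.commute)
    also have "\<dots> = cut w 0 (k * N + 1) 0"
      using odd_cocycle_sum[OF g w, of L "k * N + 1"] L' by (intro ten_trunc_cong(2)) (simp add: trunc_eqs)
    finally have z: "(\<Sum>j<N. T 0 (Suc j)) = 0" by (simp add: ten_rules)
    have "(\<Sum>p<j. T (Suc p) (Suc j)) = (\<Sum>p<Suc j. T p (Suc j)) - T 0 (Suc j)" for j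
      by (simp only: sum.lessThan_Suc_shift) simp
    then have "(\<Sum>j<N. \<Sum>p<j. T (Suc p) (Suc j)) - (\<Sum>j<N. \<Sum>p<j. T p j) =
       (\<Sum>j<N. (\<Sum>p<Suc j. T p (Suc j)) - (\<Sum>p<j. T p j)) - (\<Sum>j<N. T 0 (Suc j))"
      by (simp add: sum_subtractf)
    also have "\<dots> = (\<Sum>p<N. T p N)"
      unfolding sum_lessThan_telescope[of "\<lambda>j. \<Sum>p<j. T p j"] z by simp
    finally have rhs2: "(\<Sum>j<N. \<Sum>p<j. T (Suc p) (Suc j)) - (\<Sum>j<N. \<Sum>p<j. T p j) = (\<Sum>p<N. T p N)" .
    have p: "odd i" "even (Suc i)" "i div 2 = k" using 2 by simp_all
    show ?thesis unfolding n(1) using p by (simp only: n(2) if_True if_False not_True_eq_False) (simp only: lhs rhs1 bext_rules b1 b2 rhs2)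
  qed
qed

section \<open>The product of parallel paths\<close>

lemmas vee_rules = bilin_ext_rules[where F = "\<lambda>(\<alpha>, \<pi>) (\<beta>, \<tau>).
     if (even m \<or> even n) \<and> ptgt Q \<alpha> = psrc \<beta> \<and> ptgt Q \<pi> = psrc \<tau> \<and> plen (pcat \<alpha> \<beta>) < N
     then single (pcat \<alpha> \<beta>, pcat \<pi> \<tau>) 1 else 0" for m n :: nat, folded vee_def]

lemma vee_single:
  "vee Q N m n (single (\<alpha>, \<pi>) c) (single (\<beta>, \<tau>) d) =
    (if (even m \<or> even n) \<and> ptgt Q \<alpha> = psrc \<beta> \<and> ptgt Q \<pi> = psrc \<tau> \<and> plen \<alpha> + plen \<beta> < N
     then single (pcat \<alpha> \<beta>, pcat \<pi> \<tau>) (c * d) else (0 :: ('v, 'a, 'k::field) cochain))"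
  by (auto simp: vee_def path_simps scal_simps)

lemma vee_odd: "odd m \<Longrightarrow> odd n \<Longrightarrow> vee Q N m n f g = (0 :: ('v, 'a, 'k::field) cochain)"
  by (simp add: vee_def bilin_ext_def split_def)

lemma res_len_add: "even m \<or> even n \<Longrightarrow> res_len N (m + n) = res_len N m + res_len N n"
proof -
  assume "even m \<or> even n"
  then have "(m + n) div 2 = m div 2 + n div 2" "(m + n) mod 2 = m mod 2 + n mod 2" by presburger+
  then show ?thesis by (simp add: res_len_def add_mult_distrib)
qed

lemma vee_cochains_bi:
  fixes f g :: "('v, 'a, 'k::field) cochain"
  assumes "f \<in> cochains_bi Q N m i" "g \<in> cochains_bi Q N n j"
  shows "vee Q N m n f g \<in> cochains_bi Q N (m + n) (i + j)"
  using assms unfolding cochains_bi_def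
proof (induction rule: bilin_free_on_induct)
  case (single x c y d)
  obtain \<alpha> \<pi> \<beta> \<tau> where xy: "x = (\<alpha>, \<pi>)" "y = (\<beta>, \<tau>)" by (cases x, cases y) auto
  show ?case
  proof (cases "(even m \<or> even n) \<and> ptgt Q \<alpha> = psrc \<beta> \<and> ptgt Q \<pi> = psrc \<tau> \<and> plen \<alpha> + plen \<beta> < N")
    case True
    have "\<alpha> \<in> qpaths Q i" "\<beta> \<in> qpaths Q j" "\<pi> \<in> qpaths Q (res_len N m)" "\<tau> \<in> qpaths Q (res_len N n)"
      using single xy by (auto simp: coch_basis_def)
    then have "pcat \<alpha> \<beta> \<in> qpaths Q (i + j)" "pcat \<pi> \<tau> \<in> qpaths Q (res_len N (m + n))" "i + j < N"
      using qpaths_pcat[OF fin_digraph_axioms] True res_len_add[of m n] by (auto dest!: qpaths_plen)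
    then have "(pcat \<alpha> \<beta>, pcat \<pi> \<tau>) \<in> coch_basis Q N (m + n) (i + j)"
      using single xy True by (auto simp: coch_basis_def path_simps ptgt_pcat)
    then show ?thesis using True by (simp add: xy vee_single free_on_simps)
  next
    case False
    then show ?thesis by (simp only: xy vee_single if_False free_on_simps)
  qed
qed (auto simp: vee_rules free_on_simps)

lemma cochains_bi_sub: "cochains_bi Q N n i \<subseteq> (cochains Q N n :: ('v, 'a, 'k::field) cochain set)"
proof (cases "i < N")
  case True
  then show ?thesis unfolding cochains_bi_def cochains_def by (intro free_on_mono) auto
next
  case False
  then have "coch_basis Q N n i = {}" by (auto simp: coch_basis_def)
  then show ?thesis unfolding cochains_bi_def cochains_def by (intro free_on_mono) auto
qed

lemma vee_cochains:
  fixes f g :: "('v, 'a, 'k::field) cochain"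
  assumes "f \<in> cochains Q N m" "g \<in> cochains Q N n"
  shows "vee Q N m n f g \<in> cochains Q N (m + n)"
  using assms unfolding cochains_def[of _ _ m] cochains_def[of _ _ n]
proof (induction rule: bilin_free_on_induct)
  case (single x c y d)
  then obtain i j where "x \<in> coch_basis Q N m i" "y \<in> coch_basis Q N n j" by blast
  then have "single x c \<in> cochains_bi Q N m i" "single y d \<in> cochains_bi Q N n j"
    by (simp_all add: cochains_bi_def free_on_simps)
  from vee_cochains_bi[OF this] show ?case using cochains_bi_sub by blast
qed (auto simp: vee_rules cochains_0 cochains_add)

lemma coch_val_single: "coch_val (single (\<alpha>, \<pi>) c) \<pi>' = (if \<pi>' = \<pi> then single \<alpha> c else 0 :: ('v, 'a, 'k::field) palg)"
  by (simp add: coch_val_def scal_simps)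

text \<open>
  A path of length \<open>a + b\<close> has just one factorisation into paths of lengths \<open>a\<close> and \<open>b\<close>.
\<close>

lemma coch_val_vee:
  fixes f g :: "('v, 'a, 'k::field) cochain"
  assumes "f \<in> cochains Q N m" "g \<in> cochains Q N n" and ev: "even m \<or> even n"
    and \<rho>: "\<rho> \<in> qpaths Q (res_len N m + res_len N n)"
  shows "coch_val (vee Q N m n f g) \<rho> = trunc N (val f \<rho> 0 (res_len N m) \<star>
    val g \<rho> (res_len N m) (res_len N m + res_len N n))"
  using assms(1,2) unfolding cochains_def
proof (induction rule: bilin_free_on_induct)
  case (single x c y d)
  obtain \<alpha> \<pi> \<beta> \<tau> where xy: "x = (\<alpha>, \<pi>)" "y = (\<beta>, \<tau>)" by (cases x, cases y) auto
  have b: "\<pi> \<in> qpaths Q (res_len N m)" "\<tau> \<in> qpaths Q (res_len N n)" "ptgt Q \<alpha> = ptgt Q \<pi>" "psrc \<beta> = psrc \<tau>"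
    using single xy by (auto simp: coch_basis_def)
  let ?s = "seg Q \<rho> 0 (res_len N m)" and ?t = "seg Q \<rho> (res_len N m) (res_len N m + res_len N n)"
  have st: "pcat ?s ?t = \<rho>"
    using seg_full[of Q \<rho>] qpaths_plen[OF \<rho>] by (simp add: pcat_seg)
  have "ptgt Q ?s = psrc ?t" using qpaths_plen[OF \<rho>] by (simp add: ptgt_seg seg_simps(1))
  then have "\<rho> = pcat \<pi> \<tau> \<and> ptgt Q \<pi> = psrc \<tau> \<longleftrightarrow> ?s = \<pi> \<and> ?t = \<tau>"
    using seg_pcat[of Q \<pi> \<tau>] qpaths_plen[OF b(1)] qpaths_plen[OF b(2)] st by metis
  then show ?case
    using ev b by (auto simp: xy vee_single coch_val_single coch_val_rules kmul_simps trunc_eqs path_simps kmul_rules)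
qed (auto simp: vee_rules coch_val_rules kmul_rules trunc_eqs)

lemma right_lift_product:
  fixes f g :: "('v, 'a, 'k::field) cochain"
  assumes f: "f \<in> cochains Q N m" and g: "g \<in> cochains Q N n" and ev: "even m \<or> even n"
    and hom: "hom_of Q N f \<circ> bext (right_lift g m) \<in> alg_hom (m + n)"
  shows "coch_of Q N (m + n) (hom_of Q N f \<circ> bext (right_lift g m)) = vee Q N m n f g"
  unfolding coch_of_eq_iff[OF hom vee_cochains[OF f g]]
proof
  fix \<rho> assume "\<rho> \<in> qpaths Q (res_len N (m + n))"
  then have \<rho>: "\<rho> \<in> qpaths Q (res_len N m + res_len N n)" using res_len_add[OF ev] by simp
  note l = qpaths_plen[OF \<rho>]
  have "bext (right_lift g m) (gen \<rho>) = right_lift g m \<rho>"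
    by (rule bext_gen[where c = "right_lift g m", OF right_lift_corner[OF g \<rho>]]) simp
  then show "(hom_of Q N f \<circ> bext (right_lift g m)) (gen \<rho>) = coch_val (vee Q N m n f g) \<rho>"
    using l by (simp add: right_lift_def hom_of_ten[OF f] coch_seg_E[OF f] coch_val_vee[OF f g ev \<rho>] del: seg_simps(2))
qed

lemma left_lift_product:
  fixes f g :: "('v, 'a, 'k::field) cochain"
  assumes f: "f \<in> cochains Q N m" and g: "g \<in> cochains Q N n" and ev: "even m \<or> even n"
    and hom: "hom_of Q N f \<circ> bext (left_lift g m) \<in> alg_hom (m + n)"
  shows "coch_of Q N (m + n) (hom_of Q N f \<circ> bext (left_lift g m)) = vee Q N n m g f"
  unfolding coch_of_eq_iff[OF hom vee_cochains[OF g f, unfolded add.commute[of n m]]]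
proof
  fix \<rho> assume "\<rho> \<in> qpaths Q (res_len N (m + n))"
  then have \<rho>: "\<rho> \<in> qpaths Q (res_len N n + res_len N m)" using res_len_add[OF ev] by (simp add: add.commute)
  have ev': "even n \<or> even m" using ev by blast
  note l = qpaths_plen[OF \<rho>]
  have "bext (left_lift g m) (gen \<rho>) = left_lift g m \<rho>"
    by (rule bext_gen[where c = "left_lift g m", OF left_lift_corner[OF g \<rho>]]) simp
  then show "(hom_of Q N f \<circ> bext (left_lift g m)) (gen \<rho>) = coch_val (vee Q N n m g f) \<rho>"
    using l by (simp add: left_lift_def Let_def hom_of_ten[OF f] coch_seg_E[OF f] coch_val_vee[OF g f ev' \<rho>] del: seg_simps(2))
qed

section \<open>Odd cocycles have no component in degree 0\<close>

text \<open>
  \<open>wind \<pi> r\<close> runs \<open>r\<close> times around the closed path \<open>\<pi>\<close>.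
\<close>

definition wind :: "('v, 'a) qpath \<Rightarrow> nat \<Rightarrow> ('v, 'a) qpath" where
  "wind \<pi> r = (psrc \<pi>, concat (replicate r (snd \<pi>)))"

lemma wind_Suc: "wind \<pi> (Suc r) = pcat \<pi> (wind \<pi> r)" "wind \<pi> (Suc r) = pcat (wind \<pi> r) \<pi>"
proof -
  have "concat (replicate (Suc r) (snd \<pi>)) = concat (replicate r (snd \<pi>)) @ snd \<pi>"
    by (induction r) simp_all
  then show "wind \<pi> (Suc r) = pcat \<pi> (wind \<pi> r)" "wind \<pi> (Suc r) = pcat (wind \<pi> r) \<pi>"
    by (simp_all add: wind_def pcat_def psrc_def)
qed

context
  fixes \<pi> :: "('v, 'a) qpath" and M :: nat
  assumes \<pi>: "\<pi> \<in> qpaths Q M" and closed: "psrc \<pi> = ptgt Q \<pi>"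
begin

lemma wind_qpaths: "wind \<pi> r \<in> qpaths Q (r * M)" "psrc (wind \<pi> r) = psrc \<pi>" "ptgt Q (wind \<pi> r) = psrc \<pi>"
proof -
  have "wind \<pi> r \<in> qpaths Q (r * M) \<and> psrc (wind \<pi> r) = psrc \<pi> \<and> ptgt Q (wind \<pi> r) = psrc \<pi>"
  proof (induction r)
    case 0
    then show ?case
      using vert_qpaths[OF fin_digraph_axioms vertex_verts(1)[OF \<pi>]] by (simp add: wind_def path_simps)
  next
    case (Suc r)
    then show ?case
      using qpaths_pcat[OF fin_digraph_axioms \<pi>, of "wind \<pi> r"] closed
      by (simp add: wind_Suc(1) path_simps ptgt_pcat)
  qed
  then show "wind \<pi> r \<in> qpaths Q (r * M)" "psrc (wind \<pi> r) = psrc \<pi>" "ptgt Q (wind \<pi> r) = psrc \<pi>" by auto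
qed

lemma wind_periodic:
  assumes "a \<le> b" "b + M \<le> r * M"
  shows "seg Q (wind \<pi> r) (a + M) (b + M) = seg Q (wind \<pi> r) a b"
proof (cases r)
  case 0
  then have "a = 0" "b = 0" "M = 0" using assms by auto
  then show ?thesis by simp
next
  case (Suc r')
  have len: "plen (wind \<pi> r) = r * M" "plen (wind \<pi> r') = r' * M" "plen \<pi> = M"
    using wind_qpaths(1) \<pi> by (auto dest: qpaths_plen)
  have b: "b \<le> r' * M" using assms Suc by simp
  have "seg Q (wind \<pi> r) M (M + r' * M) = wind \<pi> r'"
    using seg_pcat(2)[of Q \<pi> "wind \<pi> r'"] closed wind_qpaths(2) len Suc by (simp add: wind_Suc(1))
  then have "seg Q (wind \<pi> r) (M + a) (M + b) = seg Q (wind \<pi> r') a b"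
    using seg_seg[of a b M "M + r' * M" "wind \<pi> r" Q] assms b len Suc by simp
  also have "seg Q (wind \<pi> r) 0 (r' * M) = wind \<pi> r'"
    using seg_pcat(1)[of Q "wind \<pi> r'" \<pi>] wind_qpaths(3) len Suc by (simp add: wind_Suc(2))
  then have "seg Q (wind \<pi> r') a b = seg Q (wind \<pi> r) a b"
    using seg_seg[of a b 0 "r' * M" "wind \<pi> r" Q] assms b len Suc by simp
  finally show ?thesis by (simp add: add.commute)
qed

end

text \<open>
  Comparing lengths, only the vertex component of \<open>x\<close> contributes to the coefficient of \<open>pq\<close> in \<open>p x q\<close>.
\<close>

lemma lookup_sandwich:
  fixes x :: "('v, 'a, 'k::field) palg"
  assumes "ptgt Q p = v" "psrc q = v"
  shows "lookup (single p 1 \<star> (x \<star> single q 1)) (pcat p q) = lookup x (v, [])"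
  using free_on_all[of x]
proof (induction rule: free_on_induct)
  case (single s c)
  obtain u l where s: "s = (u, l)" by (cases s)
  have "pcat p (pcat s q) = pcat p q \<longleftrightarrow> l = []" by (auto simp: pcat_def s)
  then show ?case
    using assms by (auto simp: kmul_simps kmul_rules s path_simps lookup_single when_def)
qed (auto simp: kmul_rules lookup_add)

text \<open>
  The degree 0 component of \<open>f\<close> is a function \<open>c\<close> on closed paths of length \<open>M = k N + 1\<close>. Deleting any segment
  of length \<open>M\<close> from a word of period \<open>M\<close> and length \<open>M + N - 1\<close> leaves the same word, so the cocycle
  condition says that \<open>N\<close> consecutive rotations of a closed path have \<open>c\<close>-values with sum 0. Subtracting two
  such sums, \<open>c\<close> is unchanged by rotation through \<open>N\<close>, hence through \<open>k N\<close>; as rotation through \<open>M\<close> is the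
  identity, \<open>c\<close> is unchanged by rotation through 1. So \<open>N\<close> times the value is 0, and \<open>N\<close> is invertible.
\<close>

lemma odd_cocycle_degree_0:
  fixes f :: "('v, 'a, 'k::field_char_0) cochain"
  assumes f: "f \<in> cocycles Q N (2 * k + 1)" and len: "plen \<alpha> = 0"
  shows "lookup f (\<alpha>, \<pi>) = 0"
proof (rule ccontr)
  assume nz: "lookup f (\<alpha>, \<pi>) \<noteq> 0"
  define M where "M = k * N + 1"
  note fc = cocycles_cochains[OF f]
  have \<pi>: "\<pi> \<in> qpaths Q M" using cochains_keys(3)[OF fc nz] unfolding res_len_simps M_def .
  have "psrc \<alpha> = psrc \<pi>" by (rule cochains_keys(4)[OF fc nz])
  moreover have "ptgt Q \<alpha> = ptgt Q \<pi>" by (rule cochains_keys(5)[OF fc nz])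
  moreover have \<alpha>: "\<alpha> = (psrc \<alpha>, [])" using len by (simp add: plen_def psrc_def prod_eq_iff)
  ultimately have closed: "psrc \<pi> = ptgt Q \<pi>" by (metis path_simps(7))
  \<comment> \<open>Enough turns for all the rotations below to stay within the path.\<close>
  define R where "R = 2 * N + 3"
  define w where "w = wind \<pi> R"
  have w: "w \<in> qpaths Q (R * M)" unfolding w_def by (rule wind_qpaths(1)[OF \<pi> closed])
  have lw: "plen w = R * M" by (rule qpaths_plen[OF w])
  have per: "seg Q w (a + M) (b + M) = seg Q w a b" if "a \<le> b" "b + M \<le> R * M" for a b
    unfolding w_def by (rule wind_periodic[OF \<pi> closed that])
  define c where "c a = lookup (val f w a (a + M)) (vx Q w a, [])" for a
  have c_per: "c (a + M) = c a" if "a + M + M \<le> R * M" for a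
    using per[of a "a + M"] per[of a a] that by (simp add: c_def seg_simps(2))
  have c_sum: "(\<Sum>j<N. c (a + j)) = 0" if a: "a + M + N \<le> R * M" for a
  proof -
    define b where "b = a + k * N + N"
    have b: "b \<le> R * M" "b = a + N - 1 + M" using a N_pos by (simp_all add: b_def M_def)
    let ?q = "seg Q w a (a + N - 1)"
    have "lookup (trunc N (\<Sum>j<N. E w a (a + j) \<star> (val f w (a + j) (a + j + k * N + 1) \<star> E w (a + j + k * N + 1) b))) ?q = 0"
      using odd_cocycle_sum[OF f w b_def b(1)] by simp
    moreover have "plen ?q < N" using a lw N_pos by (simp add: seg_simps(3))
    ultimately have "(\<Sum>j<N. lookup (E w a (a + j) \<star> (val f w (a + j) (a + j + M) \<star> E w (a + j + M) b)) ?q) = 0"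
      by (simp add: lookup_trunc[OF fin_digraph_axioms] lookup_sum M_def add.assoc)
    also have "(\<Sum>j<N. lookup (E w a (a + j) \<star> (val f w (a + j) (a + j + M) \<star> E w (a + j + M) b)) ?q) =
       (\<Sum>j<N. c (a + j))"
    proof (rule sum.cong)
      fix j assume "j \<in> {..<N}"
      then have j: "j < N" by simp
      have "seg Q w (a + j + M) b = seg Q w (a + j) (a + N - 1)"
        unfolding b(2) by (rule per) (use j a N_pos in simp_all)
      moreover have "pcat (seg Q w a (a + j)) (seg Q w (a + j) (a + N - 1)) = ?q"
        using j by (simp add: pcat_seg)
      moreover have "ptgt Q (seg Q w a (a + j)) = vx Q w (a + j)" using j a lw by (simp add: ptgt_seg)
      ultimately show "lookup (E w a (a + j) \<star> (val f w (a + j) (a + j + M) \<star> E w (a + j + M) b)) ?q = c (a + j)"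
        using lookup_sandwich[of "seg Q w a (a + j)" "vx Q w (a + j)" "seg Q w (a + j) (a + N - 1)"]
        by (simp add: c_def seg_simps(1))
    qed simp
    finally show ?thesis .
  qed
  have c_N: "c (a + N) = c a" if a: "a + 1 + M + N \<le> R * M" for a
  proof -
    have "(\<Sum>j<N. c (a + j)) + c (a + N) = c a + (\<Sum>j<N. c (Suc a + j))"
      using sum.lessThan_Suc_shift[of "\<lambda>j. c (a + j)" N] by simp
    then show ?thesis using c_sum[of a] c_sum[of "Suc a"] a by simp
  qed
  have c_kN: "c (a + i * N) = c a" if "a + 1 + M + i * N \<le> R * M" for a i
    using that
  proof (induction i)
    case (Suc i)
    then show ?case using c_N[of "a + i * N"] by (simp add: add_ac)
  qed simp
  have c_Suc: "c (Suc a) = c a" if "a + 2 + M + k * N \<le> R * M" for a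
    using c_kN[of "Suc a" k] c_per[of a] that by (simp add: M_def)
  have "R * M = 2 * (N * M) + 3 * M" by (simp add: R_def add_mult_distrib)
  moreover have "N \<le> N * M" "k * N + 1 = M" by (simp_all add: M_def)
  ultimately have R: "N + 2 + M + k * N \<le> R * M" by linarith
  have c_0: "c j = c 0" if "j \<le> N" for j
    using that
  proof (induction j)
    case (Suc j)
    then show ?case using c_Suc[of j] R by simp
  qed simp
  have "(\<Sum>j<N. c (0 + j)) = (\<Sum>j<N. c 0)"
    by (intro sum.cong refl) (metis c_0 add_0 lessThan_iff less_imp_le)
  also have "\<dots> = of_nat N * c 0" by simp
  finally have "(\<Sum>j<N. c (0 + j)) = of_nat N * c 0" .
  moreover have "0 + M + N \<le> R * M" using R by simp
  ultimately have "c 0 = 0" using c_sum[of 0] N_pos by simp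
  moreover have "seg Q w 0 M = \<pi>"
  proof -
    have "R = Suc (2 * N + 2)" by (simp add: R_def)
    then have "w = pcat \<pi> (wind \<pi> (2 * N + 2))" by (simp only: w_def wind_Suc(1))
    then show ?thesis
      using seg_pcat(1)[of Q \<pi> "wind \<pi> (2 * N + 2)"] wind_qpaths(2)[OF \<pi> closed] closed qpaths_plen[OF \<pi>] by simp
  qed
  moreover have "vx Q w 0 = psrc \<pi>" by (simp add: vx_0 w_def wind_qpaths(2)[OF \<pi> closed])
  ultimately have "lookup f ((psrc \<pi>, []), \<pi>) = 0" by (simp add: c_def lookup_coch_val)
  then show False using nz \<alpha> \<open>psrc \<alpha> = psrc \<pi>\<close> by simp
qed

lemma odd_cocycle_coch_val:
  fixes f :: "('v, 'a, 'k::field_char_0) cochain"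
  assumes f: "f \<in> cocycles Q N (2 * k + 1)"
  shows "coch_val f \<pi> \<in> pcorner 1 (psrc \<pi>) (ptgt Q \<pi>)"
  unfolding pcorner_def free_on_def
proof safe
  fix v l assume "(v, l) \<in> keys (coch_val f \<pi>)"
  then have nz: "lookup f ((v, l), \<pi>) \<noteq> 0" by (simp add: in_keys_iff lookup_coch_val)
  note b = cochains_keys[OF cocycles_cochains[OF f] nz]
  have "plen (v, l) \<noteq> 0" using odd_cocycle_degree_0[OF f] nz by blast
  then show "\<exists>n\<ge>1. (v, l) \<in> qpaths Q n" using b(2) by (intro exI[of _ "plen (v, l)"]) simp
  show "psrc (v, l) = psrc \<pi>" "ptgt Q (v, l) = ptgt Q \<pi>" using b by simp_all
qed

lemma trunc_pcorner: "x \<in> pcorner N u v \<Longrightarrow> trunc N x = 0"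
  for x :: "('v, 'a, 'k::field) palg"
  unfolding pcorner_def
  by (induction rule: free_on_induct) (auto simp: trunc_eqs dest: qpaths_plen)

text \<open>
  In each summand the arrows outside the values of \<open>f\<close> and \<open>g\<close> number \<open>p + (j - p - 1) + (N - 1 - j) = N - 2\<close>, and
  each of the two values has length at least 1.
\<close>

lemma odd_lift_product:
  fixes f g :: "('v, 'a, 'k::field_char_0) cochain"
  assumes f: "f \<in> cocycles Q N (2 * k + 1)" and g: "g \<in> cocycles Q N (2 * l + 1)"
    and hom: "hom_of Q N f \<circ> bext (odd_lift l g k) \<in> alg_hom (2 * k + 1 + (2 * l + 1))"
  shows "coch_of Q N (2 * k + 1 + (2 * l + 1)) (hom_of Q N f \<circ> bext (odd_lift l g k)) = 0"
  unfolding coch_of_eq_iff[OF hom cochains_0]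
proof
  note fc = cocycles_cochains[OF f] and gc = cocycles_cochains[OF g]
  fix \<rho> assume \<rho>': "\<rho> \<in> qpaths Q (res_len N (2 * k + 1 + (2 * l + 1)))"
  define L where "L = k * N + l * N + N"
  have "2 * k + 1 + (2 * l + 1) = 2 * (k + l) + 2" by simp
  then have "res_len N (2 * k + 1 + (2 * l + 1)) = L" by (simp only: res_len_simps(4) L_def add_mult_distrib)
  then have \<rho>: "\<rho> \<in> qpaths Q L" using \<rho>' by simp
  note len = qpaths_plen[OF \<rho>]
  have "bext (odd_lift l g k) (gen \<rho>) = odd_lift l g k \<rho>"
    by (rule bext_gen[where c = "odd_lift l g k", OF odd_lift_corner[OF gc \<rho> L_def]])
  moreover have "hom_of Q N f (odd_lift l g k \<rho>) = 0"
    unfolding odd_lift_def hom_of_rules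
  proof (intro sum.neutral ballI)
    fix j p assume "j \<in> {..<N}" "p \<in> {..<j}"
    then have pj: "p < j" "j < N" by auto
    let ?v = "vx Q \<rho>"
    have F: "val f \<rho> p (p + k * N + 1) \<in> pcorner 1 (?v p) (?v (p + k * N + 1))"
      using odd_cocycle_coch_val[OF f, of "seg Q \<rho> p (p + k * N + 1)"] pj len by (simp add: L_def ptgt_seg seg_simps(1))
    have G: "val g \<rho> (j + k * N) (j + k * N + l * N + 1) \<in> pcorner 1 (?v (j + k * N)) (?v (j + k * N + l * N + 1))"
      using odd_cocycle_coch_val[OF g, of "seg Q \<rho> (j + k * N) (j + k * N + l * N + 1)"] pj len by (simp add: L_def ptgt_seg seg_simps(1))
    have "E \<rho> 0 p \<star> (val f \<rho> p (p + k * N + 1) \<star> (E \<rho> (p + k * N + 1) (j + k * N) \<star>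
        (val g \<rho> (j + k * N) (j + k * N + l * N + 1) \<star> E \<rho> (j + k * N + l * N + 1) L))) \<in>
      pcorner (p + (1 + ((j - p - 1) + (1 + (N - 1 - j))))) (?v 0) (?v L)"
      using pj by (intro pcorner_mult[OF pcorner_E[OF \<rho>]] pcorner_mult[OF F] pcorner_mult[OF G] pcorner_E[OF \<rho>]) (auto simp: L_def)
    moreover have "p + (1 + ((j - p - 1) + (1 + (N - 1 - j)))) = N" using pj by simp
    ultimately show "hom_of Q N f (cut \<rho> p (p + k * N + 1) (E \<rho> (p + k * N + 1) (j + k * N) \<star>
        (val g \<rho> (j + k * N) (j + k * N + l * N + 1) \<star> E \<rho> (j + k * N + l * N + 1) (plen \<rho>)))) = 0"
      unfolding len hom_of_ten[OF fc] by (intro trunc_pcorner) (simp only:)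
  qed
  ultimately show "(hom_of Q N f \<circ> bext (odd_lift l g k)) (gen \<rho>) = coch_val 0 \<rho>"
    by (simp add: coch_val_rules)
qed

section \<open>The Yoneda product\<close>

lemma lift_product_cocycle:
  fixes f g :: "('v, 'a, 'k::field) cochain"
  assumes f: "f \<in> cocycles Q N m" and \<phi>: "cocycle_lift Q N n g \<phi>"
  shows "coch_of Q N (m + n) (hom_of Q N f \<circ> \<phi> m) \<in> cocycles Q N (m + n)"
  unfolding cocycle_iff[OF coch_of_cochains]
proof
  fix \<pi> assume "\<pi> \<in> qpaths Q (res_len N (Suc (m + n)))"
  then have x: "gen \<pi> \<in> (res_mod Q N (Suc (m + n)) :: ('v, 'a, 'k) bimod set)" by (rule gen_res_mod)
  then have x': "gen \<pi> \<in> (res_mod Q N (n + Suc m) :: ('v, 'a, 'k) bimod set)" by (simp add: add.commute)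
  have "hom_of Q N (coch_of Q N (m + n) (hom_of Q N f \<circ> \<phi> m)) (bd (Suc (m + n)) (gen \<pi>)) =
      hom_of Q N f (\<phi> m (bd (Suc (m + n)) (gen \<pi>)))"
    using hom_of_coch_of[OF lift_alg_hom[OF cocycles_cochains[OF f] \<phi>] res_homD(1)[OF res_diff_hom x]] by simp
  also have "\<phi> m (bd (Suc (m + n)) (gen \<pi>)) = bd (Suc m) (\<phi> (Suc m) (gen \<pi>))"
    using cocycle_liftD(3)[OF \<phi> x'] by (simp add: add.commute)
  also have "hom_of Q N f \<dots> = 0"
    by (rule cocycleD[OF f res_homD(1)[OF cocycle_liftD(1)[OF \<phi>] x']])
  finally show "hom_of Q N (coch_of Q N (m + n) (hom_of Q N f \<circ> \<phi> m)) (bd (Suc (m + n)) (gen \<pi>)) = 0" .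
qed

lemma yoneda_vee:
  fixes f g :: "('v, 'a, 'k::field_char_0) cochain"
  assumes f: "f \<in> cocycles Q N m" and g: "g \<in> cocycles Q N n"
  shows "vee Q N m n f g \<in> cocycles Q N (m + n)"
    "yoneda Q N m n (coh_class Q N m f) (coh_class Q N n g) = coh_class Q N (m + n) (vee Q N m n f g)"
proof -
  note fc = cocycles_cochains[OF f] and gc = cocycles_cochains[OF g]
  have "\<exists>\<phi>. cocycle_lift Q N n g \<phi> \<and> coch_of Q N (m + n) (hom_of Q N f \<circ> \<phi> m) = vee Q N m n f g"
  proof (cases n rule: parity_cases)
    case (1 l)
    have \<phi>: "cocycle_lift Q N n g (\<lambda>i. bext (right_lift g i))"
      using right_lift_even_cocycle[of g l] g 1 by simp
    have "even m \<or> even n" using 1 by simp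
    from right_lift_product[OF fc gc this lift_alg_hom[OF fc \<phi>]] \<phi> show ?thesis
      by (intro exI[of _ "\<lambda>i. bext (right_lift g i)"] conjI)
  next
    case (2 l)
    let ?\<phi> = "\<lambda>i. bext (if even i then right_lift g i else odd_lift l g (i div 2))"
    have \<phi>: "cocycle_lift Q N n g ?\<phi>"
      using lift_odd_cocycle[of g l] g 2 by simp
    show ?thesis
    proof (cases m rule: parity_cases)
      case (1 k)
      then have ev: "even m" "even m \<or> even n" by simp_all
      have "coch_of Q N (m + n) (hom_of Q N f \<circ> ?\<phi> m) = vee Q N m n f g"
        using right_lift_product[OF fc gc ev(2)] lift_alg_hom[OF fc \<phi>] ev(1) by simp
      then show ?thesis using \<phi> by (intro exI[of _ ?\<phi>] conjI)
    next
      case m: (2 k)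
      have e: "?\<phi> m = bext (odd_lift l g k)" using m by simp
      have f': "f \<in> cocycles Q N (2 * k + 1)" and g': "g \<in> cocycles Q N (2 * l + 1)" using f g m 2 by simp_all
      have "hom_of Q N f \<circ> bext (odd_lift l g k) \<in> alg_hom (2 * k + 1 + (2 * l + 1))"
        using lift_alg_hom[OF fc \<phi>] unfolding e unfolding m 2 .
      from odd_lift_product[OF f' g' this]
      have "coch_of Q N (m + n) (hom_of Q N f \<circ> ?\<phi> m) = 0" unfolding e unfolding m 2 .
      moreover have "vee Q N m n f g = 0" using m 2 by (intro vee_odd) simp_all
      ultimately have "coch_of Q N (m + n) (hom_of Q N f \<circ> ?\<phi> m) = vee Q N m n f g" by (rule trans[OF _ sym])
      then show ?thesis using \<phi> by (intro exI[of _ ?\<phi>] conjI)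
    qed
  qed
  then obtain \<phi> where \<phi>: "cocycle_lift Q N n g \<phi>" "coch_of Q N (m + n) (hom_of Q N f \<circ> \<phi> m) = vee Q N m n f g"
    by (elim exE conjE)
  show "vee Q N m n f g \<in> cocycles Q N (m + n)" using lift_product_cocycle[OF f \<phi>(1)] \<phi>(2) by simp
  show "yoneda Q N m n (coh_class Q N m f) (coh_class Q N n g) = coh_class Q N (m + n) (vee Q N m n f g)"
    using yoneda_eq[OF f g \<phi>(1)] \<phi>(2) by simp
qed

text \<open>The left and the right lift of \<open>g\<close> give the two orders of the product.\<close>

lemma vee_commute_even:
  fixes f g :: "('v, 'a, 'k::field_char_0) cochain"
  assumes f: "f \<in> cocycles Q N m" and g: "g \<in> cocycles Q N (2 * l)"
  shows "vee Q N m (2 * l) f g - vee Q N (2 * l) m g f \<in> coboundaries Q N (m + 2 * l)"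
proof -
  note fc = cocycles_cochains[OF f] and gc = cocycles_cochains[OF g] and \<phi> = left_lift_even_cocycle[OF g]
  have ev: "even m \<or> even (2 * l)" by simp
  have "coh_class Q N (m + 2 * l) (vee Q N m (2 * l) f g) = coh_class Q N (m + 2 * l) (vee Q N (2 * l) m g f)"
    using yoneda_eq[OF f g \<phi>] yoneda_vee(2)[OF f g] left_lift_product[OF fc gc ev lift_alg_hom[OF fc \<phi>]] by simp
  then show ?thesis by (simp add: coh_class_eq_iff)
qed

lemma vee_commute:
  fixes f g :: "('v, 'a, 'k::field_char_0) cochain"
  assumes f: "f \<in> cocycles Q N m" and g: "g \<in> cocycles Q N n"
  shows "vee Q N m n f g - vee Q N n m g f \<in> coboundaries Q N (m + n)"
proof (cases n rule: parity_cases)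
  case (1 l)
  then show ?thesis using vee_commute_even[OF f, of g l] g by simp
next
  case n: (2 l)
  show ?thesis
  proof (cases m rule: parity_cases)
    case (1 k)
    have "vee Q N n m g f - vee Q N m n f g \<in> coboundaries Q N (n + m)"
      using vee_commute_even[OF g, of f k] f 1 by simp
    from coboundaries_minus[OF this] show ?thesis by (simp add: add.commute)
  next
    case (2 k)
    then have "vee Q N m n f g = 0" "vee Q N n m g f = 0" using n by (auto intro!: vee_odd)
    then show ?thesis by (simp add: coboundaries_0)
  qed
qed

text \<open>
  Both bracketings vanish as soon as two of the three degrees are odd, and otherwise concatenate
  paths.
\<close>

lemma vee_assoc:
  fixes f g h :: "('v, 'a, 'k::field) cochain"
  shows "vee Q N (m + n) p (vee Q N m n f g) h = vee Q N m (n + p) f (vee Q N n p g h)"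
  using free_on_all[of f] free_on_all[of g]
proof (induction rule: bilin_free_on_induct)
  case (single x c y d)
  obtain \<alpha> \<pi> \<beta> \<tau> where xy: "x = (\<alpha>, \<pi>)" "y = (\<beta>, \<tau>)" by (cases x, cases y) auto
  show ?case using free_on_all[of h]
  proof (induction rule: free_on_induct)
    case (single z e)
    obtain \<gamma> \<sigma> where z: "z = (\<gamma>, \<sigma>)" by (cases z)
    have par: "(even m \<or> even n) \<and> (even (m + n) \<or> even p) \<longleftrightarrow> (even n \<or> even p) \<and> (even m \<or> even (n + p))" by auto
    have "vee Q N (m + n) p (vee Q N m n (single x c) (single y d)) (single z e) =
      (if ((even m \<or> even n) \<and> (even (m + n) \<or> even p)) \<and> ptgt Q \<alpha> = psrc \<beta> \<and> ptgt Q \<pi> = psrc \<tau> \<and>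
        ptgt Q \<beta> = psrc \<gamma> \<and> ptgt Q \<tau> = psrc \<sigma> \<and> plen \<alpha> + plen \<beta> + plen \<gamma> < N
       then single (pcat \<alpha> (pcat \<beta> \<gamma>), pcat \<pi> (pcat \<tau> \<sigma>)) (c * d * e) else 0)"
      by (auto simp: xy z vee_single vee_rules ptgt_pcat path_simps)
    moreover have "vee Q N m (n + p) (single x c) (vee Q N n p (single y d) (single z e)) =
      (if ((even n \<or> even p) \<and> (even m \<or> even (n + p))) \<and> ptgt Q \<alpha> = psrc \<beta> \<and> ptgt Q \<pi> = psrc \<tau> \<and>
        ptgt Q \<beta> = psrc \<gamma> \<and> ptgt Q \<tau> = psrc \<sigma> \<and> plen \<alpha> + plen \<beta> + plen \<gamma> < N
       then single (pcat \<alpha> (pcat \<beta> \<gamma>), pcat \<pi> (pcat \<tau> \<sigma>)) (c * d * e) else 0)"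
      by (auto simp: xy z vee_single vee_rules ptgt_pcat path_simps mult.assoc)
    ultimately show ?case by (simp only: par)
  qed (auto simp: vee_rules)
qed (auto simp: vee_rules)

definition unit_cochain :: "('v, 'a, 'k::field) cochain" where
  "unit_cochain = coch_of Q N 0 (res_aug Q N)"

lemma unit_cocycle: "unit_cochain \<in> (cocycles Q N 0 :: ('v, 'a, 'k::field) cochain set)"
  unfolding unit_cochain_def cocycle_iff[OF coch_of_cochains]
proof
  fix \<pi> assume \<pi>: "\<pi> \<in> qpaths Q (res_len N (Suc 0))"
  have L: "plen \<pi> = 1" using qpaths_plen[OF \<pi>] by (simp add: res_len_def)
  have self: "seg Q \<pi> 0 1 = \<pi>" using seg_full[of Q \<pi>] L by simp
  have "gen \<pi> = (cut \<pi> 0 1 (E \<pi> 1 1) :: ('v, 'a, 'k) bimod)"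
    using gen_seg[of 0 1 \<pi>] L self by (simp del: seg_simps(2))
  then have "bd (2 * 0 + 1) (gen \<pi>) =
      (cut \<pi> 1 1 (E \<pi> 1 1) - cut \<pi> 0 0 (E \<pi> 0 1) :: ('v, 'a, 'k) bimod)"
    using res_diff_odd[of 1 0 0 \<pi> "E \<pi> 0 0 :: _ \<Rightarrow>\<^sub>0 'k" "E \<pi> 1 1"] L by (simp add: E_mult del: seg_simps(2))
  moreover have "res_aug Q N (cut \<pi> 1 1 (E \<pi> 1 1)) = trunc N (E \<pi> 0 1 :: ('v, 'a, 'k) palg)"
    unfolding seg_simps(2)[of Q \<pi> 1] res_aug_ten unfolding E_refl[symmetric] using L by (simp add: E_mult del: seg_simps(2))
  moreover have "res_aug Q N (cut \<pi> 0 0 (E \<pi> 0 1)) = trunc N (E \<pi> 0 1 :: ('v, 'a, 'k) palg)"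
    unfolding seg_simps(2)[of Q \<pi> 0] res_aug_ten unfolding E_refl[symmetric] using L by (simp add: E_mult del: seg_simps(2))
  moreover have "bd (Suc 0) (gen \<pi>) \<in> (res_mod Q N 0 :: ('v, 'a, 'k) bimod set)"
    by (rule res_homD(1)[OF res_diff_hom gen_res_mod[OF \<pi>]])
  ultimately show "hom_of Q N (coch_of Q N 0 (res_aug Q N)) (bd (Suc 0) (gen \<pi>)) = (0 :: ('v, 'a, 'k) palg)"
    by (simp add: hom_of_coch_of[OF res_aug_alg_hom] res_aug_rules)
qed

lemma vee_unit:
  fixes f :: "('v, 'a, 'k::field) cochain"
  assumes f: "f \<in> cochains Q N n"
  shows "vee Q N 0 n unit_cochain f = f"
proof (rule cochain_eqI[of _ n])
  have u: "unit_cochain \<in> (cochains Q N 0 :: ('v, 'a, 'k) cochain set)" by (simp add: unit_cochain_def coch_of_cochains)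
  show "vee Q N 0 n unit_cochain f \<in> cochains Q N n" using vee_cochains[OF u f] by simp
  show "f \<in> cochains Q N n" by (rule f)
  fix \<pi> assume \<pi>: "\<pi> \<in> qpaths Q (res_len N n)"
  have v: "(psrc \<pi>, []) \<in> qpaths Q (res_len N 0)"
    using vert_qpaths[OF fin_digraph_axioms vertex_verts(1)[OF \<pi>]] by (simp add: res_len_simps)
  have "coch_val unit_cochain (psrc \<pi>, []) = trunc N (ev (psrc \<pi>) :: ('v, 'a, 'k) palg)"
    unfolding unit_cochain_def coch_val_coch_of[OF res_aug_alg_hom v]
    by (simp add: gen_def path_simps res_aug_ten kmul_simps)
  moreover have "coch_val (vee Q N 0 n unit_cochain f) \<pi> = trunc N (coch_val unit_cochain (psrc \<pi>, []) \<star> coch_val f \<pi>)"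
    using coch_val_vee[OF u f, of \<pi>] \<pi> seg_self[OF \<pi>, symmetric] by (simp add: res_len_simps seg_simps(2) vx_0)
  ultimately show "coch_val (vee Q N 0 n unit_cochain f) \<pi> = coch_val f \<pi>"
    using pcorner_ev_mult(1)[OF coch_val_corner(1)[OF f, of \<pi>]] coch_val_corner(2)[OF f, of \<pi>] by (simp add: trunc_mult)
qed

section \<open>The second grading\<close>

text \<open>
  The homogeneous component of an element for the path length, and of a cochain for the length of the
  first path of a pair.
\<close>

definition path_part :: "nat \<Rightarrow> ('v, 'a, 'k::field) palg \<Rightarrow> ('v, 'a, 'k) palg" where
  "path_part i = lin_ext (\<lambda>p. if plen p = i then single p 1 else 0)"

definition coch_part :: "nat \<Rightarrow> ('v, 'a, 'k::field) cochain \<Rightarrow> ('v, 'a, 'k) cochain" where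
  "coch_part i = lin_ext (\<lambda>(\<alpha>, \<pi>). if plen \<alpha> = i then single (\<alpha>, \<pi>) 1 else 0)"

lemma part_rules:
  fixes x y :: "('v, 'a, 'k::field) palg" and f g :: "('v, 'a, 'k) cochain"
  shows "path_part i (x + y) = path_part i x + path_part i y" "path_part i 0 = (0 :: ('v, 'a, 'k) palg)"
    "path_part i (x - y) = path_part i x - path_part i y"
    "path_part i (sum h S) = (\<Sum>s\<in>S. path_part i (h s) :: ('v, 'a, 'k) palg)"
    "coch_part i (f + g) = coch_part i f + coch_part i g" "coch_part i 0 = (0 :: ('v, 'a, 'k) cochain)"
    "coch_part i (f - g) = coch_part i f - coch_part i g"
    "coch_part i (sum h' S) = (\<Sum>s\<in>S. coch_part i (h' s) :: ('v, 'a, 'k) cochain)"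
  by (simp_all add: path_part_def coch_part_def lin_ext_add lin_ext_rules)

lemma path_part_single: "path_part i (single p c) = (if plen p = i then single p c else 0 :: ('v, 'a, 'k::field) palg)"
  by (simp add: path_part_def scal_simps)

lemma coch_part_single: "coch_part i (single (\<alpha>, \<pi>) c) = (if plen \<alpha> = i then single (\<alpha>, \<pi>) c else 0 :: ('v, 'a, 'k::field) cochain)"
  by (simp add: coch_part_def scal_simps)

lemma lookup_coch_part: "lookup (coch_part i f) (\<alpha>, \<pi>) = (if plen \<alpha> = i then lookup f (\<alpha>, \<pi>) else 0)"
  for f :: "('v, 'a, 'k::field) cochain"
  using free_on_all[of f]
  by (induction rule: free_on_induct)
    (auto simp: coch_part_def lin_ext_add lookup_add lookup_single when_def scal_simps split: prod.splits)

lemma coch_val_part: "coch_val (coch_part i f) \<pi> = path_part i (coch_val f \<pi>)"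
  for f :: "('v, 'a, 'k::field) cochain"
  using free_on_all[of f]
  by (induction rule: free_on_induct)
    (auto simp: coch_part_def lin_ext_add coch_val_rules part_rules coch_val_single path_part_single scal_simps split: prod.splits)

text \<open>
  Multiplication by paths with \<open>s\<close> arrows in all raises the length by \<open>s\<close>.
\<close>

lemma path_part_sandwich:
  fixes x :: "('v, 'a, 'k::field) palg"
  assumes "plen p + plen q = s"
  shows "path_part (i + s) (trunc N (single p 1 \<star> (x \<star> single q 1))) =
      trunc N (single p 1 \<star> (path_part i x \<star> single q 1))"
    "j < s \<Longrightarrow> path_part j (trunc N (single p 1 \<star> (x \<star> single q 1))) = 0"
proof -
  have "path_part (i + s) (trunc N (single p 1 \<star> (x \<star> single q 1))) =
      trunc N (single p 1 \<star> (path_part i x \<star> single q 1)) \<and>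
    (j < s \<longrightarrow> path_part j (trunc N (single p 1 \<star> (x \<star> single q 1))) = 0)"
    using free_on_all[of x]
    by (induction rule: free_on_induct)
      (use assms in \<open>auto simp: kmul_simps kmul_rules trunc_eqs part_rules path_part_single path_simps\<close>)
  then show "path_part (i + s) (trunc N (single p 1 \<star> (x \<star> single q 1))) =
      trunc N (single p 1 \<star> (path_part i x \<star> single q 1))"
    "j < s \<Longrightarrow> path_part j (trunc N (single p 1 \<star> (x \<star> single q 1))) = 0" by auto
qed

lemma cochains_bi_iff:
  "f \<in> cochains_bi Q N n i \<longleftrightarrow> f \<in> cochains Q N n \<and> coch_part i f = (f :: ('v, 'a, 'k::field) cochain)"
proof
  assume f: "f \<in> cochains_bi Q N n i"
  have "coch_part i f = f"
    using f unfolding cochains_bi_def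
    by (induction rule: free_on_induct)
      (auto simp: part_rules coch_part_single coch_basis_def dest: qpaths_plen)
  then show "f \<in> cochains Q N n \<and> coch_part i f = f" using f cochains_bi_sub by blast
next
  assume f: "f \<in> cochains Q N n \<and> coch_part i f = f"
  show "f \<in> cochains_bi Q N n i"
    unfolding cochains_bi_def free_on_def
  proof (rule CollectI, rule subsetI)
    fix b assume "b \<in> keys f"
    moreover obtain \<alpha> \<pi> where b: "b = (\<alpha>, \<pi>)" by (cases b)
    ultimately have nz: "lookup f (\<alpha>, \<pi>) \<noteq> 0" by (simp add: in_keys_iff)
    have "plen \<alpha> = i" using nz f lookup_coch_part[of i f \<alpha> \<pi>] by (auto split: if_splits)
    then show "b \<in> coch_basis Q N n i" using cochains_keys[OF conjunct1[OF f] nz] b by (auto simp: coch_basis_def)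
  qed
qed

lemma coch_part_cochains: "f \<in> cochains Q N n \<Longrightarrow> coch_part i f \<in> (cochains Q N n :: ('v, 'a, 'k::field) cochain set)"
proof -
  assume "f \<in> cochains Q N n"
  then show ?thesis
    unfolding cochains_def coch_part_def
    by (rule lin_ext_free_on) (auto intro!: free_on_simps)
qed

lemma coch_part_part: "coch_part i (coch_part j f) = (if i = j then coch_part i f else 0 :: ('v, 'a, 'k::field) cochain)"
  by (intro poly_mapping_eqI) (auto simp: lookup_coch_part)

lemma coch_part_sum: "f \<in> cochains Q N n \<Longrightarrow> (\<Sum>i<N. coch_part i f) = (f :: ('v, 'a, 'k::field) cochain)"
proof (rule poly_mapping_eqI)
  fix b :: "('v, 'a) qpath \<times> ('v, 'a) qpath" assume f: "f \<in> cochains Q N n"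
  obtain \<alpha> \<pi> where b: "b = (\<alpha>, \<pi>)" by (cases b)
  show "lookup (\<Sum>i<N. coch_part i f) b = lookup f b"
    using cochains_keys(1)[OF f, of \<alpha> \<pi>] by (auto simp: b lookup_sum lookup_coch_part)
qed

text \<open>
  Every term of the differential multiplies a value by the same number \<open>s\<close> of arrows: one arrow from even
  to odd degree, \<open>N - 1\<close> arrows from odd to even degree.
\<close>

lemma coch_diff_part:
  fixes f :: "('v, 'a, 'k::field) cochain"
  assumes f: "f \<in> cochains Q N n"
  defines "s \<equiv> if even n then 1 else N - 1"
  shows "coch_diff Q N n (coch_part i f) = coch_part (i + s) (coch_diff Q N n f)"
    "j < s \<Longrightarrow> coch_part j (coch_diff Q N n f) = 0"
proof -
  note pc = coch_part_cochains[OF f]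
  have main: "hom_of Q N (coch_part i f) (bd (Suc n) (gen \<pi>)) = path_part (i + s) (hom_of Q N f (bd (Suc n) (gen \<pi>))) \<and>
     (j < s \<longrightarrow> path_part j (hom_of Q N f (bd (Suc n) (gen \<pi>))) = 0)"
    if \<pi>: "\<pi> \<in> qpaths Q (res_len N (Suc n))" for \<pi>
  proof -
    define L where "L = res_len N (Suc n)"
    have L: "plen \<pi> = L" and self: "seg Q \<pi> 0 L = \<pi>"
      using qpaths_plen[OF \<pi>] seg_self[OF \<pi>, symmetric] by (simp_all add: L_def)
    have g: "gen \<pi> = (cut \<pi> 0 L (E \<pi> L L) :: ('v, 'a, 'k) bimod)"
      using gen_seg[of 0 L \<pi>] L self by (simp del: seg_simps(2))
    show ?thesis
    proof (cases n rule: parity_cases)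
      case (1 k)
      have n: "Suc n = 2 * k + 1" using 1 by simp
      have L': "L = k * N + 1" unfolding L_def n by (simp only: res_len_simps)
      have s: "s = 1" using 1 by (simp add: s_def)
      have d: "bd (Suc n) (gen \<pi>) =
         (cut \<pi> 1 L (E \<pi> L L) - cut \<pi> 0 (k * N) (E \<pi> (k * N) L) :: ('v, 'a, 'k) bimod)"
        unfolding g n using L' L by (subst res_diff_odd) (simp_all add: E_mult)
      have len: "plen (seg Q \<pi> 0 1) + plen (seg Q \<pi> L L) = s" "plen (seg Q \<pi> 0 0) + plen (seg Q \<pi> (k * N) L) = s"
        using L L' s by (simp_all add: seg_simps(3) del: seg_simps(2))
      have z: "path_part j (hom_of Q N f (bd (Suc n) (gen \<pi>))) = 0" if "j < s"
        by (simp only: d hom_of_rules hom_of_ten[OF f] part_rules path_part_sandwich(2)[OF len(1) that]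
            path_part_sandwich(2)[OF len(2) that] diff_0_right)
      have "hom_of Q N (coch_part i f) (bd (Suc n) (gen \<pi>)) =
          path_part (i + s) (hom_of Q N f (bd (Suc n) (gen \<pi>)))"
        by (simp only: d hom_of_rules hom_of_ten[OF pc] hom_of_ten[OF f] part_rules coch_val_part
            path_part_sandwich(1)[OF len(1)] path_part_sandwich(1)[OF len(2)])
      then show ?thesis using z by blast
    next
      case (2 k)
      have n: "Suc n = 2 * k + 2" using 2 by simp
      have L': "L = k * N + N" unfolding L_def n by (simp only: res_len_simps)
      have s: "s = N - 1" using 2 by (simp add: s_def)
      have d: "bd (Suc n) (gen \<pi>) =
         (\<Sum>j<N. cut \<pi> j (j + k * N + 1) (E \<pi> (j + k * N + 1) L) :: ('v, 'a, 'k) bimod)"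
        unfolding g n using L' L by (subst res_diff_even) (auto simp: E_mult intro!: sum.cong)
      have len: "plen (seg Q \<pi> 0 j) + plen (seg Q \<pi> (j + k * N + 1) L) = s" if "j < N" for j
        using L L' s that by (simp add: seg_simps(3) del: seg_simps(2))
      have "(\<Sum>j<N. trunc N (E \<pi> 0 j \<star> (path_part i (val f \<pi> j (j + k * N + 1)) \<star> E \<pi> (j + k * N + 1) L))) =
          (\<Sum>j<N. path_part (i + s) (trunc N (E \<pi> 0 j \<star> (val f \<pi> j (j + k * N + 1) \<star> E \<pi> (j + k * N + 1) L))))"
        using path_part_sandwich(1)[OF len, symmetric] by (intro sum.cong refl) simp
      moreover have "(\<Sum>j'<N. path_part j (trunc N (E \<pi> 0 j' \<star> (coch_val f (seg Q \<pi> j' (j' + k * N + 1)) \<star> E \<pi> (j' + k * N + 1) L)))) = 0"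
        if "j < s"
      proof (intro sum.neutral ballI)
        fix x assume "x \<in> {..<N}"
        then have "plen (seg Q \<pi> 0 x) + plen (seg Q \<pi> (x + k * N + 1) L) = s" by (intro len) simp
        from path_part_sandwich(2)[OF this \<open>j < s\<close>]
        show "path_part j (trunc N (E \<pi> 0 x \<star> (val f \<pi> x (x + k * N + 1) \<star> E \<pi> (x + k * N + 1) L))) = 0" .
      qed
      ultimately show ?thesis
        unfolding d hom_of_rules hom_of_ten[OF pc] hom_of_ten[OF f] part_rules coch_val_part by simp
    qed
  qed
  show "coch_diff Q N n (coch_part i f) = coch_part (i + s) (coch_diff Q N n f)"
    by (rule cochain_eqI[OF coch_diff_cochains coch_part_cochains[OF coch_diff_cochains]])
      (simp add: coch_val_coch_diff[OF pc] coch_val_coch_diff[OF f] coch_val_part main)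
  show "coch_part j (coch_diff Q N n f) = 0" if "j < s"
    by (rule cochain_eqI[OF coch_part_cochains[OF coch_diff_cochains] cochains_0])
      (use main that in \<open>simp add: coch_val_coch_diff[OF f] coch_val_part coch_val_rules\<close>)
qed

lemma coch_part_cocycles: "f \<in> cocycles Q N n \<Longrightarrow> coch_part i f \<in> (cocycles Q N n :: ('v, 'a, 'k::field) cochain set)"
  using coch_diff_part(1)[of f n i] by (simp add: cocycles_def coch_part_cochains part_rules)

lemma coch_part_coboundaries:
  fixes f :: "('v, 'a, 'k::field) cochain"
  assumes "f \<in> coboundaries Q N n"
  shows "coch_part i f \<in> coboundaries Q N n"
proof (cases n)
  case 0
  then show ?thesis using assms by (simp add: coboundaries_def part_rules)
next
  case (Suc m)
  then obtain b where b: "b \<in> cochains Q N m" "f = coch_diff Q N m b" using assms by (auto simp: coboundaries_Suc)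
  let ?s = "if even m then 1 else N - 1"
  show ?thesis
  proof (cases "i < ?s")
    case True
    then show ?thesis using coch_diff_part(2)[OF b(1), of i] b(2) by (simp add: coboundaries_0)
  next
    case False
    then have "coch_part i f = coch_diff Q N m (coch_part (i - ?s) b)"
      using coch_diff_part(1)[OF b(1), of "i - ?s"] b(2) by (simp only: le_add_diff_inverse2 not_less)
    then show ?thesis unfolding Suc coboundaries_Suc using coch_part_cochains[OF b(1)] by blast
  qed
qed

section \<open>The cohomology ring\<close>

lemma coh_class_add:
  "coh_class Q N n f + coh_class Q N n g = (coh_class Q N n (f + g) :: ('v, 'a, 'k::field) cochain set)"
proof (intro subset_antisym subsetI)
  fix x assume "x \<in> coh_class Q N n f + coh_class Q N n g"
  then obtain b c where bc: "b \<in> coboundaries Q N n" "c \<in> coboundaries Q N n" "x = (f + b) + (g + c)"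
    by (auto simp: set_plus_def coh_class_def)
  then have "x = (f + g) + (b + c)" by (simp add: algebra_simps)
  then show "x \<in> coh_class Q N n (f + g)" using coboundaries_add[OF bc(1,2)] unfolding coh_class_def by blast
next
  fix x assume "x \<in> coh_class Q N n (f + g)"
  then obtain b where "b \<in> coboundaries Q N n" "x = (f + b) + (g + 0)" by (auto simp: coh_class_def add_ac)
  then show "x \<in> coh_class Q N n f + coh_class Q N n g"
    unfolding set_plus_def coh_class_def using coboundaries_0 by blast
qed

lemma coh_class_sum:
  fixes h :: "'i \<Rightarrow> ('v, 'a, 'k::field) cochain"
  assumes "finite I" "I \<noteq> {}"
  shows "(\<Sum>i\<in>I. coh_class Q N n (h i)) = coh_class Q N n (\<Sum>i\<in>I. h i)"
  using assms by (induction rule: finite_ne_induct) (simp_all add: coh_class_add)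

lemma coh_class_0: "coh_class Q N n 0 = (coboundaries Q N n :: ('v, 'a, 'k::field) cochain set)"
  by (auto simp: coh_class_def)

text \<open>
  Elements of the cohomology ring are handled through families of representing cocycles, almost all of
  which are 0; \<open>conv\<close> represents the product.
\<close>

definition class_family :: "(nat \<Rightarrow> ('v, 'a, 'k::field) cochain) \<Rightarrow> nat \<Rightarrow> ('v, 'a, 'k) cochain set" where
  "class_family x = (\<lambda>n. coh_class Q N n (x n))"

definition families :: "(nat \<Rightarrow> ('v, 'a, 'k::field) cochain) set" where
  "families = {x. (\<forall>n. x n \<in> cocycles Q N n) \<and> finite {n. x n \<noteq> 0}}"

definition conv :: "(nat \<Rightarrow> ('v, 'a, 'k::field) cochain) \<Rightarrow> (nat \<Rightarrow> ('v, 'a, 'k) cochain) \<Rightarrow> nat \<Rightarrow> ('v, 'a, 'k) cochain" where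
  "conv x y = (\<lambda>n. \<Sum>i\<le>n. vee Q N i (n - i) (x i) (y (n - i)))"

definition unit_family :: "nat \<Rightarrow> ('v, 'a, 'k::field) cochain" where
  "unit_family = (\<lambda>n. if n = 0 then unit_cochain else 0)"

abbreviation H :: "(nat \<Rightarrow> ('v, 'a, 'k::field_char_0) cochain set) ring" where "H \<equiv> HH_ring Q N"

lemma cocycles_sum: "(\<And>s. s \<in> S \<Longrightarrow> h s \<in> cocycles Q N n) \<Longrightarrow> sum h S \<in> (cocycles Q N n :: ('v, 'a, 'k::field) cochain set)"
  by (induction S rule: infinite_finite_induct) (auto simp: cocycles_0 cocycles_add)

lemma coboundaries_sum: "(\<And>s. s \<in> S \<Longrightarrow> h s \<in> coboundaries Q N n) \<Longrightarrow> sum h S \<in> (coboundaries Q N n :: ('v, 'a, 'k::field) cochain set)"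
  by (induction S rule: infinite_finite_induct) (auto simp: coboundaries_0 coboundaries_add)

lemma class_family_eq_iff: "class_family x = class_family y \<longleftrightarrow> (\<forall>n. x n - y n \<in> (coboundaries Q N n :: ('v, 'a, 'k::field) cochain set))"
  by (simp add: class_family_def fun_eq_iff coh_class_eq_iff)

lemma carrier_HH: "carrier H = class_family ` (families :: (nat \<Rightarrow> ('v, 'a, 'k::field_char_0) cochain) set)"
proof (intro subset_antisym subsetI)
  fix X :: "nat \<Rightarrow> ('v, 'a, 'k) cochain set" assume "X \<in> carrier H"
  then have X: "\<And>n. X n \<in> HH Q N n" "finite {n. X n \<noteq> coboundaries Q N n}" by (auto simp: HH_ring_def)
  obtain z where z: "z n \<in> cocycles Q N n" "X n = coh_class Q N n (z n)" for n
    using X(1) unfolding HH_def image_iff by metis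
  define x where "x n = (if X n = coboundaries Q N n then 0 else z n)" for n
  have "{n. x n \<noteq> 0} \<subseteq> {n. X n \<noteq> coboundaries Q N n}" by (auto simp: x_def)
  then have "x \<in> families" using z X(2) by (auto simp: families_def x_def cocycles_0 intro: finite_subset)
  moreover have "X = class_family x" using z(2) by (auto simp: class_family_def x_def coh_class_0 fun_eq_iff)
  ultimately show "X \<in> class_family ` families" by blast
next
  fix X :: "nat \<Rightarrow> ('v, 'a, 'k) cochain set" assume "X \<in> class_family ` families"
  then obtain x where x: "x \<in> families" "X = class_family x" by blast
  have "{n. X n \<noteq> coboundaries Q N n} \<subseteq> {n. x n \<noteq> 0}" using x by (auto simp: class_family_def coh_class_0)
  then have "finite {n. X n \<noteq> coboundaries Q N n}" using x by (auto simp: families_def intro: finite_subset)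
  then show "X \<in> carrier H" using x by (auto simp: HH_ring_def HH_def class_family_def families_def)
qed

lemma families_0: "(\<lambda>n. 0) \<in> (families :: (nat \<Rightarrow> ('v, 'a, 'k::field) cochain) set)"
  by (simp add: families_def cocycles_0)

lemma families_add: "x \<in> families \<Longrightarrow> y \<in> families \<Longrightarrow> (\<lambda>n. x n + y n) \<in> (families :: (nat \<Rightarrow> ('v, 'a, 'k::field) cochain) set)"
proof -
  assume x: "x \<in> families" and y: "y \<in> families"
  have "{n. x n + y n \<noteq> 0} \<subseteq> {n. x n \<noteq> 0} \<union> {n. y n \<noteq> 0}" by auto
  then have "finite {n. x n + y n \<noteq> 0}" by (rule finite_subset) (use x y in \<open>simp add: families_def\<close>)
  then show ?thesis using x y by (simp add: families_def cocycles_add)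
qed

lemma families_minus: "x \<in> families \<Longrightarrow> (\<lambda>n. - x n) \<in> (families :: (nat \<Rightarrow> ('v, 'a, 'k::field) cochain) set)"
  using cocycles_diff[OF cocycles_0] by (fastforce simp: families_def)

lemma families_unit: "unit_family \<in> (families :: (nat \<Rightarrow> ('v, 'a, 'k::field) cochain) set)"
  by (auto simp: families_def unit_family_def unit_cocycle cocycles_0)

lemma vee_cocycles_deg:
  fixes f g :: "('v, 'a, 'k::field_char_0) cochain"
  assumes "f \<in> cocycles Q N i" "g \<in> cocycles Q N (n - i)" "i \<le> n"
  shows "vee Q N i (n - i) f g \<in> cocycles Q N n"
  using yoneda_vee(1)[OF assms(1,2)] assms(3) by simp

lemma families_conv:
  fixes x y :: "nat \<Rightarrow> ('v, 'a, 'k::field_char_0) cochain"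
  assumes x: "x \<in> families" and y: "y \<in> families"
  shows "conv x y \<in> families"
proof -
  have "{n. conv x y n \<noteq> 0} \<subseteq> (\<lambda>(i, j). i + j) ` ({n. x n \<noteq> 0} \<times> {n. y n \<noteq> 0})"
  proof
    fix n assume "n \<in> {n. conv x y n \<noteq> 0}"
    then obtain i where "i \<le> n" "vee Q N i (n - i) (x i) (y (n - i)) \<noteq> 0"
      unfolding conv_def mem_Collect_eq by (meson atMost_iff sum.neutral)
    then have "x i \<noteq> 0" "y (n - i) \<noteq> 0" "n = i + (n - i)" by (auto simp: vee_rules)
    then show "n \<in> (\<lambda>(i, j). i + j) ` ({n. x n \<noteq> 0} \<times> {n. y n \<noteq> 0})"
      by (intro image_eqI[of _ _ "(i, n - i)"]) auto
  qed
  then have "finite {n. conv x y n \<noteq> 0}"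
    using x y by (auto simp: families_def intro: finite_subset)
  then show ?thesis using x y by (auto simp: families_def conv_def intro!: cocycles_sum vee_cocycles_deg)
qed

lemma HH_ring_ops:
  fixes x y :: "nat \<Rightarrow> ('v, 'a, 'k::field_char_0) cochain"
  shows "class_family x \<oplus>\<^bsub>H\<^esub> class_family y = class_family (\<lambda>n. x n + y n)"
    "\<zero>\<^bsub>H\<^esub> = class_family (\<lambda>n. 0 :: ('v, 'a, 'k) cochain)"
    "\<one>\<^bsub>H\<^esub> = class_family (unit_family :: nat \<Rightarrow> ('v, 'a, 'k) cochain)"
    "x \<in> families \<Longrightarrow> y \<in> families \<Longrightarrow> class_family x \<otimes>\<^bsub>H\<^esub> class_family y = class_family (conv x y)"
proof -
  show "class_family x \<oplus>\<^bsub>H\<^esub> class_family y = class_family (\<lambda>n. x n + y n)"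
    by (simp add: HH_ring_def class_family_def coh_class_add)
  show "\<zero>\<^bsub>H\<^esub> = class_family (\<lambda>n. 0 :: ('v, 'a, 'k) cochain)"
    by (simp add: HH_ring_def class_family_def coh_class_0)
  show "\<one>\<^bsub>H\<^esub> = class_family (unit_family :: nat \<Rightarrow> ('v, 'a, 'k) cochain)"
    by (auto simp: HH_ring_def class_family_def coh_class_0 unit_family_def unit_cochain_def fun_eq_iff)
  assume x: "x \<in> families" and y: "y \<in> families"
  have "(\<Sum>i\<le>n. yoneda Q N i (n - i) (coh_class Q N i (x i)) (coh_class Q N (n - i) (y (n - i)))) =
    (\<Sum>i\<le>n. coh_class Q N n (vee Q N i (n - i) (x i) (y (n - i))))" for n
    using x y yoneda_vee(2)[of "x i" i "y (n - i)" "n - i" for i] by (intro sum.cong) (auto simp: families_def)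
  then show "class_family x \<otimes>\<^bsub>H\<^esub> class_family y = class_family (conv x y)"
    by (simp add: HH_ring_def class_family_def conv_def coh_class_sum)
qed

text \<open>Associativity holds for the cochains and not merely for their classes.\<close>

lemma conv_assoc: "conv (conv x y) z = conv x (conv y z)"
  for x y z :: "nat \<Rightarrow> ('v, 'a, 'k::field) cochain"
proof
  fix n
  have "conv (conv x y) z n = (\<Sum>i\<le>n. \<Sum>j\<le>i. vee Q N i (n - i) (vee Q N j (i - j) (x j) (y (i - j))) (z (n - i)))"
    by (simp add: conv_def vee_rules)
  also have "\<dots> = (\<Sum>(i, j)\<in>Sigma {..n} (\<lambda>i. {..i}). vee Q N i (n - i) (vee Q N j (i - j) (x j) (y (i - j))) (z (n - i)))"
    by (simp add: sum.Sigma)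
  also have "\<dots> = (\<Sum>(j, k)\<in>Sigma {..n} (\<lambda>j. {..n - j}). vee Q N j (n - j) (x j) (vee Q N k (n - j - k) (y k) (z (n - j - k))))"
  proof (rule sum.reindex_bij_witness[of _ "\<lambda>(j, k). (j + k, j)" "\<lambda>(i, j). (j, i - j)"])
    fix a assume "a \<in> Sigma {..n} (\<lambda>i. {..i})"
    then obtain i j where a: "a = (i, j)" "j \<le> i" "i \<le> n" by auto
    have "vee Q N (j + (i - j)) (n - i) (vee Q N j (i - j) (x j) (y (i - j))) (z (n - i)) =
       vee Q N j (i - j + (n - i)) (x j) (vee Q N (i - j) (n - i) (y (i - j)) (z (n - i)))"
      by (rule vee_assoc)
    then show "(case (case a of (i, j) \<Rightarrow> (j, i - j)) of (j, k) \<Rightarrow> vee Q N j (n - j) (x j) (vee Q N k (n - j - k) (y k) (z (n - j - k)))) =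
       (case a of (i, j) \<Rightarrow> vee Q N i (n - i) (vee Q N j (i - j) (x j) (y (i - j))) (z (n - i)))"
      using a by simp
  qed auto
  also have "\<dots> = conv x (conv y z) n"
    by (simp add: conv_def vee_rules sum.Sigma)
  finally show "conv (conv x y) z n = conv x (conv y z) n" .
qed

lemma conv_unit:
  assumes "x \<in> families"
  shows "conv unit_family x = (x :: nat \<Rightarrow> ('v, 'a, 'k::field) cochain)"
proof
  fix n
  have "conv unit_family x n = (\<Sum>i\<le>n. if i = 0 then vee Q N 0 n unit_cochain (x n) else 0)"
    unfolding conv_def by (intro sum.cong) (auto simp: unit_family_def vee_rules)
  also have "\<dots> = vee Q N 0 n unit_cochain (x n)" by (simp add: sum.delta)
  also have "\<dots> = x n" using assms by (intro vee_unit cocycles_cochains) (simp add: families_def)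
  finally show "conv unit_family x n = x n" .
qed

lemma conv_commute:
  fixes x y :: "nat \<Rightarrow> ('v, 'a, 'k::field_char_0) cochain"
  assumes x: "x \<in> families" and y: "y \<in> families"
  shows "class_family (conv x y) = class_family (conv y x)"
  unfolding class_family_eq_iff
proof
  fix n
  have "conv y x n = (\<Sum>i\<le>n. vee Q N (n - i) i (y (n - i)) (x i))"
    unfolding conv_def
    by (rule sum.reindex_bij_witness[of _ "\<lambda>i. n - i" "\<lambda>i. n - i"]) auto
  then have "conv x y n - conv y x n = (\<Sum>i\<le>n. vee Q N i (n - i) (x i) (y (n - i)) - vee Q N (n - i) i (y (n - i)) (x i))"
    by (simp add: conv_def sum_subtractf)
  also have "\<dots> \<in> coboundaries Q N n"
  proof (rule coboundaries_sum)
    fix i assume "i \<in> {..n}"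
    then show "vee Q N i (n - i) (x i) (y (n - i)) - vee Q N (n - i) i (y (n - i)) (x i) \<in> coboundaries Q N n"
      using vee_commute[of "x i" i "y (n - i)" "n - i"] x y by (simp add: families_def)
  qed
  finally show "conv x y n - conv y x n \<in> coboundaries Q N n" .
qed

lemma conv_add_left: "conv (\<lambda>n. x n + y n) z = (\<lambda>n. conv x z n + conv y z n)"
  for x y z :: "nat \<Rightarrow> ('v, 'a, 'k::field) cochain"
  by (simp add: conv_def vee_rules sum.distrib)

lemma cring_HH: "cring (H :: (nat \<Rightarrow> ('v, 'a, 'k::field_char_0) cochain set) ring)"
proof (rule cringI)
  show "abelian_group (H :: (nat \<Rightarrow> ('v, 'a, 'k) cochain set) ring)"
  proof (rule abelian_groupI)
    fix X :: "nat \<Rightarrow> ('v, 'a, 'k) cochain set" assume "X \<in> carrier H"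
    then obtain x where x: "x \<in> families" "X = class_family x" by (auto simp: carrier_HH)
    show "\<exists>Y\<in>carrier H. Y \<oplus>\<^bsub>H\<^esub> X = \<zero>\<^bsub>H\<^esub>"
      using x families_minus[OF x(1)] by (intro bexI[of _ "class_family (\<lambda>n. - x n)"]) (auto simp: HH_ring_ops carrier_HH)
  qed (auto simp: carrier_HH HH_ring_ops families_add families_0 add_ac)
  show "comm_monoid (H :: (nat \<Rightarrow> ('v, 'a, 'k) cochain set) ring)"
    by (rule comm_monoidI)
      (auto simp: carrier_HH HH_ring_ops families_conv families_unit conv_assoc conv_unit conv_commute)
qed (auto simp: carrier_HH HH_ring_ops families_conv families_add conv_add_left)

section \<open>The bigrading\<close>

definition single_family :: "nat \<Rightarrow> ('v, 'a, 'k::field) cochain \<Rightarrow> nat \<Rightarrow> ('v, 'a, 'k) cochain" where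
  "single_family n f = (\<lambda>m. if m = n then f else 0)"

lemma single_family_families: "f \<in> cocycles Q N n \<Longrightarrow> single_family n f \<in> (families :: (nat \<Rightarrow> ('v, 'a, 'k::field) cochain) set)"
  by (auto simp: families_def single_family_def cocycles_0)

lemma HH_comp_eq: "HH_comp Q N n i =
    (\<lambda>f. class_family (single_family n f)) ` (cocycles Q N n \<inter> cochains_bi Q N n i :: ('v, 'a, 'k::field) cochain set)"
proof (intro subset_antisym subsetI)
  fix X :: "nat \<Rightarrow> ('v, 'a, 'k) cochain set" assume "X \<in> HH_comp Q N n i"
  then obtain f where "f \<in> cocycles Q N n \<inter> cochains_bi Q N n i" "X n = coh_class Q N n f" "\<forall>m. m \<noteq> n \<longrightarrow> X m = coboundaries Q N m"
    by (auto simp: HH_comp_def HH_bi_def)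
  then show "X \<in> (\<lambda>f. class_family (single_family n f)) ` (cocycles Q N n \<inter> cochains_bi Q N n i)"
    by (intro image_eqI[of _ _ f]) (auto simp: class_family_def single_family_def coh_class_0 fun_eq_iff)
qed (auto simp: HH_comp_def HH_bi_def class_family_def single_family_def coh_class_0)

lemma cochains_bi_closed:
  fixes f g :: "('v, 'a, 'k::field) cochain"
  shows "0 \<in> (cochains_bi Q N n i :: ('v, 'a, 'k) cochain set)"
    "f \<in> cochains_bi Q N n i \<Longrightarrow> g \<in> cochains_bi Q N n i \<Longrightarrow> f + g \<in> cochains_bi Q N n i"
    "f \<in> cochains_bi Q N n i \<Longrightarrow> - f \<in> cochains_bi Q N n i"
  by (auto simp: cochains_bi_def free_on_simps free_on_uminus)

lemma subgroup_HH_comp: "subgroup (HH_comp Q N n i) (add_monoid (H :: (nat \<Rightarrow> ('v, 'a, 'k::field_char_0) cochain set) ring))"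
proof -
  interpret R: cring "H :: (nat \<Rightarrow> ('v, 'a, 'k) cochain set) ring" by (rule cring_HH)
  have in_carrier: "HH_comp Q N n i \<subseteq> carrier (H :: (nat \<Rightarrow> ('v, 'a, 'k) cochain set) ring)"
    by (auto simp: HH_comp_eq carrier_HH single_family_families)
  have minus: "\<ominus>\<^bsub>H\<^esub> class_family (single_family n f) = class_family (single_family n (- f))"
    if f: "f \<in> cocycles Q N n" for f :: "('v, 'a, 'k) cochain"
  proof (rule R.minus_equality)
    have f': "- f \<in> cocycles Q N n" using cocycles_diff[OF cocycles_0 f] by simp
    show "class_family (single_family n (- f)) \<oplus>\<^bsub>H\<^esub> class_family (single_family n f) = \<zero>\<^bsub>H\<^esub>"
      unfolding HH_ring_ops by (rule arg_cong[where f = class_family]) (auto simp: single_family_def fun_eq_iff)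
    show "class_family (single_family n f) \<in> carrier H" "class_family (single_family n (- f)) \<in> carrier H"
      using f f' by (auto simp: carrier_HH intro!: imageI single_family_families)
  qed
  have add: "class_family (single_family n f) \<oplus>\<^bsub>H\<^esub> class_family (single_family n g) = class_family (single_family n (f + g))"
    for f g :: "('v, 'a, 'k) cochain"
    unfolding HH_ring_ops by (rule arg_cong[where f = class_family]) (auto simp: single_family_def fun_eq_iff)
  show ?thesis
  proof (rule group.subgroupI[OF R.a_group])
    show "HH_comp Q N n i \<subseteq> carrier (add_monoid (H :: (nat \<Rightarrow> ('v, 'a, 'k) cochain set) ring))" using in_carrier by simp
    show "HH_comp Q N n i \<noteq> ({} :: (nat \<Rightarrow> ('v, 'a, 'k) cochain set) set)"
      using cocycles_0 cochains_bi_closed(1) unfolding HH_comp_eq by blast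
    fix X :: "nat \<Rightarrow> ('v, 'a, 'k) cochain set" assume "X \<in> HH_comp Q N n i"
    then obtain f where f: "f \<in> cocycles Q N n" "f \<in> cochains_bi Q N n i" "X = class_family (single_family n f)" by (auto simp: HH_comp_eq)
    have "- f \<in> cocycles Q N n" using cocycles_diff[OF cocycles_0 f(1)] by simp
    then show "inv\<^bsub>add_monoid H\<^esub> X \<in> HH_comp Q N n i"
      using minus[OF f(1)] cochains_bi_closed(3)[OF f(2)] unfolding f(3) a_inv_def HH_comp_eq by auto
    fix Y :: "nat \<Rightarrow> ('v, 'a, 'k) cochain set" assume "Y \<in> HH_comp Q N n i"
    then obtain g where g: "g \<in> cocycles Q N n" "g \<in> cochains_bi Q N n i" "Y = class_family (single_family n g)" by (auto simp: HH_comp_eq)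
    show "X \<otimes>\<^bsub>add_monoid H\<^esub> Y \<in> HH_comp Q N n i"
      using add[of f g] cocycles_add[OF f(1) g(1)] cochains_bi_closed(2)[OF f(2) g(2)] f(3) g(3) by (auto simp: HH_comp_eq)
  qed
qed

lemma finsum_class_family:
  fixes u :: "'i \<Rightarrow> nat \<Rightarrow> ('v, 'a, 'k::field_char_0) cochain"
  assumes "finite D" "\<And>d. d \<in> D \<Longrightarrow> u d \<in> families" "\<And>d. d \<in> D \<Longrightarrow> c d = class_family (u d)"
  shows "finsum H c D = class_family (\<lambda>n. \<Sum>d\<in>D. u d n)" "(\<lambda>n. \<Sum>d\<in>D. u d n) \<in> families"
proof -
  interpret R: cring "H :: (nat \<Rightarrow> ('v, 'a, 'k) cochain set) ring" by (rule cring_HH)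
  have "finsum H c D = class_family (\<lambda>n. \<Sum>d\<in>D. u d n) \<and> (\<lambda>n. \<Sum>d\<in>D. u d n) \<in> families"
    using assms
  proof (induction D rule: finite_induct)
    case empty
    then show ?case by (simp add: HH_ring_ops families_0)
  next
    case (insert d D)
    have c: "c \<in> D \<rightarrow> carrier H" "c d \<in> carrier H" using insert.prems by (auto simp: carrier_HH)
    have "finsum H c (insert d D) = class_family (u d) \<oplus>\<^bsub>H\<^esub> class_family (\<lambda>n. \<Sum>d\<in>D. u d n)"
      using R.finsum_insert[OF insert.hyps c] insert by simp
    then show ?case using insert families_add[of "u d" "\<lambda>n. \<Sum>d\<in>D. u d n"] by (simp add: HH_ring_ops)
  qed
  then show "finsum H c D = class_family (\<lambda>n. \<Sum>d\<in>D. u d n)" "(\<lambda>n. \<Sum>d\<in>D. u d n) \<in> families" by auto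
qed

lemma coch_part_bi: "f \<in> cochains_bi Q N n i \<Longrightarrow> coch_part j f = (if j = i then f else 0 :: ('v, 'a, 'k::field) cochain)"
  using coch_part_part[of j i f] by (auto simp: cochains_bi_iff)

text \<open>
  The components of a representing family give a decomposition. It is unique because taking a component
  preserves coboundaries: the component of a sum of homogeneous representatives in bidegree \<open>(n, i)\<close> is the
  representative of that bidegree.
\<close>

lemma HH_decomposition:
  fixes X :: "nat \<Rightarrow> ('v, 'a, 'k::field_char_0) cochain set"
  assumes "X \<in> carrier H"
  shows "\<exists>!c. (\<forall>n i. c (n, i) \<in> HH_comp Q N n i) \<and> finite {d. c d \<noteq> \<zero>\<^bsub>H\<^esub>} \<and> X = finsum H c {d. c d \<noteq> \<zero>\<^bsub>H\<^esub>}"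
proof -
  obtain z where z: "z \<in> families" "X = class_family z" using assms by (auto simp: carrier_HH)
  have zc: "z n \<in> cocycles Q N n" for n using z by (simp add: families_def)
  define u where "u = (\<lambda>(n, i). single_family n (coch_part i (z n)))"
  have u: "u d \<in> families" for d
    by (cases d) (simp add: u_def single_family_families coch_part_cocycles zc)
  show ?thesis
  proof (rule ex1I[of _ "\<lambda>d. class_family (u d)"], intro conjI allI)
    show "class_family (u (n, i)) \<in> HH_comp Q N n i" for n i
      using coch_part_cocycles[OF zc, of i n] coch_part_cochains[OF cocycles_cochains[OF zc], of i n]
      by (auto simp: HH_comp_eq u_def cochains_bi_iff coch_part_part)
    \<comment> \<open>A finite set of bidegrees containing all nonzero cochains. The bidegrees in it whose class is zero
      only contribute coboundaries.\<close>
    define S where "S = {n. z n \<noteq> 0} \<times> {..<N}"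
    have S: "finite S" using z by (simp add: S_def families_def)
    have out: "u d = (\<lambda>n. 0)" if "d \<notin> S" for d
    proof -
      obtain n i where d: "d = (n, i)" by (cases d)
      have "coch_part i (z n) = 0"
      proof (cases "z n = 0")
        case False
        then have "N \<le> i" using that d by (auto simp: S_def)
        have "lookup (z n) (\<alpha>, \<pi>) = 0" if "plen \<alpha> = i" for \<alpha> \<pi>
          using cochains_keys(1)[OF cocycles_cochains[OF zc[of n]], of \<alpha> \<pi>] \<open>N \<le> i\<close> that by (meson not_le)
        then have "lookup (coch_part i (z n)) (\<alpha>, \<pi>) = 0" for \<alpha> \<pi>
          by (simp add: lookup_coch_part)
        then show ?thesis by (intro poly_mapping_eqI) (metis lookup_zero surj_pair)
      qed (simp add: part_rules)
      then show ?thesis by (simp add: u_def d single_family_def fun_eq_iff)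
    qed
    let ?D = "{d. class_family (u d) \<noteq> \<zero>\<^bsub>H\<^esub>}"
    have DS: "?D \<subseteq> S" using out by (auto simp: HH_ring_ops)
    then show D: "finite ?D" using S finite_subset by blast
    have "(\<Sum>d\<in>S. u d n) = z n" for n
    proof -
      have "(\<Sum>d\<in>S. u d n) = (\<Sum>m | z m \<noteq> 0. \<Sum>i<N. if n = m then coch_part i (z m) else 0)"
        by (simp add: S_def sum.cartesian_product u_def single_family_def split_def)
      also have "\<dots> = (\<Sum>m | z m \<noteq> 0. if n = m then z m else 0)"
        using coch_part_sum[OF cocycles_cochains[OF zc]] by (intro sum.cong) auto
      also have "\<dots> = z n" using z by (simp add: families_def)
      finally show ?thesis .
    qed
    moreover have "(\<Sum>d\<in>S. u d n) = (\<Sum>d\<in>S - ?D. u d n) + (\<Sum>d\<in>?D. u d n)" for n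
      by (rule sum.subset_diff[OF DS S])
    ultimately have "z n - (\<Sum>d\<in>?D. u d n) = (\<Sum>d\<in>S - ?D. u d n)" for n
      by (metis add_diff_cancel_right')
    moreover have "(\<Sum>d\<in>S - ?D. u d n) \<in> coboundaries Q N n" for n
      by (rule coboundaries_sum) (auto simp: HH_ring_ops class_family_eq_iff)
    ultimately show "X = finsum H (\<lambda>d. class_family (u d)) ?D"
      unfolding finsum_class_family(1)[OF D u refl] z(2) class_family_eq_iff by simp
  next
    fix c assume c: "(\<forall>n i. c (n, i) \<in> HH_comp Q N n i) \<and> finite {d. c d \<noteq> \<zero>\<^bsub>H\<^esub>} \<and> X = finsum H c {d. c d \<noteq> \<zero>\<^bsub>H\<^esub>}"
    let ?D = "{d. c d \<noteq> \<zero>\<^bsub>H\<^esub>}"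
    have "\<exists>v. v \<in> cocycles Q N (fst d) \<inter> cochains_bi Q N (fst d) (snd d) \<and> c d = class_family (single_family (fst d) v)" for d
    proof -
      have "c (fst d, snd d) \<in> HH_comp Q N (fst d) (snd d)" using c by blast
      then show ?thesis by (auto simp: HH_comp_eq)
    qed
    then have "\<exists>v. \<forall>d. v d \<in> cocycles Q N (fst d) \<inter> cochains_bi Q N (fst d) (snd d) \<and> c d = class_family (single_family (fst d) (v d))"
      by (intro choice allI)
    then obtain v where v: "\<And>d. v d \<in> cocycles Q N (fst d)" "\<And>d. v d \<in> cochains_bi Q N (fst d) (snd d)"
      "\<And>d. c d = class_family (single_family (fst d) (v d))" by blast
    have "class_family z = class_family (\<lambda>n. \<Sum>d\<in>?D. single_family (fst d) (v d) n)"
      using c z(2) finsum_class_family(1)[of ?D "\<lambda>d. single_family (fst d) (v d)" c] v(3) single_family_families[OF v(1)] by simp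
    then have diff: "z n - (\<Sum>d\<in>?D. single_family (fst d) (v d) n) \<in> coboundaries Q N n" for n
      unfolding class_family_eq_iff by blast
    show "c = (\<lambda>d. class_family (u d))"
    proof
      fix d :: "nat \<times> nat"
      obtain n i where d: "d = (n, i)" by (cases d)
      have "coch_part i (single_family (fst e) (v e) n) = (if e = d then v d else 0)" for e
        using coch_part_bi[OF v(2)[of e], of i] by (cases e) (auto simp: single_family_def part_rules d)
      then have "coch_part i (\<Sum>e\<in>?D. single_family (fst e) (v e) n) = (\<Sum>e\<in>?D. if e = d then v d else 0)"
        by (simp add: part_rules)
      also have "\<dots> = (if d \<in> ?D then v d else 0)" using c by (subst sum.delta) auto
      finally have "coch_part i (z n) - (if d \<in> ?D then v d else 0) \<in> coboundaries Q N n"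
        using coch_part_coboundaries[OF diff[of n], of i] by (simp only: part_rules)
      moreover have "v d \<in> coboundaries Q N n" if "d \<notin> ?D"
      proof -
        have "class_family (single_family n (v d)) = class_family (\<lambda>n. 0)" using that v(3)[of d] d by (simp add: HH_ring_ops)
        then have "single_family n (v d) n - 0 \<in> coboundaries Q N n" unfolding class_family_eq_iff by blast
        then show ?thesis by (simp add: single_family_def)
      qed
      ultimately have "coch_part i (z n) - v d \<in> coboundaries Q N n"
        using coboundaries_diff[of "coch_part i (z n)" n "v d"] by (auto split: if_splits)
      from coboundaries_minus[OF this] have "v d - coch_part i (z n) \<in> coboundaries Q N n" by simp
      then have "class_family (single_family n (v d)) = class_family (single_family n (coch_part i (z n)))"
        by (auto simp: class_family_eq_iff single_family_def coboundaries_0)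
      then show "c d = class_family (u d)" using v(3)[of d] by (simp add: d u_def)
    qed
  qed
qed

lemma bigrading_HH: "bigrading (H :: (nat \<Rightarrow> ('v, 'a, 'k::field_char_0) cochain set) ring) (HH_comp Q N)"
  unfolding bigrading_def
proof (intro conjI allI ballI)
  show "subgroup (HH_comp Q N n i) (add_monoid (H :: (nat \<Rightarrow> ('v, 'a, 'k) cochain set) ring))" for n i
    by (rule subgroup_HH_comp)
  show "\<exists>!c. (\<forall>n i. c (n, i) \<in> HH_comp Q N n i) \<and> finite {d. c d \<noteq> \<zero>\<^bsub>H\<^esub>} \<and> X = finsum H c {d. c d \<noteq> \<zero>\<^bsub>H\<^esub>}"
    if "X \<in> carrier H" for X :: "nat \<Rightarrow> ('v, 'a, 'k) cochain set"
    by (rule HH_decomposition[OF that])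
  fix m n i j and X Y :: "nat \<Rightarrow> ('v, 'a, 'k) cochain set"
  assume "X \<in> HH_comp Q N m i" "Y \<in> HH_comp Q N n j"
  then obtain f g where f: "f \<in> cocycles Q N m" "f \<in> cochains_bi Q N m i" "X = class_family (single_family m f)"
    and g: "g \<in> cocycles Q N n" "g \<in> cochains_bi Q N n j" "Y = class_family (single_family n g)" by (auto simp: HH_comp_eq)
  have "conv (single_family m f) (single_family n g) = single_family (m + n) (vee Q N m n f g)"
  proof
    fix k
    have "conv (single_family m f) (single_family n g) k = (\<Sum>i\<le>k. if i = m then (if k = m + n then vee Q N m n f g else 0) else 0)"
      unfolding conv_def by (intro sum.cong) (auto simp: single_family_def vee_rules)
    also have "\<dots> = single_family (m + n) (vee Q N m n f g) k" by (auto simp: sum.delta single_family_def)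
    finally show "conv (single_family m f) (single_family n g) k = single_family (m + n) (vee Q N m n f g) k" .
  qed
  then have "X \<otimes>\<^bsub>H\<^esub> Y = class_family (single_family (m + n) (vee Q N m n f g))"
    unfolding f(3) g(3) by (simp add: HH_ring_ops single_family_families f g)
  then show "X \<otimes>\<^bsub>H\<^esub> Y \<in> HH_comp Q N (m + n) (i + j)"
    using yoneda_vee(1)[OF f(1) g(1)] vee_cochains_bi[OF f(2) g(2)] by (auto simp: HH_comp_eq)
qed

end

theorem theorem7p8:
  fixes Q :: "('v, 'a) pre_digraph" and N :: nat
  assumes "fin_digraph Q" and "Digraph_Component.connected Q" and "N \<ge> 1"
  shows "(\<forall>m n. \<forall>f\<in>cocycles Q N m. \<forall>g\<in>cocycles Q N n.
            (vee Q N m n f g :: ('v, 'a, 'k::field_char_0) cochain) \<in> cocycles Q N (m + n) \<and>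
            yoneda Q N m n (coh_class Q N m f) (coh_class Q N n g) =
              coh_class Q N (m + n) (vee Q N m n f g))
       \<and> cring (HH_ring Q N :: (nat \<Rightarrow> ('v, 'a, 'k) cochain set) ring)
       \<and> bigrading (HH_ring Q N :: (nat \<Rightarrow> ('v, 'a, 'k) cochain set) ring) (HH_comp Q N)
       \<and> (\<forall>m n. odd m \<longrightarrow> odd n \<longrightarrow>
            (\<forall>X\<in>HH Q N m. \<forall>Y\<in>HH Q N n.
               yoneda Q N m n X Y = (coboundaries Q N (m + n) :: ('v, 'a, 'k) cochain set)))"
proof -
  interpret truncated_quiver Q N
    using assms by (intro truncated_quiver.intro truncated_quiver_axioms.intro)
  have "yoneda Q N m n X Y = coboundaries Q N (m + n)"
    if odd: "odd m" "odd n" and XY: "X \<in> HH Q N m" "Y \<in> HH Q N n" for m n and X Y :: "('v, 'a, 'k) cochain set"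
  proof -
    obtain f g where "f \<in> cocycles Q N m" "X = coh_class Q N m f" "g \<in> cocycles Q N n" "Y = coh_class Q N n g"
      using XY by (auto simp: HH_def)
    then show ?thesis by (simp add: yoneda_vee(2) vee_odd[OF odd] coh_class_0)
  qed
  then show ?thesis
    using yoneda_vee cring_HH bigrading_HH by blast
qed

end
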